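(* Let $(X,D)$ be a marked smooth projective curve and $r\ge2$. The group $\mathcal{T}$ of basic transformations (of rank $r$ quasi-parabolic vector bundles on $(X,D)$) is isomorphic to the semidirect product $$\mathcal{T}\cong\big((\mathbb{Z}^{|D|}\times\mathrm{Pic}(X))/\mathcal{G}_D\big)\rtimes\big(\mathrm{Aut}(X,D)\times\mathbb{Z}/2\mathbb{Z}\big),$$ where $$\mathcal{G}_D=\{(rH,\mathcal{O}_X(H))\mid H\text{ a divisor supported on }D\}<\mathbb{Z}^{|D|}\times\mathrm{Pic}(X).$$
   Context: A marked curve $(X,D)$ is an irreducible smooth complex projective curve $X$ with a finite set $D\subset X$ of $|D|\ge 1$ distinct points (also regarded as a reduced effective divisor). $\mathbb{Z}^{|D|}$ is identified with the group of divisors supported on $D$. $\mathrm{Aut}(X,D)$ is the group of automorphisms $\sigma$ of $X$ with $\sigma(D)=D$ (not necessarily pointwise). A (full flag) quasi-parabolic vector bundle $(E,E_\bullet)$ of rank $r$ on $(X,D)$ is a rank $r$ vector bundle $E$ with, for each $x\in D$, a full flag $E|_x=E_{x,1}\supsetneq\cdots\supsetneq E_{x,r}\supsetneq E_{x,r+1}=0$. Tensoring: $(E,E_\bullet)\otimes L$ has bundle $E\otimes L$ and flags $E_{x,i}\otimes L|_x$. Dual: $(E,E_\bullet)^\vee$ has bundle $E^\vee$ and flags $(E^\vee)_{x,i}=\mathrm{ann}(E_{x,r+2-i})$. Hecke transformation at $x\in D$: let $E_x^i=\ker(E\to E|_x/E_{x,i})$, so $E=E_x^1\supsetneq E_x^2\supsetneq\cdots\supsetneq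 E_x^{r+1}=E(-x)$ (this chain is equivalent to the flag at $x$); $\mathcal{H}_x(E,E_\bullet)$ has underlying bundle $E_x^2$, flag at $x$ given by the chain $E_x^2\supsetneq\cdots\supsetneq E_x^r\supsetneq E(-x)\supsetneq E_x^2(-x)$, and the flags of $E$ at the other points of $D$. $\mathcal{H}_H$ for $H=\sum h_xx\ge0$ is the composition of the commuting $\mathcal{H}_x^{h_x}$. A basic transformation is a tuple $T=(\sigma,s,L,H)$ with $\sigma\in\mathrm{Aut}(X,D)$, $s\in\{1,-1\}$, $L\in\mathrm{Pic}(X)$ and $H$ a divisor with $0\le H\le(r-1)D$; it acts by $T(E,E_\bullet)=\sigma^*(L\otimes\mathcal{H}_H(E,E_\bullet))$ if $s=1$ and $\sigma^*\big((L\otimes\mathcal{H}_H(E,E_\bullet))^\vee\big)$ if $s=-1$. The set $\mathcal{T}$ of these tuples is a group under composition. Explicitly, writing $\Sigma_\sigma=(\sigma,1,\mathcal{O}_X,0)$, $\mathcal{D}^-=(\mathrm{Id},-1,\mathcal{O}_X,0)$, $\mathcal{T}_L=(\mathrm{Id},1,L,0)$, $\mathcal{H}_H=(\mathrm{Id},1,\mathcal{O}_X,H)$, one has $(\sigma,1,L,H)=\Sigma_\sigma\mathcal{T}_L\mathcal{H}_H$, $(\sigma,-1,L,H)=\Sigma_\sigma\mathcal{D}^-\mathcal{T}_L\mathcal{H}_H$, and the product is determined by: $\Sigma_\sigma\Sigma_\tau=\Sigma_{\tau\circ\sigma}$; $(\mathcal{D}^-)^2=1$; $\mathcal{D}^-$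 commutes with $\Sigma_\sigma$; $\mathcal{T}_L\mathcal{T}_M=\mathcal{T}_{L\otimes M}$; the $\mathcal{H}_x$ commute with each other and with $\mathcal{T}_L$; $\mathcal{H}_x^r=\mathcal{T}_{\mathcal{O}_X(-x)}$; $\Sigma_\sigma\mathcal{T}_L=\mathcal{T}_{\sigma^*L}\Sigma_\sigma$; $\Sigma_\sigma\mathcal{H}_H=\mathcal{H}_{\sigma^*H}\Sigma_\sigma$; $\mathcal{D}^-\mathcal{T}_L=\mathcal{T}_{L^{-1}}\mathcal{D}^-$; $\mathcal{D}^-\mathcal{H}_x=\mathcal{H}_x^{-1}\mathcal{D}^-$. In the semidirect product, the action is the one induced by these rules: $\sigma\in\mathrm{Aut}(X,D)$ acts on $(H,L)$ by $((\sigma^{-1})^*H,(\sigma^{-1})^*L)$ and the generator of $\mathbb{Z}/2\mathbb{Z}$ acts by inversion. *)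

theory Defs
  imports
    "HOL-Analysis.Analysis"
    "HOL-Algebra.Bij"
    "HOL-Algebra.Elementary_Groups"
    "HOL-Algebra.Free_Abelian_Groups"
begin

section \<open>Projective space and the Zariski topology\<close>

text \<open>
  Varieties are classical: sets of closed points, with regular functions being complex-valued
  functions on these points. A point of the projective space of dimension \<open>CARD('n) - 1\<close> is a line
  through the origin of \<open>complex ^ 'n\<close>, so that equality of points is equality in HOL.
\<close>

type_synonym 'n point = "(complex ^ 'n) set"

definition proj_space :: "'n::finite point set" where
  "proj_space = {vec.span {v} | v. v \<noteq> 0}"

text \<open>Homogeneous polynomials, as polynomial functions (the ground field is infinite).\<close>

inductive homogeneous :: "nat \<Rightarrow> (complex ^ 'n::finite \<Rightarrow> complex) \<Rightarrow> bool" where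
  const: "homogeneous 0 (\<lambda>v. c)"
| coord: "homogeneous 1 (\<lambda>v. v $ i)"
| add: "homogeneous d f \<Longrightarrow> homogeneous d g \<Longrightarrow> homogeneous d (\<lambda>v. f v + g v)"
| mult: "homogeneous d f \<Longrightarrow> homogeneous e g \<Longrightarrow> homogeneous (d + e) (\<lambda>v. f v * g v)"

lemma homogeneous_scale: "homogeneous d f \<Longrightarrow> f (c *s v) = c ^ d * f v"
  by (induction rule: homogeneous.induct) (auto simp: algebra_simps power_add)

definition zariski_open :: "'n::finite point set \<Rightarrow> bool" where
  "zariski_open U \<longleftrightarrow>
     (\<exists>F. (\<forall>f\<in>F. \<exists>d. homogeneous d f) \<and> U = {p \<in> proj_space. \<exists>f\<in>F. \<exists>v\<in>p. f v \<noteq> 0})"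

lemma istopology_zariski_open: "istopology (zariski_open :: 'n::finite point set \<Rightarrow> bool)"
  unfolding istopology_def
proof (intro conjI allI impI)
  fix U V :: "'n point set"
  assume "zariski_open U" "zariski_open V"
  then obtain F G where F: "\<forall>f\<in>F. \<exists>d. homogeneous d f"
      and U: "U = {p \<in> proj_space. \<exists>f\<in>F. \<exists>v\<in>p. f v \<noteq> 0}"
      and G: "\<forall>f\<in>G. \<exists>d. homogeneous d f"
      and V: "V = {p \<in> proj_space. \<exists>f\<in>G. \<exists>v\<in>p. f v \<noteq> 0}"
    unfolding zariski_open_def by blast
  define K where "K = {(\<lambda>v. f v * g v) | f g. f \<in> F \<and> g \<in> G}"
  have K: "\<forall>f\<in>K. \<exists>d. homogeneous d f"
    unfolding K_def using F G homogeneous.mult by blast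
  have "U \<inter> V = {p \<in> proj_space. \<exists>f\<in>K. \<exists>v\<in>p. f v \<noteq> 0}" (is "_ = ?R")
  proof (intro equalityI subsetI)
    fix p assume p: "p \<in> U \<inter> V"
    then obtain f g a b where fg: "f \<in> F" "g \<in> G" "a \<in> p" "b \<in> p" "f a \<noteq> 0" "g b \<noteq> 0"
      and P: "p \<in> proj_space" unfolding U V by blast
    from P obtain w where w: "p = vec.span {w}" unfolding proj_space_def by blast
    obtain c e where ce: "a = c *s w" "b = e *s w"
      using fg(3,4) w by (auto simp: vec.span_singleton)
    obtain m n where mn: "homogeneous m f" "homogeneous n g" using F G fg by blast
    have "f w \<noteq> 0" "g w \<noteq> 0"
      using fg(5,6) ce homogeneous_scale[OF mn(1)] homogeneous_scale[OF mn(2)] by auto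
    then have nz: "f w * g w \<noteq> 0" by simp
    have wp: "w \<in> p" using w by (simp add: vec.span_base)
    have fgK: "(\<lambda>v. f v * g v) \<in> K" unfolding K_def using fg by blast
    show "p \<in> ?R"
      by (rule CollectI, rule conjI[OF P], rule bexI[OF _ fgK], rule bexI[OF _ wp], rule nz)
  next
    fix p assume "p \<in> ?R"
    then obtain k v where k: "k \<in> K" and v: "p \<in> proj_space" "v \<in> p" "k v \<noteq> 0" by blast
    from k obtain f g where fg: "f \<in> F" "g \<in> G" "k = (\<lambda>v. f v * g v)" unfolding K_def by blast
    from v(3) fg(3) have "f v \<noteq> 0" "g v \<noteq> 0" by simp_all
    with v(1,2) fg(1,2) show "p \<in> U \<inter> V" unfolding U V by blast
  qed
  with K show "zariski_open (U \<inter> V)" unfolding zariski_open_def by blast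
next
  fix \<U> :: "'n point set set"
  assume op: "\<forall>U\<in>\<U>. zariski_open U"
  define K where "K = {f. (\<exists>d. homogeneous d f) \<and> {p \<in> proj_space. \<exists>v\<in>p. f v \<noteq> 0} \<subseteq> \<Union>\<U>}"
  have "\<Union>\<U> = {p \<in> proj_space. \<exists>f\<in>K. \<exists>v\<in>p. f v \<noteq> 0}" (is "_ = ?R")
  proof (intro equalityI subsetI)
    fix p assume "p \<in> \<Union>\<U>"
    then obtain U where U: "U \<in> \<U>" "p \<in> U" by (rule UnionE)
    from op U(1) have "zariski_open U" by (rule bspec)
    then obtain F where F: "\<forall>f\<in>F. \<exists>d. homogeneous d f"
        and Ueq: "U = {p \<in> proj_space. \<exists>f\<in>F. \<exists>v\<in>p. f v \<noteq> 0}"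
      unfolding zariski_open_def by (elim exE conjE)
    from U(2) obtain f v where p: "p \<in> proj_space" and f: "f \<in> F" and v: "v \<in> p" "f v \<noteq> 0"
      unfolding Ueq by (elim CollectE conjE bexE)
    have "{p \<in> proj_space. \<exists>v\<in>p. f v \<noteq> 0} \<subseteq> U"
      unfolding Ueq using f by (intro Collect_mono impI conjI) (elim conjE, assumption, elim conjE, rule bexI[of _ f])
    with U(1) have "{p \<in> proj_space. \<exists>v\<in>p. f v \<noteq> 0} \<subseteq> \<Union>\<U>" by (meson Union_upper subset_trans)
    with bspec[OF F f] have "f \<in> K" unfolding K_def by (intro CollectI conjI)
    with p v show "p \<in> ?R" by (intro CollectI conjI bexI)
  next
    fix p assume "p \<in> ?R"
    then obtain f v where f: "f \<in> K" and p: "p \<in> proj_space" "v \<in> p" "f v \<noteq> 0"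
      by (elim CollectE conjE bexE)
    from f have "{p \<in> proj_space. \<exists>v\<in>p. f v \<noteq> 0} \<subseteq> \<Union>\<U>"
      unfolding K_def by (elim CollectE conjE)
    moreover have "p \<in> {p \<in> proj_space. \<exists>v\<in>p. f v \<noteq> 0}"
      using p by (intro CollectI conjI bexI)
    ultimately show "p \<in> \<Union>\<U>" by (rule subsetD)
  qed
  moreover have "\<forall>f\<in>K. \<exists>d. homogeneous d f" unfolding K_def by simp
  ultimately show "zariski_open (\<Union>\<U>)"
    unfolding zariski_open_def by (intro exI[of _ K] conjI)
qed

definition proj_zariski :: "'n::finite point topology" where
  "proj_zariski = topology zariski_open"

abbreviation zariski :: "'n::finite point set \<Rightarrow> 'n point topology" where
  "zariski X \<equiv> subtopology proj_zariski X"

lemma openin_proj_zariski: "openin proj_zariski = zariski_open"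
  unfolding proj_zariski_def using istopology_zariski_open topology_inverse' by blast

lemma topspace_proj_zariski:
  "topspace (proj_zariski :: 'n::finite point topology) = proj_space"
proof -
  have "zariski_open (proj_space :: 'n point set)"
    unfolding zariski_open_def
  proof (intro exI conjI)
    show "\<forall>f\<in>{\<lambda>v. 1}. \<exists>d. homogeneous d f" by (auto intro: homogeneous.const)
    show "(proj_space :: 'n point set) =
        {p \<in> proj_space. \<exists>f\<in>{\<lambda>v. 1}. \<exists>v\<in>p. f v \<noteq> (0::complex)}"
      by (auto simp: proj_space_def intro: vec.span_base)
  qed
  moreover have "U \<subseteq> proj_space" if "zariski_open U" for U :: "'n point set"
    using that unfolding zariski_open_def by blast
  ultimately show ?thesis unfolding topspace_def openin_proj_zariski by blast
qed

definition irreducible_in :: "'a topology \<Rightarrow> 'a set \<Rightarrow> bool" where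
  "irreducible_in T S \<longleftrightarrow> S \<subseteq> topspace T \<and> S \<noteq> {} \<and>
     (\<forall>A B. closedin T A \<and> closedin T B \<and> S \<subseteq> A \<union> B \<longrightarrow> S \<subseteq> A \<or> S \<subseteq> B)"

definition irreducible_chain :: "'a topology \<Rightarrow> nat \<Rightarrow> bool" where
  "irreducible_chain T d \<longleftrightarrow> (\<exists>Z. (\<forall>i\<le>d. closedin T (Z i) \<and> irreducible_in T (Z i)) \<and>
     (\<forall>i<d. Z i \<subset> Z (Suc i)))"

definition has_krull_dim :: "'a topology \<Rightarrow> nat \<Rightarrow> bool" where
  "has_krull_dim T d \<longleftrightarrow> irreducible_chain T d \<and> \<not> irreducible_chain T (Suc d)"


section \<open>Regular functions and smooth projective curves\<close>

definition regular_on ::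
  "'n::finite point set \<Rightarrow> 'n point set \<Rightarrow> ('n point \<Rightarrow> complex) \<Rightarrow> bool" where
  "regular_on X U f \<longleftrightarrow> (\<forall>p\<in>U. \<exists>V d a b. openin (zariski X) V \<and> p \<in> V \<and> V \<subseteq> U \<and>
     homogeneous d a \<and> homogeneous d b \<and>
     (\<forall>q\<in>V. \<forall>v\<in>q. v \<noteq> 0 \<longrightarrow> b v \<noteq> 0 \<and> f q = a v / b v))"

text \<open>Units of the ring of regular functions.\<close>

definition unit_on ::
  "'n::finite point set \<Rightarrow> 'n point set \<Rightarrow> ('n point \<Rightarrow> complex) \<Rightarrow> bool" where
  "unit_on X U f \<longleftrightarrow> regular_on X U f \<and> (\<forall>p\<in>U. f p \<noteq> 0)"

text \<open>
  A function whose germ at \<open>p\<close> generates the maximal ideal of the local ring of \<open>X\<close> at \<open>p\<close>;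
  germs are spelled out by shrinking neighbourhoods.
\<close>

definition uniformizer ::
  "'n::finite point set \<Rightarrow> 'n point \<Rightarrow> 'n point set \<Rightarrow> ('n point \<Rightarrow> complex) \<Rightarrow> bool" where
  "uniformizer X p U t \<longleftrightarrow> openin (zariski X) U \<and> p \<in> U \<and> regular_on X U t \<and> t p = 0 \<and>
     (\<forall>V f. openin (zariski X) V \<and> p \<in> V \<and> regular_on X V f \<and> f p = 0 \<longrightarrow>
        (\<exists>W g. openin (zariski X) W \<and> p \<in> W \<and> W \<subseteq> U \<inter> V \<and> regular_on X W g \<and>
           (\<forall>q\<in>W. f q = g q * t q)))"

text \<open>
  Smoothness is regularity of all local rings. The dimension of each of them is 1, hence
  regularity means that the maximal ideal is generated by one element.
\<close>

definition smooth_projective_curve :: "'n::finite point set \<Rightarrow> bool" where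
  "smooth_projective_curve X \<longleftrightarrow>
     closedin proj_zariski X \<and> irreducible_in proj_zariski X \<and> has_krull_dim (zariski X) 1 \<and>
     (\<forall>p\<in>X. \<exists>U t. uniformizer X p U t)"

definition marked_curve :: "'n::finite point set \<Rightarrow> 'n point set \<Rightarrow> bool" where
  "marked_curve X D \<longleftrightarrow> smooth_projective_curve X \<and> D \<subseteq> X \<and> finite D \<and> D \<noteq> {}"

definition endomorphism :: "'n::finite point set \<Rightarrow> ('n point \<Rightarrow> 'n point) \<Rightarrow> bool" where
  "endomorphism X \<sigma> \<longleftrightarrow> continuous_map (zariski X) (zariski X) \<sigma> \<and>
     (\<forall>V f. openin (zariski X) V \<and> regular_on X V f \<longrightarrow>
        regular_on X {q \<in> X. \<sigma> q \<in> V} (f \<circ> \<sigma>))"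

text \<open>The group of automorphisms \<open>\<sigma>\<close> with \<open>\<sigma>(D) = D\<close>; the product of \<open>\<sigma>\<close> and \<open>\<tau>\<close> is \<open>\<sigma> \<circ> \<tau>\<close>.\<close>

definition aut_group ::
  "'n::finite point set \<Rightarrow> 'n point set \<Rightarrow> ('n point \<Rightarrow> 'n point) monoid" where
  "aut_group X D = BijGroup X
     \<lparr>carrier := {\<sigma> \<in> Bij X. endomorphism X \<sigma> \<and> endomorphism X (inv_into X \<sigma>) \<and> \<sigma> ` D = D}\<rparr>"


section \<open>Line bundles and the Picard group\<close>

text \<open>
  A line bundle is given by a trivializing cover \<open>U\<close> and transition functions \<open>g\<close>. The cover is
  indexed by the points of \<open>X\<close>, with \<open>x \<in> U x\<close>; every line bundle has such a trivializing cover.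
  The transition functions are normalized so that a section is a family of regular functions \<open>s x\<close>
  on \<open>U x\<close> with \<open>s x = g x y * s y\<close> on \<open>U x \<inter> U y\<close>.
\<close>

type_synonym 'n line_bundle =
  "('n point \<Rightarrow> 'n point set) \<times> ('n point \<Rightarrow> 'n point \<Rightarrow> 'n point \<Rightarrow> complex)"

fun line_bundle :: "'n::finite point set \<Rightarrow> 'n line_bundle \<Rightarrow> bool" where
  "line_bundle X (U, g) \<longleftrightarrow>
     (\<forall>x\<in>X. openin (zariski X) (U x) \<and> x \<in> U x) \<and>
     (\<forall>x\<in>X. \<forall>y\<in>X. unit_on X (U x \<inter> U y) (g x y)) \<and>
     (\<forall>x\<in>X. \<forall>y\<in>X. \<forall>z\<in>X. \<forall>q \<in> U x \<inter> U y \<inter> U z. g x z q = g x y q * g y z q)"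

text \<open>An isomorphism is given, over a common refinement \<open>W\<close>, by \<open>s x \<mapsto> l x * s x\<close>.\<close>

fun line_bundle_iso :: "'n::finite point set \<Rightarrow> 'n line_bundle \<Rightarrow> 'n line_bundle \<Rightarrow> bool" where
  "line_bundle_iso X (U, g) (V, h) \<longleftrightarrow>
     (\<exists>W l. (\<forall>x\<in>X. openin (zariski X) (W x) \<and> x \<in> W x \<and> W x \<subseteq> U x \<inter> V x \<and>
              unit_on X (W x) (l x)) \<and>
        (\<forall>x\<in>X. \<forall>y\<in>X. \<forall>q \<in> W x \<inter> W y. h x y q * l y q = l x q * g x y q))"

definition line_bundle_equiv :: "'n::finite point set \<Rightarrow> ('n line_bundle \<times> 'n line_bundle) set" where
  "line_bundle_equiv X = {(a, b). line_bundle X a \<and> line_bundle X b \<and> line_bundle_iso X a b}"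

fun line_bundle_tensor :: "'n line_bundle \<Rightarrow> 'n line_bundle \<Rightarrow> 'n line_bundle" where
  "line_bundle_tensor (U, g) (V, h) = (\<lambda>x. U x \<inter> V x, \<lambda>x y q. g x y q * h x y q)"

definition line_bundle_trivial :: "'n point set \<Rightarrow> 'n line_bundle" where
  "line_bundle_trivial X = (\<lambda>x. X, \<lambda>x y q. 1)"

fun line_bundle_pullback ::
  "'n point set \<Rightarrow> ('n point \<Rightarrow> 'n point) \<Rightarrow> 'n line_bundle \<Rightarrow> 'n line_bundle" where
  "line_bundle_pullback X \<sigma> (U, g) =
     (\<lambda>x. {q \<in> X. \<sigma> q \<in> U (\<sigma> x)}, \<lambda>x y q. g (\<sigma> x) (\<sigma> y) (\<sigma> q))"

definition Pic :: "'n::finite point set \<Rightarrow> 'n line_bundle set monoid" where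
  "Pic X = \<lparr>carrier = {a. line_bundle X a} // line_bundle_equiv X,
     monoid.mult = (\<lambda>A B. line_bundle_equiv X `` {line_bundle_tensor a b | a b. a \<in> A \<and> b \<in> B}),
     one = line_bundle_equiv X `` {line_bundle_trivial X}\<rparr>"

definition Pic_pullback ::
  "'n::finite point set \<Rightarrow> ('n point \<Rightarrow> 'n point) \<Rightarrow> 'n line_bundle set \<Rightarrow> 'n line_bundle set" where
  "Pic_pullback X \<sigma> A = line_bundle_equiv X `` (line_bundle_pullback X \<sigma> ` A)"


section \<open>Divisors\<close>

text \<open>
  The group of divisors supported on \<open>D\<close> is \<^term>\<open>free_Abelian_group D\<close>. For an automorphism,
  \<open>\<sigma>\<^sup>* x = \<sigma>\<^sup>-\<^sup>1(x)\<close>.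
\<close>

definition div_pullback ::
  "'n point set \<Rightarrow> ('n point \<Rightarrow> 'n point) \<Rightarrow> ('n point \<Rightarrow>\<^sub>0 int) \<Rightarrow> ('n point \<Rightarrow>\<^sub>0 int)" where
  "div_pullback X \<sigma> H = frag_extend (\<lambda>x. frag_of (inv_into X \<sigma> x)) H"

text \<open>
  \<open>f\<close> is a rational function, evaluated away from the support of \<open>H\<close>, whose divisor on \<open>U\<close> is \<open>H\<close>:
  near each \<open>p\<close> it is a unit times the \<open>H(p)\<close>-th power of a uniformizer.
\<close>

definition local_equation ::
  "'n::finite point set \<Rightarrow> ('n point \<Rightarrow>\<^sub>0 int) \<Rightarrow> 'n point set \<Rightarrow> ('n point \<Rightarrow> complex) \<Rightarrow> bool" where
  "local_equation X H U f \<longleftrightarrow> (\<forall>p\<in>U. \<exists>W t u. W \<subseteq> U \<and> uniformizer X p W t \<and> unit_on X W u \<and>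
     (\<forall>q \<in> W - Poly_Mapping.keys H. f q = u q * t q powi Poly_Mapping.lookup H p))"

text \<open>
  The class of \<open>\<O>\<^sub>X(H)\<close>, whose sections are the rational functions \<open>\<phi>\<close> with \<open>div \<phi> + H \<ge> 0\<close>. If
  \<open>f x\<close> is a local equation of \<open>H\<close> on \<open>U x\<close>, then \<open>\<phi> \<mapsto> \<phi> * f x\<close> trivializes it over \<open>U x\<close>, so the
  transition functions are \<open>f x / f y\<close>.
\<close>

fun divisor_cocycle :: "'n::finite point set \<Rightarrow> ('n point \<Rightarrow>\<^sub>0 int) \<Rightarrow> 'n line_bundle \<Rightarrow> bool" where
  "divisor_cocycle X H (U, g) \<longleftrightarrow> line_bundle X (U, g) \<and>
     (\<exists>f. (\<forall>x\<in>X. local_equation X H (U x) (f x)) \<and>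
        (\<forall>x\<in>X. \<forall>y\<in>X. \<forall>q \<in> U x \<inter> U y - Poly_Mapping.keys H. g x y q = f x q / f y q))"

definition divisor_bundle ::
  "'n::finite point set \<Rightarrow> ('n point \<Rightarrow>\<^sub>0 int) \<Rightarrow> 'n line_bundle set" where
  "divisor_bundle X H = line_bundle_equiv X `` {a. divisor_cocycle X H a}"


section \<open>Basic transformations\<close>

text \<open>The tuples \<open>(\<sigma>, s, L, H)\<close>, with \<open>L\<close> an isomorphism class of line bundles.\<close>

type_synonym 'n basic_transformation =
  "('n point \<Rightarrow> 'n point) \<times> int \<times> 'n line_bundle set \<times> ('n point \<Rightarrow>\<^sub>0 int)"

definition hecke_divisors :: "'n point set \<Rightarrow> nat \<Rightarrow> ('n point \<Rightarrow>\<^sub>0 int) set" where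
  "hecke_divisors D r = {H \<in> carrier (free_Abelian_group D).
     \<forall>x\<in>D. 0 \<le> Poly_Mapping.lookup H x \<and> Poly_Mapping.lookup H x \<le> int r - 1}"

definition basic_transformations ::
  "'n::finite point set \<Rightarrow> 'n point set \<Rightarrow> nat \<Rightarrow> 'n basic_transformation set" where
  "basic_transformations X D r =
     carrier (aut_group X D) \<times> {1, -1} \<times> carrier (Pic X) \<times> hecke_divisors D r"

definition bt_pullback ::
  "'n::finite point set \<Rightarrow> ('n point \<Rightarrow> 'n point) \<Rightarrow> 'n basic_transformation" where
  "bt_pullback X \<sigma> = (\<sigma>, 1, \<one>\<^bsub>Pic X\<^esub>, 0)"

definition bt_dual :: "'n::finite point set \<Rightarrow> 'n basic_transformation" where
  "bt_dual X = (\<lambda>x\<in>X. x, -1, \<one>\<^bsub>Pic X\<^esub>, 0)"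

definition bt_twist :: "'n::finite point set \<Rightarrow> 'n line_bundle set \<Rightarrow> 'n basic_transformation" where
  "bt_twist X L = (\<lambda>x\<in>X. x, 1, L, 0)"

definition bt_hecke :: "'n::finite point set \<Rightarrow> ('n point \<Rightarrow>\<^sub>0 int) \<Rightarrow> 'n basic_transformation" where
  "bt_hecke X H = (\<lambda>x\<in>X. x, 1, \<one>\<^bsub>Pic X\<^esub>, H)"

text \<open>
  The group of basic transformations: the group structure on the set of tuples which is determined
  by the rules for composing pullbacks, dualization, twists and Hecke transformations. The rule
  \<open>hecke_add\<close> says that \<open>\<H>\<^sub>H\<close> is the composition of the \<open>\<H>\<^sub>x\<close>, each taken \<open>H(x)\<close> times.
\<close>

locale basic_transformation_group = group T
  for X :: "'n::finite point set" and D :: "'n point set" and r :: nat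
    and T :: "'n basic_transformation monoid" (structure) +
  assumes carrier_eq: "carrier T = basic_transformations X D r"
    and normal_form_plus:
      "\<lbrakk>\<sigma> \<in> carrier (aut_group X D); L \<in> carrier (Pic X); H \<in> hecke_divisors D r\<rbrakk> \<Longrightarrow>
        (\<sigma>, 1, L, H) = bt_pullback X \<sigma> \<otimes> bt_twist X L \<otimes> bt_hecke X H"
    and normal_form_minus:
      "\<lbrakk>\<sigma> \<in> carrier (aut_group X D); L \<in> carrier (Pic X); H \<in> hecke_divisors D r\<rbrakk> \<Longrightarrow>
        (\<sigma>, -1, L, H) = bt_pullback X \<sigma> \<otimes> bt_dual X \<otimes> bt_twist X L \<otimes> bt_hecke X H"
    and hecke_add:
      "\<lbrakk>H \<in> hecke_divisors D r; H' \<in> hecke_divisors D r; H + H' \<in> hecke_divisors D r\<rbrakk> \<Longrightarrow>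
        bt_hecke X (H + H') = bt_hecke X H \<otimes> bt_hecke X H'"
    and pullback_pullback:
      "\<lbrakk>\<sigma> \<in> carrier (aut_group X D); \<tau> \<in> carrier (aut_group X D)\<rbrakk> \<Longrightarrow>
        bt_pullback X \<sigma> \<otimes> bt_pullback X \<tau> = bt_pullback X (\<tau> \<otimes>\<^bsub>aut_group X D\<^esub> \<sigma>)"
    and dual_dual: "bt_dual X \<otimes> bt_dual X = \<one>"
    and dual_pullback:
      "\<sigma> \<in> carrier (aut_group X D) \<Longrightarrow> bt_dual X \<otimes> bt_pullback X \<sigma> = bt_pullback X \<sigma> \<otimes> bt_dual X"
    and twist_twist:
      "\<lbrakk>L \<in> carrier (Pic X); M \<in> carrier (Pic X)\<rbrakk> \<Longrightarrow>
        bt_twist X L \<otimes> bt_twist X M = bt_twist X (L \<otimes>\<^bsub>Pic X\<^esub> M)"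
    and hecke_hecke:
      "\<lbrakk>x \<in> D; y \<in> D\<rbrakk> \<Longrightarrow>
        bt_hecke X (frag_of x) \<otimes> bt_hecke X (frag_of y) =
        bt_hecke X (frag_of y) \<otimes> bt_hecke X (frag_of x)"
    and hecke_twist:
      "\<lbrakk>x \<in> D; L \<in> carrier (Pic X)\<rbrakk> \<Longrightarrow>
        bt_hecke X (frag_of x) \<otimes> bt_twist X L = bt_twist X L \<otimes> bt_hecke X (frag_of x)"
    and hecke_power:
      "x \<in> D \<Longrightarrow> bt_hecke X (frag_of x) [^] r = bt_twist X (divisor_bundle X (- frag_of x))"
    and pullback_twist:
      "\<lbrakk>\<sigma> \<in> carrier (aut_group X D); L \<in> carrier (Pic X)\<rbrakk> \<Longrightarrow>
        bt_pullback X \<sigma> \<otimes> bt_twist X L = bt_twist X (Pic_pullback X \<sigma> L) \<otimes> bt_pullback X \<sigma>"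
    and pullback_hecke:
      "\<lbrakk>\<sigma> \<in> carrier (aut_group X D); H \<in> hecke_divisors D r\<rbrakk> \<Longrightarrow>
        bt_pullback X \<sigma> \<otimes> bt_hecke X H = bt_hecke X (div_pullback X \<sigma> H) \<otimes> bt_pullback X \<sigma>"
    and dual_twist:
      "L \<in> carrier (Pic X) \<Longrightarrow> bt_dual X \<otimes> bt_twist X L = bt_twist X (inv\<^bsub>Pic X\<^esub> L) \<otimes> bt_dual X"
    and dual_hecke:
      "x \<in> D \<Longrightarrow>
        bt_dual X \<otimes> bt_hecke X (frag_of x) = inv (bt_hecke X (frag_of x)) \<otimes> bt_dual X"


section \<open>The semidirect product\<close>

definition semidirect_product ::
  "('a, 'c) monoid_scheme \<Rightarrow> ('b, 'd) monoid_scheme \<Rightarrow> ('b \<Rightarrow> 'a \<Rightarrow> 'a) \<Rightarrow> ('a \<times> 'b) monoid" where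
  "semidirect_product N Q \<phi> = \<lparr>carrier = carrier N \<times> carrier Q,
     monoid.mult = (\<lambda>(n, q) (n', q'). (n \<otimes>\<^bsub>N\<^esub> \<phi> q n', q \<otimes>\<^bsub>Q\<^esub> q')),
     one = (\<one>\<^bsub>N\<^esub>, \<one>\<^bsub>Q\<^esub>)\<rparr>"

definition twisting_subgroup ::
  "'n::finite point set \<Rightarrow> 'n point set \<Rightarrow> nat \<Rightarrow> (('n point \<Rightarrow>\<^sub>0 int) \<times> 'n line_bundle set) set" where
  "twisting_subgroup X D r =
     {(frag_cmul (int r) H, divisor_bundle X H) | H. H \<in> carrier (free_Abelian_group D)}"

definition twisting_quotient ::
  "'n::finite point set \<Rightarrow> 'n point set \<Rightarrow> nat \<Rightarrow>
    (('n point \<Rightarrow>\<^sub>0 int) \<times> 'n line_bundle set) set monoid" where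
  "twisting_quotient X D r = (free_Abelian_group D \<times>\<times> Pic X) Mod twisting_subgroup X D r"

text \<open>
  The action on cosets induced by \<open>((\<sigma>\<^sup>-\<^sup>1)\<^sup>* H, (\<sigma>\<^sup>-\<^sup>1)\<^sup>* L)\<close> and, for the generator of the group of
  order two, inversion.
\<close>

definition twisting_action ::
  "'n::finite point set \<Rightarrow> 'n point set \<Rightarrow> nat \<Rightarrow> ('n point \<Rightarrow> 'n point) \<times> int \<Rightarrow>
    (('n point \<Rightarrow>\<^sub>0 int) \<times> 'n line_bundle set) set \<Rightarrow>
    (('n point \<Rightarrow>\<^sub>0 int) \<times> 'n line_bundle set) set" where
  "twisting_action X D r = (\<lambda>(\<sigma>, e) C.
     let \<sigma>' = inv\<^bsub>aut_group X D\<^esub> \<sigma>;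
         C' = (\<lambda>(H, L). (div_pullback X \<sigma>' H, Pic_pullback X \<sigma>' L)) ` C
     in if e = 0 then C' else inv\<^bsub>twisting_quotient X D r\<^esub> C')"

end

theory Submission
  imports Defs
begin

text \<open>
  Let \<open>A\<close> be the product of the group of divisors supported on \<open>D\<close> and the Picard group, and \<open>N\<close> its
  subgroup of the relations \<open>(r H, \<O>\<^sub>X(H))\<close>. The rules for Hecke transformations and twists say that
  they commute with each other and that \<open>\<H>\<^sub>x\<^sup>r = \<T>\<^bsub>\<O>(-x)\<^esub>\<close>, so that together they give a homomorphism
  from \<open>A\<close> which is trivial on \<open>N\<close>. Pullbacks and dualization form the group of symmetries, and the
  remaining rules describe how they conjugate Hecke transformations and twists. So every group
  obeying the rules receives a
  homomorphism from the semidirect product of \<open>A / N\<close> by the symmetries.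

  This homomorphism is bijective because of a normal form. By division with remainder by \<open>r\<close>, each class in
  \<open>A / N\<close> has exactly one representative \<open>(H, L)\<close> with \<open>0 \<le> H \<le> (r - 1) D\<close>. Hence the elements of the
  semidirect product correspond to the tuples \<open>(\<sigma>, s, L, H)\<close> (\<open>bij_betw_normal_form\<close>). On the other side, the
  elements of the group of transformations are these tuples by definition, and two of the rules
  express each tuple as the corresponding product of generators. Conversely, carrying the
  semidirect product over to the tuples by this bijection gives a group that obeys the rules
  (\<open>basic_transformation_group_exists\<close>, \<open>iso_semidirect\<close>).

  All this presupposes that the semidirect product makes sense, and here geometry enters: the
  line bundles form an abelian group, \<open>H \<mapsto> \<O>\<^sub>X(H)\<close> is a well-defined homomorphism
  (\<open>divisor_bundle_add\<close>), and it commutes with pullback by automorphisms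
  (\<open>Pic_pullback_divisor_bundle\<close>). For the homomorphism property, local parameters are fixed once for all
  divisors on \<open>D\<close>, and the resulting cocycles are multiplicative in \<open>H\<close>. For well-definedness, two local
  equations of \<open>H\<close> must differ by a unit. This comes down to the fact that two uniformizers at a point
  differ by a unit (\<open>uniformizers_differ_by_unit\<close>); the only obstruction would be a
  uniformizer vanishing identically near the point, but zeros of uniformizers are isolated
  (\<open>uniformizer_isolated_zero\<close>), so the point would be open in \<open>X\<close>, against irreducibility and
  dimension one.
\<close>

abbreviation "div_supp \<equiv> Poly_Mapping.keys"
abbreviation "div_coeff \<equiv> Poly_Mapping.lookup"

section \<open>Points and closed sets of projective space\<close>

lemma proj_spaceE:
  assumes "p \<in> proj_space"
  obtains w where "w \<in> p" "w \<noteq> 0"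
  using assms unfolding proj_space_def by (auto intro: vec.span_base)

lemma point_eq_span:
  assumes "p \<in> proj_space" "v \<in> p" "v \<noteq> 0"
  shows "p = vec.span {v}"
proof -
  obtain w where w: "p = vec.span {w}" "w \<noteq> 0" using assms(1) unfolding proj_space_def by blast
  then obtain c where c: "v = c *s w" using assms(2) by (auto simp: vec.span_singleton)
  with assms(3) have "c \<noteq> 0" by auto
  then have "w = (1 / c) *s v" using c by (simp add: vector_smult_assoc)
  then have "w \<in> vec.span {v}" by (metis vec.span_base vec.span_scale singletonI)
  then have "vec.span {w} \<subseteq> vec.span {v}" by (intro vec.span_minimal vec.subspace_span) simp
  moreover have "vec.span {v} \<subseteq> vec.span {w}"
    using assms(2) w(1) by (intro vec.span_minimal vec.subspace_span) simp
  ultimately show ?thesis using w(1) by simp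
qed

lemma point_scale:
  assumes "p \<in> proj_space" "v \<in> p" "v \<noteq> 0" "v' \<in> p"
  obtains c where "v' = c *s v"
proof -
  have "v' \<in> vec.span {v}" using point_eq_span[OF assms(1-3)] assms(4) by simp
  then show ?thesis using that by (auto simp: vec.span_singleton)
qed

lemma homogeneous_nonzero_iff:
  assumes "homogeneous d f" "p \<in> proj_space" "v \<in> p" "v \<noteq> 0"
  shows "f v \<noteq> 0 \<longleftrightarrow> (\<exists>u\<in>p. f u \<noteq> 0)"
proof
  assume "\<exists>u\<in>p. f u \<noteq> 0"
  then obtain u where u: "u \<in> p" "f u \<noteq> 0" by blast
  obtain c where "u = c *s v" using point_scale[OF assms(2-4) u(1)] .
  then show "f v \<noteq> 0" using u(2) homogeneous_scale[OF assms(1)] by auto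
qed (use assms(3) in blast)

lemma openin_zariski_subset: "openin (zariski X) U \<Longrightarrow> U \<subseteq> X \<inter> proj_space"
  using openin_subset topspace_proj_zariski topspace_subtopology by (metis inf_commute)

lemma openin_zariski_nonvanishing:
  assumes "homogeneous d f"
  shows "openin (zariski X) {q \<in> X \<inter> proj_space. \<exists>v\<in>q. f v \<noteq> 0}"
proof -
  have "openin proj_zariski {q \<in> proj_space. \<exists>v\<in>q. f v \<noteq> 0}"
    unfolding openin_proj_zariski zariski_open_def
    by (rule exI[of _ "{f}"]) (use assms in auto)
  moreover have "{q \<in> X \<inter> proj_space. \<exists>v\<in>q. f v \<noteq> 0} = {q \<in> proj_space. \<exists>v\<in>q. f v \<noteq> 0} \<inter> X"
    by auto
  ultimately show ?thesis unfolding openin_subtopology by blast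
qed

lemma homogeneous_lincomb:
  "homogeneous 1 (\<lambda>v. c * v $ i + e * v $ j)"
proof -
  have "homogeneous (0 + 1) (\<lambda>v. c * v $ i)" for c :: complex and i
    by (rule homogeneous.mult[OF homogeneous.const homogeneous.coord])
  then show ?thesis using homogeneous.add by fastforce
qed

lemma coordinates_determine_point:
  assumes p: "p \<in> proj_space" "w \<in> p" and w: "w $ i \<noteq> 0"
    and q: "q \<in> proj_space" "v \<in> q" "v \<noteq> 0" and eq: "\<And>j. w $ i * v $ j = w $ j * v $ i"
  shows "q = p"
proof -
  have "v = (v $ i / w $ i) *s w"
    using eq w by (simp add: vec_eq_iff nonzero_eq_divide_eq mult.commute)
  moreover have "w \<noteq> 0" using w by auto
  ultimately have "v \<in> p" using point_eq_span[OF p(1,2)]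
    by (metis vec.span_base vec.span_scale singletonI)
  then show ?thesis using point_eq_span[OF p(1) _ q(3)] point_eq_span[OF q] by simp
qed

text \<open>
  The point spanned by \<open>w\<close> is cut out by the 2 by 2 minors of the matrix with rows \<open>w\<close> and \<open>v\<close>; since
  \<open>w $ i \<noteq> 0\<close>, the minors involving column \<open>i\<close> suffice.
\<close>

lemma closedin_point:
  assumes "p \<in> proj_space"
  shows "closedin proj_zariski {p}"
proof -
  obtain w where w: "w \<in> p" "w \<noteq> 0" using proj_spaceE[OF assms] .
  obtain i where i: "w $ i \<noteq> 0" using w(2) by (auto simp: vec_eq_iff)
  define F where "F = range (\<lambda>j v. w $ i * v $ j + (- w $ j) * v $ i)"
  have "proj_space - {p} = {q \<in> proj_space. \<exists>f\<in>F. \<exists>v\<in>q. f v \<noteq> 0}"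
  proof (intro equalityI subsetI)
    fix q assume q: "q \<in> proj_space - {p}"
    then obtain v where v: "v \<in> q" "v \<noteq> 0" using proj_spaceE by blast
    obtain j where "w $ i * v $ j \<noteq> w $ j * v $ i"
      using coordinates_determine_point[OF assms w(1) i _ v] q by blast
    then show "q \<in> {q \<in> proj_space. \<exists>f\<in>F. \<exists>v\<in>q. f v \<noteq> 0}"
      unfolding F_def using v(1) q by auto
  next
    fix q assume "q \<in> {q \<in> proj_space. \<exists>f\<in>F. \<exists>v\<in>q. f v \<noteq> 0}"
    moreover have "f v = 0" if "f \<in> F" "v \<in> p" for f and v :: "complex ^ 'a"
    proof -
      from point_scale[OF assms w \<open>v \<in> p\<close>] obtain c where "v = c *s w" .
      then show ?thesis using \<open>f \<in> F\<close> unfolding F_def by auto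
    qed
    ultimately show "q \<in> proj_space - {p}" by auto
  qed
  moreover have "\<exists>d. homogeneous d f" if f: "f \<in> F" for f
  proof -
    from f obtain j where "f = (\<lambda>v. w $ i * v $ j + (- w $ j) * v $ i)" unfolding F_def by blast
    then show ?thesis using homogeneous_lincomb by blast
  qed
  ultimately have "zariski_open (proj_space - {p})"
    unfolding zariski_open_def by (intro exI[of _ F] conjI ballI)
  then show ?thesis unfolding closedin_def topspace_proj_zariski openin_proj_zariski
    using assms by simp
qed

lemma openin_zariski_remove_finite:
  assumes "openin (zariski X) U" "finite S"
  shows "openin (zariski X) (U - S)"
proof -
  have "closedin (zariski X) {p}" if "p \<in> S \<inter> U" for p
    using that closedin_point openin_zariski_subset[OF assms(1)]
    by (intro closedin_subset_topspace) auto
  then have "closedin (zariski X) (\<Union>p\<in>S \<inter> U. {p})"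
    using assms(2) by (intro closedin_Union) auto
  then have "openin (zariski X) (U - (\<Union>p\<in>S \<inter> U. {p}))"
    by (rule openin_diff[OF assms(1)])
  moreover have "U - (\<Union>p\<in>S \<inter> U. {p}) = U - S" by auto
  ultimately show ?thesis by simp
qed

section \<open>Regular functions\<close>

lemma regular_onI:
  assumes "\<And>p. p \<in> U \<Longrightarrow> \<exists>V. openin (zariski X) V \<and> p \<in> V \<and> V \<subseteq> U \<and> regular_on X V f"
  shows "regular_on X U f"
  unfolding regular_on_def
proof
  fix p assume "p \<in> U"
  from assms[OF this] obtain V where V: "p \<in> V" "V \<subseteq> U" "regular_on X V f" by (elim exE conjE)
  from bspec[OF V(3)[unfolded regular_on_def] V(1)] obtain W d a b where W: "openin (zariski X) W \<and> p \<in> W \<and> W \<subseteq> V \<and>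
     homogeneous d a \<and> homogeneous d b \<and>
     (\<forall>q\<in>W. \<forall>v\<in>q. v \<noteq> 0 \<longrightarrow> b v \<noteq> 0 \<and> f q = a v / b v)"
    by (elim exE)
  show "\<exists>W d a b. openin (zariski X) W \<and> p \<in> W \<and> W \<subseteq> U \<and> homogeneous d a \<and> homogeneous d b \<and>
     (\<forall>q\<in>W. \<forall>v\<in>q. v \<noteq> 0 \<longrightarrow> b v \<noteq> 0 \<and> f q = a v / b v)"
    by (rule exI[of _ W], rule exI[of _ d], rule exI[of _ a], rule exI[of _ b])
      (use W V(2) in auto)
qed

lemma regular_onE:
  assumes "regular_on X U f" "p \<in> U"
  obtains V d a b where "openin (zariski X) V" "p \<in> V" "V \<subseteq> U" "homogeneous d a" "homogeneous d b"
    "\<forall>q\<in>V. \<forall>v\<in>q. v \<noteq> 0 \<longrightarrow> b v \<noteq> 0 \<and> f q = a v / b v"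
proof -
  from bspec[OF assms(1)[unfolded regular_on_def] assms(2)]
  obtain V d a b where "openin (zariski X) V \<and> p \<in> V \<and> V \<subseteq> U \<and>
     homogeneous d a \<and> homogeneous d b \<and>
     (\<forall>q\<in>V. \<forall>v\<in>q. v \<noteq> 0 \<longrightarrow> b v \<noteq> 0 \<and> f q = a v / b v)" by (elim exE)
  then show ?thesis using that[of V d a b] by simp
qed

lemma regular_on_fraction:
  assumes "openin (zariski X) V" "homogeneous d a" "homogeneous d b"
    "\<And>q v. \<lbrakk>q \<in> V; v \<in> q; v \<noteq> 0\<rbrakk> \<Longrightarrow> b v \<noteq> 0"
    "\<And>q v. \<lbrakk>q \<in> V; v \<in> q; v \<noteq> 0\<rbrakk> \<Longrightarrow> f q = a v / b v"
  shows "regular_on X V f"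
  unfolding regular_on_def using assms
  by (intro ballI exI[of _ V] exI[of _ d] exI[of _ a] exI[of _ b]) simp

lemma regular_on_subset:
  assumes f: "regular_on X U f" and V: "openin (zariski X) V" "V \<subseteq> U"
  shows "regular_on X V f"
proof (rule regular_onI)
  fix p assume p: "p \<in> V"
  with V have "p \<in> U" by blast
  from regular_onE[OF f this] obtain W d a b where W: "openin (zariski X) W" "p \<in> W" "W \<subseteq> U"
      "homogeneous d a" "homogeneous d b"
    and Wf: "\<forall>q\<in>W. \<forall>v\<in>q. v \<noteq> 0 \<longrightarrow> b v \<noteq> 0 \<and> f q = a v / b v" .
  have "regular_on X (W \<inter> V) f"
    by (rule regular_on_fraction[OF openin_Int[OF W(1) V(1)] W(4,5)]) (use Wf in auto)
  then show "\<exists>V'. openin (zariski X) V' \<and> p \<in> V' \<and> V' \<subseteq> V \<and> regular_on X V' f"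
    using W V p by (intro exI[of _ "W \<inter> V"]) auto
qed

lemma regular_on_cong:
  assumes f: "regular_on X U f" and eq: "\<And>q. q \<in> U \<Longrightarrow> f q = g q"
  shows "regular_on X U g"
proof (rule regular_onI)
  fix p assume p: "p \<in> U"
  from regular_onE[OF f p] obtain W d a b where W: "openin (zariski X) W" "p \<in> W" "W \<subseteq> U"
      "homogeneous d a" "homogeneous d b"
    and Wf: "\<forall>q\<in>W. \<forall>v\<in>q. v \<noteq> 0 \<longrightarrow> b v \<noteq> 0 \<and> f q = a v / b v" .
  have "regular_on X W g"
    by (rule regular_on_fraction[OF W(1,4,5)]) (use W(3) Wf eq[symmetric] in auto)
  then show "\<exists>V'. openin (zariski X) V' \<and> p \<in> V' \<and> V' \<subseteq> U \<and> regular_on X V' g"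
    using W by blast
qed

lemma regular_on_const: "openin (zariski X) U \<Longrightarrow> regular_on X U (\<lambda>q. c)"
  by (rule regular_on_fraction[OF _ homogeneous.const[of c] homogeneous.const[of 1]]) auto

text \<open>
  Sums and products of regular functions are treated together: over the product of the two
  denominators, the operation \<open>P\<close> on values becomes an operation \<open>A\<close> on numerators and denominators,
  and \<open>comb\<close> asks that \<open>A\<close> respects homogeneity.
\<close>

lemma regular_on_combine:
  fixes X :: "'n::finite point set"
  assumes f: "regular_on X U f" and g: "regular_on X U g"
    and comb: "\<And>d e (a :: complex ^ 'n \<Rightarrow> complex) b a' b'. \<lbrakk>homogeneous d a; homogeneous d b; homogeneous e a'; homogeneous e b'\<rbrakk> \<Longrightarrow>
       \<exists>k. homogeneous k (\<lambda>v. A (a v) (b v) (a' v) (b' v)) \<and> homogeneous k (\<lambda>v. b v * b' v)"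
    and op: "\<And>x y x' y'. \<lbrakk>y \<noteq> 0; y' \<noteq> 0\<rbrakk> \<Longrightarrow> P (x / y) (x' / y') = A x y x' y' / (y * y')"
  shows "regular_on X U (\<lambda>q. P (f q) (g q))"
proof (rule regular_onI)
  fix p assume p: "p \<in> U"
  from regular_onE[OF f p] obtain W d a b where W: "openin (zariski X) W" "p \<in> W" "W \<subseteq> U"
      "homogeneous d a" "homogeneous d b"
    and Wf: "\<forall>q\<in>W. \<forall>v\<in>q. v \<noteq> 0 \<longrightarrow> b v \<noteq> 0 \<and> f q = a v / b v" .
  from regular_onE[OF g p] obtain V e a' b' where V: "openin (zariski X) V" "p \<in> V" "V \<subseteq> U"
      "homogeneous e a'" "homogeneous e b'"
    and Vf: "\<forall>q\<in>V. \<forall>v\<in>q. v \<noteq> 0 \<longrightarrow> b' v \<noteq> 0 \<and> g q = a' v / b' v" .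
  from comb[OF W(4,5) V(4,5)] obtain k where
    k: "homogeneous k (\<lambda>v. A (a v) (b v) (a' v) (b' v))" "homogeneous k (\<lambda>v. b v * b' v)" by blast
  have "regular_on X (W \<inter> V) (\<lambda>q. P (f q) (g q))"
  proof (rule regular_on_fraction[OF openin_Int[OF W(1) V(1)] k])
    fix q v assume q: "q \<in> W \<inter> V" "v \<in> q" "v \<noteq> 0"
    have *: "b v \<noteq> 0" "b' v \<noteq> 0" "f q = a v / b v" "g q = a' v / b' v"
      using q Wf Vf by auto
    then show "b v * b' v \<noteq> 0" by simp
    show "P (f q) (g q) = A (a v) (b v) (a' v) (b' v) / (b v * b' v)"
      using op * by simp
  qed
  then show "\<exists>V'. openin (zariski X) V' \<and> p \<in> V' \<and> V' \<subseteq> U \<and> regular_on X V' (\<lambda>q. P (f q) (g q))"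
    using W V by (intro exI[of _ "W \<inter> V"]) auto
qed

lemma regular_on_mult:
  assumes "regular_on X U f" "regular_on X U g"
  shows "regular_on X U (\<lambda>q. f q * g q)"
  by (rule regular_on_combine[where A = "\<lambda>x y x' y'. x * x'", OF assms]) (auto intro: homogeneous.mult)

lemma regular_on_add:
  assumes "regular_on X U f" "regular_on X U g"
  shows "regular_on X U (\<lambda>q. f q + g q)"
proof (rule regular_on_combine[where A = "\<lambda>x y x' y'. x * y' + y * x'", OF assms])
  fix d e :: nat and a b a' b' :: "complex ^ 'a \<Rightarrow> complex"
  assume "homogeneous d a" "homogeneous d b" "homogeneous e a'" "homogeneous e b'"
  then have "homogeneous (d + e) (\<lambda>v. a v * b' v + b v * a' v) \<and> homogeneous (d + e) (\<lambda>v. b v * b' v)"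
    by (intro conjI homogeneous.add homogeneous.mult)
  then show "\<exists>k. homogeneous k (\<lambda>v. a v * b' v + b v * a' v) \<and> homogeneous k (\<lambda>v. b v * b' v)" ..
qed (auto simp: field_simps)

lemma regular_on_inverse:
  assumes f: "regular_on X U f" and nz: "\<And>q. q \<in> U \<Longrightarrow> f q \<noteq> 0"
  shows "regular_on X U (\<lambda>q. inverse (f q))"
proof (rule regular_onI)
  fix p assume p: "p \<in> U"
  from regular_onE[OF f p] obtain W d a b where W: "openin (zariski X) W" "p \<in> W" "W \<subseteq> U"
      "homogeneous d a" "homogeneous d b"
    and Wf: "\<forall>q\<in>W. \<forall>v\<in>q. v \<noteq> 0 \<longrightarrow> b v \<noteq> 0 \<and> f q = a v / b v" .
  have "a v \<noteq> 0" if "q \<in> W" "v \<in> q" "v \<noteq> 0" for q v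
  proof -
    have "f q \<noteq> 0" using nz that(1) W(3) by auto
    then show ?thesis using Wf that by auto
  qed
  then have "regular_on X W (\<lambda>q. inverse (f q))"
    by (intro regular_on_fraction[OF W(1,5,4)]) (use Wf in auto)
  then show "\<exists>V'. openin (zariski X) V' \<and> p \<in> V' \<and> V' \<subseteq> U \<and> regular_on X V' (\<lambda>q. inverse (f q))"
    using W by blast
qed

text \<open>
  Where \<open>f\<close> is a fraction \<open>a / b\<close>, it vanishes exactly where the form \<open>a\<close> does.
\<close>

lemma openin_regular_nonzero:
  assumes f: "regular_on X U f"
  shows "openin (zariski X) {q \<in> U. f q \<noteq> 0}"
proof (subst openin_subopen, intro ballI)
  fix p assume "p \<in> {q \<in> U. f q \<noteq> 0}"
  then have p: "p \<in> U" "f p \<noteq> 0" by auto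
  from regular_onE[OF f p(1)] obtain W d a b where W: "openin (zariski X) W" "p \<in> W" "W \<subseteq> U"
      "homogeneous d a" "homogeneous d b"
    and Wf: "\<forall>q\<in>W. \<forall>v\<in>q. v \<noteq> 0 \<longrightarrow> b v \<noteq> 0 \<and> f q = a v / b v" .
  let ?N = "W \<inter> {q \<in> X \<inter> proj_space. \<exists>v\<in>q. a v \<noteq> 0}"
  have iff: "(\<exists>v\<in>q. a v \<noteq> 0) \<longleftrightarrow> f q \<noteq> 0" if q: "q \<in> W" for q
  proof -
    have "q \<in> proj_space" using q openin_zariski_subset[OF W(1)] by auto
    then obtain v where v: "v \<in> q" "v \<noteq> 0" using proj_spaceE by blast
    show ?thesis
      using homogeneous_nonzero_iff[OF W(4) \<open>q \<in> proj_space\<close> v] Wf q v by auto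
  qed
  have "openin (zariski X) ?N"
    by (intro openin_Int W(1) openin_zariski_nonvanishing[OF W(4)])
  moreover have "p \<in> ?N" using iff[OF W(2)] p W(2) openin_zariski_subset[OF W(1)] by blast
  moreover have "?N \<subseteq> {q \<in> U. f q \<noteq> 0}" using iff W(3) by blast
  ultimately show "\<exists>T. openin (zariski X) T \<and> p \<in> T \<and> T \<subseteq> {q \<in> U. f q \<noteq> 0}" by blast
qed

lemma unit_on_subset: "\<lbrakk>unit_on X U f; openin (zariski X) V; V \<subseteq> U\<rbrakk> \<Longrightarrow> unit_on X V f"
  unfolding unit_on_def using regular_on_subset by blast

lemma unit_on_cong: "\<lbrakk>unit_on X U f; \<And>q. q \<in> U \<Longrightarrow> f q = g q\<rbrakk> \<Longrightarrow> unit_on X U g"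
  unfolding unit_on_def using regular_on_cong by force

lemma unit_on_const: "\<lbrakk>openin (zariski X) U; c \<noteq> 0\<rbrakk> \<Longrightarrow> unit_on X U (\<lambda>q. c)"
  unfolding unit_on_def using regular_on_const by blast

lemma unit_on_mult: "\<lbrakk>unit_on X U f; unit_on X U g\<rbrakk> \<Longrightarrow> unit_on X U (\<lambda>q. f q * g q)"
  unfolding unit_on_def using regular_on_mult by auto

lemma unit_on_inverse: "unit_on X U f \<Longrightarrow> unit_on X U (\<lambda>q. inverse (f q))"
  unfolding unit_on_def using regular_on_inverse by auto

lemma unit_on_divide: "\<lbrakk>unit_on X U f; unit_on X U g\<rbrakk> \<Longrightarrow> unit_on X U (\<lambda>q. f q / g q)"
  using unit_on_mult[OF _ unit_on_inverse] by (simp add: divide_inverse)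

lemma unit_on_power_int:
  assumes "openin (zariski X) U" "unit_on X U f"
  shows "unit_on X U (\<lambda>q. f q powi n)"
proof -
  have *: "unit_on X U (\<lambda>q. f q ^ k)" for k
    by (induction k) (auto intro!: unit_on_const[of X U 1] unit_on_mult assms)
  show ?thesis
    using *[of "nat n"] unit_on_inverse[OF *[of "nat (-n)"]]
    by (cases "n \<ge> 0") (auto simp: power_int_def power_inverse)
qed

section \<open>The Picard group\<close>

lemma line_bundleD:
  assumes "line_bundle X (U, g)"
  shows "x \<in> X \<Longrightarrow> openin (zariski X) (U x)" "x \<in> X \<Longrightarrow> x \<in> U x"
    "\<lbrakk>x \<in> X; y \<in> X\<rbrakk> \<Longrightarrow> unit_on X (U x \<inter> U y) (g x y)"
    "\<lbrakk>x \<in> X; y \<in> X; z \<in> X; q \<in> U x; q \<in> U y; q \<in> U z\<rbrakk> \<Longrightarrow> g x z q = g x y q * g y z q"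
    "\<lbrakk>x \<in> X; y \<in> X; q \<in> U x; q \<in> U y\<rbrakk> \<Longrightarrow> g x y q \<noteq> 0"
proof -
  note * = assms[unfolded line_bundle.simps]
  show "x \<in> X \<Longrightarrow> openin (zariski X) (U x)" "x \<in> X \<Longrightarrow> x \<in> U x"
    using conjunct1[OF *] by blast+
  show unit: "unit_on X (U x \<inter> U y) (g x y)" if "x \<in> X" "y \<in> X"
    using conjunct1[OF conjunct2[OF *]] that by blast
  show "\<lbrakk>x \<in> X; y \<in> X; z \<in> X; q \<in> U x; q \<in> U y; q \<in> U z\<rbrakk> \<Longrightarrow> g x z q = g x y q * g y z q"
    using conjunct2[OF conjunct2[OF *]] by blast
  show "\<lbrakk>x \<in> X; y \<in> X; q \<in> U x; q \<in> U y\<rbrakk> \<Longrightarrow> g x y q \<noteq> 0"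
    using unit unfolding unit_on_def by blast
qed

lemma line_bundleI:
  assumes "\<And>x. x \<in> X \<Longrightarrow> openin (zariski X) (U x)" "\<And>x. x \<in> X \<Longrightarrow> x \<in> U x"
    "\<And>x y. \<lbrakk>x \<in> X; y \<in> X\<rbrakk> \<Longrightarrow> unit_on X (U x \<inter> U y) (g x y)"
    "\<And>x y z q. \<lbrakk>x \<in> X; y \<in> X; z \<in> X; q \<in> U x; q \<in> U y; q \<in> U z\<rbrakk> \<Longrightarrow> g x z q = g x y q * g y z q"
  shows "line_bundle X (U, g)"
  unfolding line_bundle.simps
proof (intro conjI ballI)
  fix x y z q assume "x \<in> X" "y \<in> X" "z \<in> X" "q \<in> U x \<inter> U y \<inter> U z"
  then show "g x z q = g x y q * g y z q" using assms(4)[of x y z q] by blast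
qed (use assms(1-3) in blast)+

declare line_bundle.simps [simp del] line_bundle_iso.simps [simp del]

lemma line_bundle_self_transition:
  assumes "line_bundle X (U, g)" "x \<in> X" "q \<in> U x"
  shows "g x x q = 1"
  using line_bundleD(4)[OF assms(1,2,2,2,3,3,3)] line_bundleD(5)[OF assms(1,2,2,3,3)] by simp

lemma line_bundle_isoI:
  assumes "\<And>x. x \<in> X \<Longrightarrow> openin (zariski X) (W x)" "\<And>x. x \<in> X \<Longrightarrow> x \<in> W x"
    "\<And>x. x \<in> X \<Longrightarrow> W x \<subseteq> U x" "\<And>x. x \<in> X \<Longrightarrow> W x \<subseteq> V x"
    "\<And>x. x \<in> X \<Longrightarrow> unit_on X (W x) (l x)"
    "\<And>x y q. \<lbrakk>x \<in> X; y \<in> X; q \<in> W x; q \<in> W y\<rbrakk> \<Longrightarrow> h x y q * l y q = l x q * g x y q"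
  shows "line_bundle_iso X (U, g) (V, h)"
  unfolding line_bundle_iso.simps
  by (rule exI[of _ W], rule exI[of _ l]) (use assms in auto)

lemma line_bundle_isoE:
  assumes "line_bundle_iso X (U, g) (V, h)"
  obtains W l where "\<forall>x\<in>X. openin (zariski X) (W x)" "\<forall>x\<in>X. x \<in> W x"
    "\<forall>x\<in>X. W x \<subseteq> U x" "\<forall>x\<in>X. W x \<subseteq> V x"
    "\<forall>x\<in>X. unit_on X (W x) (l x)"
    "\<forall>x\<in>X. \<forall>y\<in>X. \<forall>q\<in>W x \<inter> W y. h x y q * l y q = l x q * g x y q"
proof -
  from assms obtain W l where "(\<forall>x\<in>X. openin (zariski X) (W x) \<and> x \<in> W x \<and> W x \<subseteq> U x \<inter> V x \<and>
              unit_on X (W x) (l x)) \<and>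
        (\<forall>x\<in>X. \<forall>y\<in>X. \<forall>q \<in> W x \<inter> W y. h x y q * l y q = l x q * g x y q)"
    unfolding line_bundle_iso.simps by (elim exE)
  then show ?thesis using that[of W l] by simp
qed


text \<open>
  Cocycles are functions on a whole type, of which only the values over \<open>X\<close> are meaningful. Identities
  between line bundles such as \<open>id\<^sup>* L = L\<close> therefore hold for cocycles only up to this isomorphism.
\<close>

lemma line_bundle_iso_agree:
  assumes "line_bundle X (U, g)" "\<And>x. x \<in> X \<Longrightarrow> U x = V x"
    "\<And>x y q. \<lbrakk>x \<in> X; y \<in> X; q \<in> U x; q \<in> U y\<rbrakk> \<Longrightarrow> g x y q = h x y q"
  shows "line_bundle_iso X (U, g) (V, h)"
proof (rule line_bundle_isoI[where W = U and l = "\<lambda>x q. 1"])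
  show "h x y q * 1 = 1 * g x y q" if "x \<in> X" "y \<in> X" "q \<in> U x" "q \<in> U y" for x y q
    using assms(3)[OF that] by simp
qed (use line_bundleD(1,2)[OF assms(1)] assms(2) in \<open>auto intro: unit_on_const\<close>)

lemma line_bundle_iso_refl: "line_bundle X a \<Longrightarrow> line_bundle_iso X a a"
  by (cases a) (metis line_bundle_iso_agree)

lemma line_bundle_iso_sym:
  assumes "line_bundle_iso X a b"
  shows "line_bundle_iso X b a"
proof -
  obtain U g V h where ab: "a = (U, g)" "b = (V, h)" by (cases a, cases b)
  from line_bundle_isoE[OF assms[unfolded ab]] obtain W l where
    W: "\<forall>x\<in>X. openin (zariski X) (W x)" "\<forall>x\<in>X. x \<in> W x"
    "\<forall>x\<in>X. W x \<subseteq> U x" "\<forall>x\<in>X. W x \<subseteq> V x"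
    "\<forall>x\<in>X. unit_on X (W x) (l x)"
    "\<forall>x\<in>X. \<forall>y\<in>X. \<forall>q\<in>W x \<inter> W y. h x y q * l y q = l x q * g x y q" .
  show ?thesis unfolding ab
  proof (rule line_bundle_isoI[where W = W and l = "\<lambda>x q. inverse (l x q)"])
    fix x y q assume xy: "x \<in> X" "y \<in> X" "q \<in> W x" "q \<in> W y"
    have "l x q \<noteq> 0" "l y q \<noteq> 0" using W(5) xy unfolding unit_on_def by auto
    then show "g x y q * inverse (l y q) = inverse (l x q) * h x y q"
      using W(6) xy by (simp add: field_simps)
  qed (use W in \<open>auto intro: unit_on_inverse\<close>)
qed

lemma line_bundle_iso_trans:
  assumes "line_bundle_iso X a b" "line_bundle_iso X b c"
  shows "line_bundle_iso X a c"
proof -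
  obtain U g V h V' k where ab: "a = (U, g)" "b = (V, h)" "c = (V', k)" by (cases a, cases b, cases c)
  from line_bundle_isoE[OF assms(1)[unfolded ab]] obtain W l where
    W: "\<forall>x\<in>X. openin (zariski X) (W x)" "\<forall>x\<in>X. x \<in> W x"
    "\<forall>x\<in>X. W x \<subseteq> U x" "\<forall>x\<in>X. W x \<subseteq> V x"
    "\<forall>x\<in>X. unit_on X (W x) (l x)"
    "\<forall>x\<in>X. \<forall>y\<in>X. \<forall>q\<in>W x \<inter> W y. h x y q * l y q = l x q * g x y q" .
  from line_bundle_isoE[OF assms(2)[unfolded ab]] obtain W' m where
    W': "\<forall>x\<in>X. openin (zariski X) (W' x)" "\<forall>x\<in>X. x \<in> W' x"
    "\<forall>x\<in>X. W' x \<subseteq> V x" "\<forall>x\<in>X. W' x \<subseteq> V' x"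
    "\<forall>x\<in>X. unit_on X (W' x) (m x)"
    "\<forall>x\<in>X. \<forall>y\<in>X. \<forall>q\<in>W' x \<inter> W' y. k x y q * m y q = m x q * h x y q" .
  show ?thesis unfolding ab
  proof (rule line_bundle_isoI[where W = "\<lambda>x. W x \<inter> W' x" and l = "\<lambda>x q. m x q * l x q"])
    fix x assume x: "x \<in> X"
    have "openin (zariski X) (W x \<inter> W' x)" using W(1) W'(1) x by auto
    then show "unit_on X (W x \<inter> W' x) (\<lambda>q. m x q * l x q)"
      using bspec[OF W(5) x] bspec[OF W'(5) x] by (auto intro!: unit_on_mult intro: unit_on_subset)
  next
    fix x y q assume xy: "x \<in> X" "y \<in> X" "q \<in> W x \<inter> W' x" "q \<in> W y \<inter> W' y"
    have "k x y q * (m y q * l y q) = m x q * (h x y q * l y q)"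
      using W'(6) xy by simp
    also have "\<dots> = m x q * l x q * g x y q" using W(6) xy by simp
    finally show "k x y q * (m y q * l y q) = m x q * l x q * g x y q" .
  qed (use W W' in auto)
qed

lemma equiv_line_bundle: "equiv {a. line_bundle X a} (line_bundle_equiv X)"
  unfolding line_bundle_equiv_def
  by (rule equivI) (auto simp: sym_def trans_def intro!: refl_onI
      intro: line_bundle_iso_refl line_bundle_iso_sym line_bundle_iso_trans)

abbreviation line_bundle_class :: "'n::finite point set \<Rightarrow> 'n line_bundle \<Rightarrow> 'n line_bundle set" where
  "line_bundle_class X a \<equiv> line_bundle_equiv X `` {a}"

lemma line_bundle_class_eq_iff:
  "\<lbrakk>line_bundle X a; line_bundle X b\<rbrakk> \<Longrightarrow>
    line_bundle_class X a = line_bundle_class X b \<longleftrightarrow> line_bundle_iso X a b"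
  by (subst eq_equiv_class_iff[OF equiv_line_bundle])
    (auto simp: line_bundle_equiv_def)

text \<open>
  Multiplication and pullback on the Picard group are defined by saturating a set of cocycles under
  isomorphism. This computes them from a single representative.
\<close>

lemma line_bundle_equiv_Image:
  assumes "S \<noteq> {}" "\<And>b. b \<in> S \<Longrightarrow> line_bundle X b \<and> line_bundle_iso X a b" "line_bundle X a"
  shows "line_bundle_equiv X `` S = line_bundle_class X a"
proof -
  have "line_bundle_class X b = line_bundle_class X a" if "b \<in> S" for b
    using line_bundle_class_eq_iff assms(2)[OF that] assms(3) by blast
  then show ?thesis using assms(1) by (subst Image_eq_UN) auto
qed

lemma line_bundle_class_memD:
  "b \<in> line_bundle_class X a \<Longrightarrow> line_bundle X a \<and> line_bundle X b \<and> line_bundle_iso X a b"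
  by (simp add: line_bundle_equiv_def)

lemma line_bundle_class_self: "line_bundle X a \<Longrightarrow> a \<in> line_bundle_class X a"
  using line_bundle_iso_refl
  by (simp add: line_bundle_equiv_def)

lemma line_bundle_tensor:
  assumes "line_bundle X a" "line_bundle X b"
  shows "line_bundle X (line_bundle_tensor a b)"
proof -
  obtain U g V h where ab: "a = (U, g)" "b = (V, h)" by (cases a, cases b)
  note a = line_bundleD[OF assms(1)[unfolded ab]] and b = line_bundleD[OF assms(2)[unfolded ab]]
  show ?thesis unfolding ab line_bundle_tensor.simps
  proof (rule line_bundleI)
    fix x y assume xy: "x \<in> X" "y \<in> X"
    have "openin (zariski X) (U x \<inter> V x \<inter> (U y \<inter> V y))" using a(1) b(1) xy by auto
    then show "unit_on X (U x \<inter> V x \<inter> (U y \<inter> V y)) (\<lambda>q. g x y q * h x y q)"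
      using a(3)[OF xy] b(3)[OF xy] by (intro unit_on_mult; elim unit_on_subset) auto
  next
    fix x y z q
    assume "x \<in> X" "y \<in> X" "z \<in> X" "q \<in> U x \<inter> V x" "q \<in> U y \<inter> V y" "q \<in> U z \<inter> V z"
    then show "g x z q * h x z q = g x y q * h x y q * (g y z q * h y z q)"
      using a(4)[of x y z q] b(4)[of x y z q] by simp
  qed (use a(1,2) b(1,2) in auto)
qed

lemma line_bundle_iso_tensor:
  assumes "line_bundle_iso X a a'" "line_bundle_iso X b b'"
  shows "line_bundle_iso X (line_bundle_tensor a b) (line_bundle_tensor a' b')"
proof -
  obtain U g V h U' g' V' h' where ab: "a = (U, g)" "a' = (V, h)" "b = (U', g')" "b' = (V', h')"
    by (cases a, cases b, cases a', cases b')
  from line_bundle_isoE[OF assms(1)[unfolded ab]] obtain W l where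
    W: "\<forall>x\<in>X. openin (zariski X) (W x)" "\<forall>x\<in>X. x \<in> W x"
    "\<forall>x\<in>X. W x \<subseteq> U x" "\<forall>x\<in>X. W x \<subseteq> V x"
    "\<forall>x\<in>X. unit_on X (W x) (l x)"
    "\<forall>x\<in>X. \<forall>y\<in>X. \<forall>q\<in>W x \<inter> W y. h x y q * l y q = l x q * g x y q" .
  from line_bundle_isoE[OF assms(2)[unfolded ab]] obtain W' m where
    W': "\<forall>x\<in>X. openin (zariski X) (W' x)" "\<forall>x\<in>X. x \<in> W' x"
    "\<forall>x\<in>X. W' x \<subseteq> U' x" "\<forall>x\<in>X. W' x \<subseteq> V' x"
    "\<forall>x\<in>X. unit_on X (W' x) (m x)"
    "\<forall>x\<in>X. \<forall>y\<in>X. \<forall>q\<in>W' x \<inter> W' y. h' x y q * m y q = m x q * g' x y q" .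
  show ?thesis unfolding ab line_bundle_tensor.simps
  proof (rule line_bundle_isoI[where W = "\<lambda>x. W x \<inter> W' x" and l = "\<lambda>x q. l x q * m x q"])
    fix x assume x: "x \<in> X"
    have "openin (zariski X) (W x \<inter> W' x)" using W(1) W'(1) x by auto
    then show "unit_on X (W x \<inter> W' x) (\<lambda>q. l x q * m x q)"
      using bspec[OF W(5) x] bspec[OF W'(5) x] by (auto intro!: unit_on_mult intro: unit_on_subset)
  next
    fix x y q assume xy: "x \<in> X" "y \<in> X" "q \<in> W x \<inter> W' x" "q \<in> W y \<inter> W' y"
    have "h x y q * h' x y q * (l y q * m y q) = (h x y q * l y q) * (h' x y q * m y q)" by simp
    also have "\<dots> = (l x q * g x y q) * (m x q * g' x y q)"
      using W(6) W'(6) xy by simp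
    finally show "h x y q * h' x y q * (l y q * m y q) = l x q * m x q * (g x y q * g' x y q)"
      by simp
  qed (use W W' in blast)+
qed

lemma line_bundle_tensor_comm: "line_bundle_tensor a b = line_bundle_tensor b a"
  by (cases a; cases b) (auto simp: Int_commute mult.commute)

lemma line_bundle_tensor_assoc:
  "line_bundle_tensor (line_bundle_tensor a b) c = line_bundle_tensor a (line_bundle_tensor b c)"
  by (cases a; cases b; cases c) (auto simp: Int_assoc mult.assoc)

lemma carrier_PicE:
  assumes "L \<in> carrier (Pic X)"
  obtains a where "line_bundle X a" "L = line_bundle_class X a"
  using assms by (auto simp: Pic_def elim!: quotientE)

lemma line_bundle_class_in_Pic: "line_bundle X a \<Longrightarrow> line_bundle_class X a \<in> carrier (Pic X)"
  by (simp add: Pic_def quotientI)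

lemma one_Pic: "\<one>\<^bsub>Pic X\<^esub> = line_bundle_class X (line_bundle_trivial X)"
  by (simp add: Pic_def)

lemma mult_Pic:
  assumes a: "line_bundle X a" and b: "line_bundle X b"
  shows "line_bundle_class X a \<otimes>\<^bsub>Pic X\<^esub> line_bundle_class X b =
    line_bundle_class X (line_bundle_tensor a b)"
proof -
  have "line_bundle_equiv X `` {line_bundle_tensor a' b' | a' b'.
      a' \<in> line_bundle_class X a \<and> b' \<in> line_bundle_class X b} =
    line_bundle_class X (line_bundle_tensor a b)"
  proof (rule line_bundle_equiv_Image[OF _ _ line_bundle_tensor[OF a b]])
    show "{line_bundle_tensor a' b' | a' b'.
      a' \<in> line_bundle_class X a \<and> b' \<in> line_bundle_class X b} \<noteq> {}"
      using line_bundle_class_self[OF a] line_bundle_class_self[OF b] by blast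
  next
    fix c assume "c \<in> {line_bundle_tensor a' b' | a' b'.
      a' \<in> line_bundle_class X a \<and> b' \<in> line_bundle_class X b}"
    then obtain a' b' where c: "c = line_bundle_tensor a' b'"
      "a' \<in> line_bundle_class X a" "b' \<in> line_bundle_class X b" by blast
    note * = line_bundle_class_memD[OF c(2)] line_bundle_class_memD[OF c(3)]
    then show "line_bundle X c \<and> line_bundle_iso X (line_bundle_tensor a b) c"
      unfolding c(1) using line_bundle_tensor line_bundle_iso_tensor by blast
  qed
  then show ?thesis by (simp add: Pic_def)
qed

lemma line_bundle_trivial:
  assumes "X \<subseteq> proj_space"
  shows "line_bundle X (line_bundle_trivial X)"
proof -
  have "openin (zariski X) X"
    using assms openin_topspace[of "zariski X"] by (simp add: topspace_proj_zariski Int_absorb1)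
  then show ?thesis unfolding line_bundle_trivial_def by (intro line_bundleI) (auto intro: unit_on_const)
qed

fun line_bundle_dual :: "'n line_bundle \<Rightarrow> 'n line_bundle" where
  "line_bundle_dual (U, g) = (U, \<lambda>x y q. inverse (g x y q))"

lemma line_bundle_dual:
  assumes "line_bundle X a"
  shows "line_bundle X (line_bundle_dual a)"
proof -
  obtain U g where a: "a = (U, g)" by (cases a)
  note aD = line_bundleD[OF assms[unfolded a]]
  show ?thesis unfolding a line_bundle_dual.simps
  proof (rule line_bundleI)
    show "unit_on X (U x \<inter> U y) (\<lambda>q. inverse (g x y q))" if "x \<in> X" "y \<in> X" for x y
      using aD(3)[OF that] by (rule unit_on_inverse)
    show "inverse (g x z q) = inverse (g x y q) * inverse (g y z q)"
      if "x \<in> X" "y \<in> X" "z \<in> X" "q \<in> U x" "q \<in> U y" "q \<in> U z" for x y z q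
      using aD(4)[OF that] by simp
  qed (fact aD(1,2))+
qed

lemma comm_group_Pic:
  assumes X: "X \<subseteq> proj_space"
  shows "comm_group (Pic X)"
proof (rule comm_groupI)
  show "\<one>\<^bsub>Pic X\<^esub> \<in> carrier (Pic X)"
    unfolding one_Pic by (rule line_bundle_class_in_Pic[OF line_bundle_trivial[OF X]])
next
  fix L M assume L: "L \<in> carrier (Pic X)" and M: "M \<in> carrier (Pic X)"
  from carrier_PicE[OF L] obtain a where a: "line_bundle X a" "L = line_bundle_class X a" .
  from carrier_PicE[OF M] obtain b where b: "line_bundle X b" "M = line_bundle_class X b" .
  show "L \<otimes>\<^bsub>Pic X\<^esub> M \<in> carrier (Pic X)"
    unfolding a(2) b(2) mult_Pic[OF a(1) b(1)]
    by (intro line_bundle_class_in_Pic line_bundle_tensor a(1) b(1))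
  show "L \<otimes>\<^bsub>Pic X\<^esub> M = M \<otimes>\<^bsub>Pic X\<^esub> L"
    unfolding a(2) b(2) mult_Pic[OF a(1) b(1)] mult_Pic[OF b(1) a(1)]
    by (simp only: line_bundle_tensor_comm)
next
  fix L M N
  assume L: "L \<in> carrier (Pic X)" and M: "M \<in> carrier (Pic X)" and N: "N \<in> carrier (Pic X)"
  from carrier_PicE[OF L] obtain a where a: "line_bundle X a" "L = line_bundle_class X a" .
  from carrier_PicE[OF M] obtain b where b: "line_bundle X b" "M = line_bundle_class X b" .
  from carrier_PicE[OF N] obtain c where c: "line_bundle X c" "N = line_bundle_class X c" .
  show "L \<otimes>\<^bsub>Pic X\<^esub> M \<otimes>\<^bsub>Pic X\<^esub> N = L \<otimes>\<^bsub>Pic X\<^esub> (M \<otimes>\<^bsub>Pic X\<^esub> N)"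
    unfolding a(2) b(2) c(2)
    by (simp only: mult_Pic line_bundle_tensor line_bundle_tensor_assoc a(1) b(1) c(1))
next
  fix L assume L: "L \<in> carrier (Pic X)"
  from carrier_PicE[OF L] obtain a where a: "line_bundle X a" "L = line_bundle_class X a" .
  obtain U g where Ug: "a = (U, g)" by (cases a)
  note aD = line_bundleD[OF a(1)[unfolded Ug]]
  have "line_bundle_iso X a (line_bundle_tensor (line_bundle_trivial X) a)"
    unfolding Ug line_bundle_trivial_def line_bundle_tensor.simps
  proof (rule line_bundle_iso_agree[OF a(1)[unfolded Ug]])
    show "U x = X \<inter> U x" if "x \<in> X" for x using openin_zariski_subset[OF aD(1)[OF that]] by blast
  qed simp
  then have "line_bundle_iso X (line_bundle_tensor (line_bundle_trivial X) a) a"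
    by (rule line_bundle_iso_sym)
  then show "\<one>\<^bsub>Pic X\<^esub> \<otimes>\<^bsub>Pic X\<^esub> L = L"
    unfolding one_Pic a(2) mult_Pic[OF line_bundle_trivial[OF X] a(1)]
    using line_bundle_class_eq_iff line_bundle_tensor line_bundle_trivial[OF X] a(1) by blast
  have "line_bundle_iso X (line_bundle_tensor (line_bundle_dual a) a) (line_bundle_trivial X)"
    unfolding Ug line_bundle_trivial_def line_bundle_tensor.simps line_bundle_dual.simps
  proof (rule line_bundle_isoI[where W = U and l = "\<lambda>x q. 1"])
    show "U x \<subseteq> X" if "x \<in> X" for x using openin_zariski_subset[OF aD(1)[OF that]] by blast
    show "1 * 1 = 1 * (inverse (g x y q) * g x y q)"
      if "x \<in> X" "y \<in> X" "q \<in> U x" "q \<in> U y" for x y q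
      using aD(5)[OF that] by simp
  qed (use aD(1,2) in \<open>auto intro: unit_on_const\<close>)
  then have "line_bundle_class X (line_bundle_dual a) \<otimes>\<^bsub>Pic X\<^esub> L = \<one>\<^bsub>Pic X\<^esub>"
    unfolding one_Pic a(2) mult_Pic[OF line_bundle_dual[OF a(1)] a(1)]
    using line_bundle_class_eq_iff line_bundle_tensor line_bundle_trivial[OF X]
      line_bundle_dual[OF a(1)] a(1) by blast
  then show "\<exists>M\<in>carrier (Pic X). M \<otimes>\<^bsub>Pic X\<^esub> L = \<one>\<^bsub>Pic X\<^esub>"
    using line_bundle_class_in_Pic[OF line_bundle_dual[OF a(1)]] by blast
qed

section \<open>Uniformizers on a smooth projective curve\<close>

lemma uniformizerD:
  assumes "uniformizer X p U t"
  shows "openin (zariski X) U" "p \<in> U" "regular_on X U t" "t p = 0" "p \<in> X" "p \<in> proj_space"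
proof -
  show "openin (zariski X) U" "p \<in> U" "regular_on X U t" "t p = 0"
    using assms unfolding uniformizer_def by simp_all
  then show "p \<in> X" "p \<in> proj_space" using openin_zariski_subset by blast+
qed

lemma uniformizer_dividesE:
  assumes "uniformizer X p U t" "openin (zariski X) V" "p \<in> V" "regular_on X V f" "f p = 0"
  obtains W g where "openin (zariski X) W" "p \<in> W" "W \<subseteq> U" "W \<subseteq> V" "regular_on X W g"
    "\<forall>q\<in>W. f q = g q * t q"
proof -
  have "\<exists>W g. openin (zariski X) W \<and> p \<in> W \<and> W \<subseteq> U \<inter> V \<and> regular_on X W g \<and>
      (\<forall>q\<in>W. f q = g q * t q)"
    using assms unfolding uniformizer_def by blast
  then obtain W g where "openin (zariski X) W \<and> p \<in> W \<and> W \<subseteq> U \<inter> V \<and> regular_on X W g \<and>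
      (\<forall>q\<in>W. f q = g q * t q)" by (elim exE)
  then show ?thesis using that[of W g] by simp
qed

lemma uniformizerI:
  assumes "openin (zariski X) U" "p \<in> U" "regular_on X U t" "t p = 0"
    and "\<And>V f. \<lbrakk>openin (zariski X) V; p \<in> V; regular_on X V f; f p = 0\<rbrakk> \<Longrightarrow>
      \<exists>W g. openin (zariski X) W \<and> p \<in> W \<and> W \<subseteq> U \<inter> V \<and> regular_on X W g \<and>
        (\<forall>q\<in>W. f q = g q * t q)"
  shows "uniformizer X p U t"
  unfolding uniformizer_def
proof (intro conjI assms(1-4) allI impI)
  fix V f assume "openin (zariski X) V \<and> p \<in> V \<and> regular_on X V f \<and> f p = 0"
  then show "\<exists>W g. openin (zariski X) W \<and> p \<in> W \<and> W \<subseteq> U \<inter> V \<and> regular_on X W g \<and>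
        (\<forall>q\<in>W. f q = g q * t q)" using assms(5) by simp
qed

lemma uniformizer_subset:
  assumes t: "uniformizer X p U t" and V: "openin (zariski X) V" "p \<in> V" "V \<subseteq> U"
  shows "uniformizer X p V t"
proof (rule uniformizerI[OF V(1,2)])
  show "regular_on X V t" using uniformizerD(3)[OF t] V(1,3) by (rule regular_on_subset)
  show "t p = 0" using uniformizerD(4)[OF t] .
next
  fix V' f assume V': "openin (zariski X) V'" "p \<in> V'" "regular_on X V' f" "f p = 0"
  from uniformizer_dividesE[OF t V'] obtain W g where W: "openin (zariski X) W" "p \<in> W"
    "W \<subseteq> U" "W \<subseteq> V'" "regular_on X W g" "\<forall>q\<in>W. f q = g q * t q" .
  have o: "openin (zariski X) (W \<inter> V)" using W(1) V(1) by (rule openin_Int)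
  show "\<exists>W g. openin (zariski X) W \<and> p \<in> W \<and> W \<subseteq> V \<inter> V' \<and> regular_on X W g \<and>
        (\<forall>q\<in>W. f q = g q * t q)"
    using o regular_on_subset[OF W(5) o] W(2,4,6) V(2)
    by (intro exI[of _ "W \<inter> V"] exI[of _ g]) auto
qed

text \<open>
  The functions \<open>(w $ i * v $ j - w $ j * v $ i) / v $ i\<close>, for the finitely many indices \<open>j\<close>, vanish at the
  point \<open>p\<close> spanned by \<open>w\<close>, so the uniformizer divides all of them near \<open>p\<close>. At a zero of the uniformizer
  close to \<open>p\<close> they all vanish, which happens only at \<open>p\<close> itself.
\<close>

lemma uniformizer_isolated_zero:
  fixes X :: "'n::finite point set"
  assumes t: "uniformizer X p U t"
  obtains W where "openin (zariski X) W" "p \<in> W" "W \<subseteq> U" "\<forall>q\<in>W. t q = 0 \<longrightarrow> q = p"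
proof -
  have p: "p \<in> X" "p \<in> proj_space" using uniformizerD[OF t] by auto
  obtain w where w: "w \<in> p" "w \<noteq> 0" using proj_spaceE[OF p(2)] .
  obtain i where i: "w $ i \<noteq> 0" using w(2) by (auto simp: vec_eq_iff)
  define V where "V = {q \<in> X \<inter> proj_space. \<exists>v\<in>q. v $ i \<noteq> 0}"
  have V: "openin (zariski X) V" unfolding V_def
    by (rule openin_zariski_nonvanishing[OF homogeneous.coord])
  have pV: "p \<in> V" unfolding V_def using p w i by blast
  have vi: "v $ i \<noteq> 0" if "q \<in> V" "v \<in> q" "v \<noteq> 0" for q and v :: "complex ^ 'n"
    using homogeneous_nonzero_iff[OF homogeneous.coord[of i], of q v] that unfolding V_def by auto
  define rep :: "'n point \<Rightarrow> complex ^ 'n" where "rep q = (SOME v. v \<in> q \<and> v \<noteq> 0)" for q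
  have rep: "rep q \<in> q" "rep q \<noteq> 0" if q: "q \<in> proj_space" for q
  proof -
    have "\<exists>v. v \<in> q \<and> v \<noteq> 0" using proj_spaceE[OF q] by blast
    then show "rep q \<in> q" "rep q \<noteq> 0" unfolding rep_def by (metis (mono_tags, lifting) someI_ex)+
  qed
  define f where "f j q = (w $ i * rep q $ j + (- w $ j) * rep q $ i) / rep q $ i" for j q
  have f: "f j q = (w $ i * v $ j + (- w $ j) * v $ i) / v $ i"
    if q: "q \<in> V" "v \<in> q" "v \<noteq> 0" for j q and v :: "complex ^ 'n"
  proof -
    have qp: "q \<in> proj_space" using q(1) unfolding V_def by blast
    from point_scale[OF qp q(2,3) rep(1)[OF qp]] obtain c where c: "rep q = c *s v" .
    have "c \<noteq> 0" using rep(2)[OF qp] c by auto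
    then show ?thesis unfolding f_def c using vi[OF q] by (simp add: field_simps)
  qed
  have reg: "regular_on X V (f j)" for j
    by (rule regular_on_fraction[OF V homogeneous_lincomb homogeneous.coord vi f])
  have "f j p = 0" for j using f[OF pV w] i by simp
  then have "\<exists>W g. openin (zariski X) W \<and> p \<in> W \<and> W \<subseteq> U \<and> W \<subseteq> V \<and> (\<forall>q\<in>W. f j q = g q * t q)" for j
    by (rule uniformizer_dividesE[OF t V pV reg]) blast
  then obtain W g where W: "\<And>j. openin (zariski X) (W j)" "\<And>j. p \<in> W j" "\<And>j. W j \<subseteq> U"
    "\<And>j. W j \<subseteq> V" "\<And>j q. q \<in> W j \<Longrightarrow> f j q = g j q * t q"
    by metis
  show ?thesis
  proof (rule that[of "\<Inter>(range W)"])
    show "openin (zariski X) (\<Inter>(range W))" using W(1) by (intro openin_Inter) auto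
    show "p \<in> \<Inter>(range W)" "\<Inter>(range W) \<subseteq> U" using W(2,3) by blast+
    show "\<forall>q\<in>\<Inter>(range W). t q = 0 \<longrightarrow> q = p"
    proof (intro ballI impI)
      fix q assume q: "q \<in> \<Inter>(range W)" and tq: "t q = 0"
      have qV: "q \<in> V" using q W(4) by blast
      then have qp: "q \<in> proj_space" unfolding V_def by blast
      have "w $ i * rep q $ j = w $ j * rep q $ i" for j
        using W(5)[of q j] q tq f[OF qV rep[OF qp], of j] vi[OF qV rep[OF qp]] by auto
      then show "q = p"
        by (rule coordinates_determine_point[OF p(2) w(1) i qp rep[OF qp]])
    qed
  qed
qed

lemma curve_subset_proj_space: "smooth_projective_curve X \<Longrightarrow> X \<subseteq> proj_space"
  unfolding smooth_projective_curve_def using closedin_subset topspace_proj_zariski by metis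

lemma topspace_zariski: "X \<subseteq> proj_space \<Longrightarrow> topspace (zariski X) = X"
  by (simp add: topspace_proj_zariski Int_absorb1)

text \<open>
  If \<open>{p}\<close> were open, then by irreducibility it would be all of \<open>X\<close>, leaving no room for a chain of
  two closed irreducible subsets. This is the place where the dimension of \<open>X\<close> enters.
\<close>

lemma curve_no_open_point:
  assumes X: "smooth_projective_curve X"
  shows "\<not> openin (zariski X) {p}"
proof
  assume o: "openin (zariski X) {p}"
  have p: "p \<in> X" "p \<in> proj_space" using openin_zariski_subset[OF o] by auto
  from o obtain T where T: "openin proj_zariski T" "{p} = T \<inter> X"
    unfolding openin_subtopology by blast
  have c: "closedin proj_zariski (topspace proj_zariski - T)" "closedin proj_zariski {p}"
    using T(1) closedin_point[OF p(2)] by (blast intro: openin_closedin_eq[THEN iffD1, THEN conjunct2])+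
  have "X \<subseteq> (topspace proj_zariski - T) \<union> {p}"
    using T(2) curve_subset_proj_space[OF X] by (auto simp: topspace_proj_zariski)
  then have "X \<subseteq> topspace proj_zariski - T \<or> X \<subseteq> {p}"
    using X c unfolding smooth_projective_curve_def irreducible_in_def by blast
  moreover have "p \<in> T" using T(2) by blast
  ultimately have Xp: "X \<subseteq> {p}" using p(1) by blast
  have "irreducible_chain (zariski X) 1"
    using X unfolding smooth_projective_curve_def has_krull_dim_def by blast
  then obtain Z where Z: "\<forall>i\<le>1::nat. closedin (zariski X) (Z i) \<and> irreducible_in (zariski X) (Z i)"
    "\<forall>i<1::nat. Z i \<subset> Z (Suc i)" unfolding irreducible_chain_def by blast
  have "Z 0 \<noteq> {}" using Z(1) unfolding irreducible_in_def by auto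
  moreover have "Z 0 \<subset> Z 1" using Z(2) by auto
  moreover have "Z 1 \<subseteq> X" using Z(1) closedin_subset[of "zariski X" "Z 1"] by auto
  ultimately show False using Xp by blast
qed

lemma uniformizer_not_locally_zero:
  assumes X: "smooth_projective_curve X" and t: "uniformizer X p U t"
    and W: "openin (zariski X) W" "p \<in> W"
  shows "\<exists>q\<in>W. t q \<noteq> 0"
proof (rule ccontr)
  assume z: "\<not> (\<exists>q\<in>W. t q \<noteq> 0)"
  from uniformizer_isolated_zero[OF t] obtain V where V: "openin (zariski X) V" "p \<in> V" "V \<subseteq> U"
    "\<forall>q\<in>V. t q = 0 \<longrightarrow> q = p" .
  have "W \<inter> V \<subseteq> {p}" using z V(4) by blast
  then have "W \<inter> V = {p}" using V(2) W(2) by blast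
  then have "openin (zariski X) {p}" using openin_Int[OF W(1) V(1)] by simp
  then show False using curve_no_open_point[OF X] by blast
qed

text \<open>
  Each of two uniformizers is a multiple of the other, say \<open>s = e * t\<close> and \<open>t = e' * s\<close>, so
  \<open>(1 - e * e') * s = 0\<close>. If \<open>e\<close> vanished at \<open>p\<close>, the first factor would be nonzero near \<open>p\<close> and \<open>s\<close> would
  vanish identically there.
\<close>

lemma uniformizers_differ_by_unit:
  assumes X: "smooth_projective_curve X" and t: "uniformizer X p U t" and s: "uniformizer X p V s"
  obtains W e where "openin (zariski X) W" "p \<in> W" "W \<subseteq> U" "W \<subseteq> V" "unit_on X W e"
    "\<forall>q\<in>W. s q = e q * t q"
proof -
  note tD = uniformizerD[OF t] and sD = uniformizerD[OF s]
  from uniformizer_dividesE[OF t sD(1-4)] obtain W1 e where W1: "openin (zariski X) W1" "p \<in> W1"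
    "W1 \<subseteq> U" "W1 \<subseteq> V" "regular_on X W1 e" "\<forall>q\<in>W1. s q = e q * t q" .
  from uniformizer_dividesE[OF s tD(1-4)] obtain W2 e' where W2: "openin (zariski X) W2" "p \<in> W2"
    "W2 \<subseteq> V" "W2 \<subseteq> U" "regular_on X W2 e'" "\<forall>q\<in>W2. t q = e' q * s q" .
  let ?W = "W1 \<inter> W2"
  have W: "openin (zariski X) ?W" using W1(1) W2(1) by (rule openin_Int)
  have "e p \<noteq> 0"
  proof
    assume ep: "e p = 0"
    define h where "h q = - 1 + e q * e' q" for q
    have "regular_on X ?W h" unfolding h_def
      by (intro regular_on_add regular_on_const[OF W] regular_on_mult
          regular_on_subset[OF W1(5) W] regular_on_subset[OF W2(5) W]) auto
    then have N: "openin (zariski X) {q \<in> ?W. h q \<noteq> 0}" by (rule openin_regular_nonzero)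
    moreover have "p \<in> {q \<in> ?W. h q \<noteq> 0}" using W1(2) W2(2) ep by (simp add: h_def)
    ultimately obtain q where q: "q \<in> ?W" "h q \<noteq> 0" "s q \<noteq> 0"
      using uniformizer_not_locally_zero[OF X s] by blast
    have "s q = e q * t q" "t q = e' q * s q" using W1(6) W2(6) q(1) by blast+
    then have "s q = e q * (e' q * s q)" by metis
    then have "h q * s q = 0" by (simp add: h_def algebra_simps)
    then show False using q by simp
  qed
  then show ?thesis
  proof (intro that[of "{q \<in> W1. e q \<noteq> 0}" e])
    show o: "openin (zariski X) {q \<in> W1. e q \<noteq> 0}" by (rule openin_regular_nonzero[OF W1(5)])
    show "unit_on X {q \<in> W1. e q \<noteq> 0} e"
      unfolding unit_on_def using regular_on_subset[OF W1(5) o] by auto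
  qed (use W1 in auto)
qed

section \<open>The line bundle of a divisor\<close>

text \<open>
  A choice of uniformizers on neighbourhoods so small that \<open>t x\<close> vanishes only at \<open>x\<close> and that no
  point of \<open>D\<close> other than \<open>x\<close> lies in \<open>U x\<close>. Two different neighbourhoods then meet outside of \<open>D\<close> only,
  where all local equations of divisors on \<open>D\<close> are units, and one choice serves all these divisors.
\<close>

definition local_parameters ::
  "'n::finite point set \<Rightarrow> 'n point set \<Rightarrow> ('n point \<Rightarrow> 'n point set) \<Rightarrow>
    ('n point \<Rightarrow> 'n point \<Rightarrow> complex) \<Rightarrow> bool" where
  "local_parameters X D U t \<longleftrightarrow> (\<forall>x\<in>X. uniformizer X x (U x) (t x) \<and> U x \<inter> D \<subseteq> {x} \<and>
     (\<forall>q\<in>U x. t x q = 0 \<longrightarrow> q = x))"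

lemma local_parametersD:
  assumes "local_parameters X D U t" "x \<in> X"
  shows "uniformizer X x (U x) (t x)" "\<lbrakk>q \<in> U x; q \<in> D\<rbrakk> \<Longrightarrow> q = x"
    "\<lbrakk>q \<in> U x; t x q = 0\<rbrakk> \<Longrightarrow> q = x"
  using assms unfolding local_parameters_def by blast+

lemma local_parameters_exist:
  assumes "marked_curve X D"
  obtains U t where "local_parameters X D U t"
proof -
  have "\<exists>U t. uniformizer X x U t \<and> U \<inter> D \<subseteq> {x} \<and> (\<forall>q\<in>U. t q = 0 \<longrightarrow> q = x)" if x: "x \<in> X" for x
  proof -
    obtain U t where t: "uniformizer X x U t"
      using assms x unfolding marked_curve_def smooth_projective_curve_def by blast
    from uniformizer_isolated_zero[OF t] obtain W where W: "openin (zariski X) W" "x \<in> W" "W \<subseteq> U"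
      "\<forall>q\<in>W. t q = 0 \<longrightarrow> q = x" .
    have "finite (D - {x})" using assms unfolding marked_curve_def by blast
    then have "openin (zariski X) (W - (D - {x}))" by (rule openin_zariski_remove_finite[OF W(1)])
    then have "uniformizer X x (W - (D - {x})) t"
      by (rule uniformizer_subset[OF t]) (use W in auto)
    then show ?thesis using W(4) by (intro exI[of _ "W - (D - {x})"] exI[of _ t]) auto
  qed
  then have "\<forall>x\<in>X. \<exists>U t. uniformizer X x U t \<and> U \<inter> D \<subseteq> {x} \<and> (\<forall>q\<in>U. t q = 0 \<longrightarrow> q = x)" ..
  then have "\<exists>U t. local_parameters X D U t" unfolding local_parameters_def by (subst (asm) bchoice_iff) (subst (asm) bchoice_iff, blast)
  then show ?thesis using that by blast
qed

text \<open>
  The cocycle of \<open>\<O>\<^sub>X(H)\<close> for the local equations \<open>t x powi H(x)\<close>. The diagonal is treated separately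
  because there the quotient is \<open>0 / 0 = 0\<close> at \<open>x\<close> when \<open>H(x)\<close> is nonzero.
\<close>

definition divisor_transition ::
  "('n point \<Rightarrow> 'n point \<Rightarrow> complex) \<Rightarrow> ('n point \<Rightarrow>\<^sub>0 int) \<Rightarrow> 'n point \<Rightarrow> 'n point \<Rightarrow> 'n point \<Rightarrow> complex"
where
  "divisor_transition t H x y q = (if x = y then 1
     else t x q powi div_coeff H x / t y q powi div_coeff H y)"

context
  fixes X D :: "'n::finite point set" and U t
  assumes XD: "marked_curve X D" and lp: "local_parameters X D U t"
begin

lemma parameter_openin: "x \<in> X \<Longrightarrow> openin (zariski X) (U x)"
  and parameter_mem: "x \<in> X \<Longrightarrow> x \<in> U x"
  using uniformizerD[OF local_parametersD(1)[OF lp]] by blast+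

lemma parameter_nonzero:
  assumes "x \<in> X" "y \<in> X" "x \<noteq> y" "q \<in> U x" "q \<in> U y" "x \<in> D"
  shows "t x q \<noteq> 0"
proof
  assume "t x q = 0"
  then have "q = x" using local_parametersD(3)[OF lp] assms by blast
  then have "x = y" using local_parametersD(2)[OF lp assms(2)] assms by blast
  then show False using assms by blast
qed

lemma lookup_nonzero_imp_mem: "div_supp H \<subseteq> D \<Longrightarrow> div_coeff H x \<noteq> 0 \<Longrightarrow> x \<in> D"
  by (meson in_keys_iff subsetD)

text \<open>
  For \<open>x \<in> D\<close>, the only zero \<open>x\<close> of \<open>t x\<close> is not in \<open>U y\<close>; for \<open>x \<notin> D\<close>, the exponent is zero.
\<close>

lemma parameter_power_unit:
  assumes H: "div_supp H \<subseteq> D" and xy: "x \<in> X" "y \<in> X" "x \<noteq> y"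
  shows "unit_on X (U x \<inter> U y) (\<lambda>q. t x q powi div_coeff H x)"
proof -
  have o: "openin (zariski X) (U x \<inter> U y)" using parameter_openin xy by blast
  show ?thesis
  proof (cases "div_coeff H x = 0")
    case True
    then show ?thesis using unit_on_const[OF o, of 1] by simp
  next
    case False
    have "regular_on X (U x \<inter> U y) (t x)"
      using uniformizerD(3)[OF local_parametersD(1)[OF lp xy(1)]] o by (rule regular_on_subset) simp
    then have "unit_on X (U x \<inter> U y) (t x)"
      unfolding unit_on_def using parameter_nonzero[OF xy] lookup_nonzero_imp_mem[OF H False] by blast
    then show ?thesis by (rule unit_on_power_int[OF o])
  qed
qed

text \<open>
  At a point of \<open>U x\<close> other than \<open>x\<close>, the coefficient of \<open>H\<close> is zero and \<open>t x\<close> does not vanish, so the power of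
  \<open>t x\<close> is itself the unit in the definition of a local equation.
\<close>

lemma local_equation_parameter_power:
  assumes H: "div_supp H \<subseteq> D" and x: "x \<in> X"
  shows "local_equation X H (U x) (\<lambda>q. t x q powi div_coeff H x)"
  unfolding local_equation_def
proof
  fix p assume p: "p \<in> U x"
  have pX: "p \<in> X" using p openin_zariski_subset[OF parameter_openin[OF x]] by blast
  show "\<exists>W s u. W \<subseteq> U x \<and> uniformizer X p W s \<and> unit_on X W u \<and>
    (\<forall>q\<in>W - div_supp H.
      t x q powi div_coeff H x = u q * s q powi div_coeff H p)"
  proof (cases "p = x")
    case True
    have "unit_on X (U x) (\<lambda>q. 1)" using parameter_openin[OF x] by (rule unit_on_const) simp
    then show ?thesis using True local_parametersD(1)[OF lp x]
      by (intro exI[of _ "U x"] exI[of _ "t x"] exI[of _ "\<lambda>q. 1"]) auto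
  next
    case False
    have "p \<notin> D" using local_parametersD(2)[OF lp x] p False by blast
    then have Hp: "div_coeff H p = 0" using lookup_nonzero_imp_mem[OF H] by blast
    let ?W = "(U x \<inter> U p) - {x}"
    have W: "openin (zariski X) ?W"
      by (intro openin_zariski_remove_finite openin_Int parameter_openin x pX) simp
    have "uniformizer X p ?W (t p)"
      by (rule uniformizer_subset[OF local_parametersD(1)[OF lp pX] W])
        (use p False parameter_mem[OF pX] in auto)
    moreover have "unit_on X ?W (\<lambda>q. t x q powi div_coeff H x)"
    proof (rule unit_on_power_int[OF W])
      have "regular_on X ?W (t x)"
        using uniformizerD(3)[OF local_parametersD(1)[OF lp x]] W by (rule regular_on_subset) auto
      then show "unit_on X ?W (t x)"
        unfolding unit_on_def using local_parametersD(3)[OF lp x] by blast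
    qed
    ultimately show ?thesis
      by (intro exI[of _ ?W] exI[of _ "t p"]
          exI[of _ "\<lambda>q. t x q powi div_coeff H x"]) (auto simp: Hp)
  qed
qed

lemma line_bundle_divisor_transition:
  assumes H: "div_supp H \<subseteq> D"
  shows "line_bundle X (U, divisor_transition t H)"
proof (rule line_bundleI)
  fix x y assume xy: "x \<in> X" "y \<in> X"
  have o: "openin (zariski X) (U x \<inter> U y)" using parameter_openin xy by blast
  show "unit_on X (U x \<inter> U y) (divisor_transition t H x y)"
  proof (cases "x = y")
    case True
    then show ?thesis using unit_on_const[OF o, of 1] by (auto simp: divisor_transition_def elim: unit_on_cong)
  next
    case False
    have "unit_on X (U x \<inter> U y) (\<lambda>q. t y q powi div_coeff H y)"
      using parameter_power_unit[OF H xy(2,1)] False by (simp add: Int_commute)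
    from unit_on_divide[OF parameter_power_unit[OF H xy False] this]
    show ?thesis by (rule unit_on_cong) (simp add: divisor_transition_def False)
  qed
next
  fix x y z q assume *: "x \<in> X" "y \<in> X" "z \<in> X" "q \<in> U x" "q \<in> U y" "q \<in> U z"
  have nz: "t a q powi div_coeff H a \<noteq> 0"
    if "a \<in> X" "b \<in> X" "a \<noteq> b" "q \<in> U a" "q \<in> U b" for a b
    using parameter_power_unit[OF H that(1-3)] that(4,5) unfolding unit_on_def by blast
  have "t x q powi div_coeff H x \<noteq> 0" if "x \<noteq> y"
    using nz[of x y] that * by blast
  moreover have "t y q powi div_coeff H y \<noteq> 0" if "x \<noteq> y \<or> y \<noteq> z"
    using nz[of y x] nz[of y z] that * by blast
  ultimately
  show "divisor_transition t H x z q = divisor_transition t H x y q * divisor_transition t H y z q"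
    by (auto simp: divisor_transition_def)
qed (use parameter_openin parameter_mem in auto)

lemma parameter_power_off_support:
  assumes "x \<in> X" "q \<in> U x" "q \<notin> div_supp H"
  shows "t x q powi div_coeff H x \<noteq> 0"
  using local_parametersD(3)[OF lp assms(1,2)] assms(3) by (auto simp: in_keys_iff)

lemma divisor_cocycle_divisor_transition:
  assumes H: "div_supp H \<subseteq> D"
  shows "divisor_cocycle X H (U, divisor_transition t H)"
  unfolding divisor_cocycle.simps
proof (intro conjI exI ballI)
  show "line_bundle X (U, divisor_transition t H)" by (rule line_bundle_divisor_transition[OF H])
  show "local_equation X H (U x) (\<lambda>q. t x q powi div_coeff H x)" if "x \<in> X" for x
    by (rule local_equation_parameter_power[OF H that])
  show "divisor_transition t H x y q =
      t x q powi div_coeff H x / t y q powi div_coeff H y"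
    if "x \<in> X" "y \<in> X" "q \<in> U x \<inter> U y - div_supp H" for x y q
    using parameter_power_off_support[of x q H] that by (auto simp: divisor_transition_def)
qed

lemma local_equation_nonzero:
  assumes f: "local_equation X H V f" and q: "q \<in> V" "q \<notin> div_supp H"
  shows "f q \<noteq> 0"
proof -
  from f q(1) obtain W s u where *: "uniformizer X q W s" "unit_on X W u"
    "\<forall>q' \<in> W - div_supp H. f q' = u q' * s q' powi div_coeff H q"
    unfolding local_equation_def by blast
  have "q \<in> W" using uniformizerD(2)[OF *(1)] .
  then have "f q = u q" "u q \<noteq> 0" using * q(2) unfolding unit_on_def by (auto simp: in_keys_iff)
  then show ?thesis by simp
qed

text \<open>
  Near \<open>x\<close>, two local equations of \<open>H\<close> are the same power of two uniformizers, up to units, and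
  uniformizers differ by a unit.
\<close>

lemma local_equation_quotient:
  assumes x: "x \<in> X" "x \<in> V" and f: "local_equation X H V f"
  obtains W l where "openin (zariski X) W" "x \<in> W" "W \<subseteq> U x" "W \<subseteq> V" "unit_on X W l"
    "\<forall>q \<in> W - div_supp H. f q = l q * t x q powi div_coeff H x"
proof -
  have curve: "smooth_projective_curve X" using XD unfolding marked_curve_def by blast
  from f x(2) obtain V' s u where V': "V' \<subseteq> V" "uniformizer X x V' s" "unit_on X V' u"
    "\<forall>q \<in> V' - div_supp H. f q = u q * s q powi div_coeff H x"
    unfolding local_equation_def by blast
  from uniformizers_differ_by_unit[OF curve local_parametersD(1)[OF lp x(1)] V'(2)]
  obtain W e where W: "openin (zariski X) W" "x \<in> W" "W \<subseteq> U x" "W \<subseteq> V'" "unit_on X W e"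
    "\<forall>q\<in>W. s q = e q * t x q" .
  show ?thesis
  proof (rule that[OF W(1-3)])
    show "unit_on X W (\<lambda>q. u q * e q powi div_coeff H x)"
      by (intro unit_on_mult unit_on_power_int W(1,5) unit_on_subset[OF V'(3) W(1,4)])
    show "\<forall>q\<in>W - div_supp H. f q =
        u q * e q powi div_coeff H x * t x q powi div_coeff H x"
      using W(4,6) V'(4) by (auto simp: power_int_mult_distrib)
  qed (use W(4) V'(1) in blast)
qed

text \<open>
  The units comparing the two systems of local equations form an isomorphism of line bundles. Outside
  of the support of \<open>H\<close> the compatibility is an identity between quotients of local equations; a point of
  the support lies in a single \<open>U x\<close>, where both transition functions are 1.
\<close>

lemma divisor_cocycle_iso:
  assumes H: "div_supp H \<subseteq> D" and c: "divisor_cocycle X H (V, h)"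
  shows "line_bundle_iso X (U, divisor_transition t H) (V, h)"
proof -
  from c obtain f where Vh: "line_bundle X (V, h)" and f: "\<forall>x\<in>X. local_equation X H (V x) (f x)"
    and h: "\<forall>x\<in>X. \<forall>y\<in>X. \<forall>q \<in> V x \<inter> V y - div_supp H. h x y q = f x q / f y q"
    unfolding divisor_cocycle.simps by blast
  note VhD = line_bundleD[OF Vh]
  have "\<exists>W l. openin (zariski X) W \<and> x \<in> W \<and> W \<subseteq> U x \<and> W \<subseteq> V x \<and> unit_on X W l \<and>
    (\<forall>q \<in> W - div_supp H. f x q = l q * t x q powi div_coeff H x)"
    if x: "x \<in> X" for x
    by (rule local_equation_quotient[OF x VhD(2)[OF x] bspec[OF f x]]) blast
  then have "\<exists>W. \<forall>x\<in>X. \<exists>l. openin (zariski X) (W x) \<and> x \<in> W x \<and> W x \<subseteq> U x \<and> W x \<subseteq> V x \<and>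
    unit_on X (W x) l \<and>
    (\<forall>q \<in> W x - div_supp H. f x q = l q * t x q powi div_coeff H x)"
    by (intro bchoice ballI)
  then obtain W where "\<forall>x\<in>X. \<exists>l. openin (zariski X) (W x) \<and> x \<in> W x \<and> W x \<subseteq> U x \<and> W x \<subseteq> V x \<and>
    unit_on X (W x) l \<and>
    (\<forall>q \<in> W x - div_supp H. f x q = l q * t x q powi div_coeff H x)" by (rule exE)
  from bchoice[OF this] obtain l where
    "\<forall>x\<in>X. openin (zariski X) (W x) \<and> x \<in> W x \<and> W x \<subseteq> U x \<and> W x \<subseteq> V x \<and>
    unit_on X (W x) (l x) \<and>
    (\<forall>q \<in> W x - div_supp H. f x q = l x q * t x q powi div_coeff H x)"
    by (rule exE)
  then have W: "\<And>x. x \<in> X \<Longrightarrow> openin (zariski X) (W x)" "\<And>x. x \<in> X \<Longrightarrow> x \<in> W x"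
      "\<And>x. x \<in> X \<Longrightarrow> W x \<subseteq> U x" "\<And>x. x \<in> X \<Longrightarrow> W x \<subseteq> V x"
      "\<And>x. x \<in> X \<Longrightarrow> unit_on X (W x) (l x)"
    and l: "\<And>x q. \<lbrakk>x \<in> X; q \<in> W x; q \<notin> div_supp H\<rbrakk> \<Longrightarrow>
      f x q = l x q * t x q powi div_coeff H x"
    by auto
  show ?thesis
  proof (rule line_bundle_isoI[OF W])
    fix x y q assume xy: "x \<in> X" "y \<in> X" "q \<in> W x" "q \<in> W y"
    have q: "q \<in> U x" "q \<in> U y" "q \<in> V x" "q \<in> V y" using W(3,4) xy by blast+
    show "h x y q * l y q = l x q * divisor_transition t H x y q"
    proof (cases "q \<in> div_supp H")
      case True
      then have "q \<in> D" using H by blast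
      then have "q = x" "q = y" using local_parametersD(2)[OF lp] xy q by blast+
      then show ?thesis using line_bundle_self_transition[OF Vh xy(1) q(3)]
        by (simp add: divisor_transition_def)
    next
      case False
      have "f x q \<noteq> 0" "f y q \<noteq> 0"
        using local_equation_nonzero[of H "V x" "f x" q] local_equation_nonzero[of H "V y" "f y" q]
          f xy q False by blast+
      then have nz: "t x q powi div_coeff H x \<noteq> 0" "t y q powi div_coeff H y \<noteq> 0"
        "l y q \<noteq> 0"
        using l xy False by auto
      have "h x y q * l y q = (l x q * t x q powi div_coeff H x) /
          (l y q * t y q powi div_coeff H y) * l y q"
        using h xy q False l[OF xy(1,3) False] l[OF xy(2,4) False] by simp
      also have "\<dots> = l x q * (t x q powi div_coeff H x / t y q powi div_coeff H y)"
        using nz by (simp add: field_simps)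
      also have "\<dots> = l x q * divisor_transition t H x y q"
        using nz by (auto simp: divisor_transition_def)
      finally show ?thesis .
    qed
  qed
qed

lemma line_bundle_divisor_cocycle: "divisor_cocycle X H a \<Longrightarrow> line_bundle X a"
  by (cases a) simp

lemma divisor_bundle_eq_transition:
  assumes H: "div_supp H \<subseteq> D"
  shows "divisor_bundle X H = line_bundle_class X (U, divisor_transition t H)"
  unfolding divisor_bundle_def
proof (rule line_bundle_equiv_Image[OF _ _ line_bundle_divisor_transition[OF H]])
  show "{a. divisor_cocycle X H a} \<noteq> {}" using divisor_cocycle_divisor_transition[OF H] by blast
  show "line_bundle X b \<and> line_bundle_iso X (U, divisor_transition t H) b"
    if "b \<in> {a. divisor_cocycle X H a}" for b
    using that divisor_cocycle_iso[OF H] line_bundle_divisor_cocycle[of H b] by (cases b) auto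
qed

lemma divisor_bundle_in_Pic_of_parameters:
  "div_supp H \<subseteq> D \<Longrightarrow> divisor_bundle X H \<in> carrier (Pic X)"
  by (simp only: divisor_bundle_eq_transition line_bundle_class_in_Pic line_bundle_divisor_transition)

lemma divisor_bundle_eq_class_of_parameters:
  assumes H: "div_supp H \<subseteq> D" and a: "divisor_cocycle X H a"
  shows "divisor_bundle X H = line_bundle_class X a"
proof -
  have "line_bundle_iso X (U, divisor_transition t H) a"
    using divisor_cocycle_iso[OF H] a by (cases a) auto
  then show ?thesis
    unfolding divisor_bundle_eq_transition[OF H]
    by (subst line_bundle_class_eq_iff)
      (use line_bundle_divisor_transition[OF H] line_bundle_divisor_cocycle[OF a] in auto)
qed

text \<open>
  With the same local parameters for \<open>H\<close>, \<open>H'\<close> and \<open>H + H'\<close>, the cocycles multiply, since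
  they are quotients of powers whose exponents are additive in the divisor.
\<close>

lemma divisor_bundle_add_of_parameters:
  assumes H: "div_supp H \<subseteq> D" and H': "div_supp H' \<subseteq> D"
  shows "divisor_bundle X (H + H') = divisor_bundle X H \<otimes>\<^bsub>Pic X\<^esub> divisor_bundle X H'"
proof -
  have HH: "div_supp (H + H') \<subseteq> D" using H H' Poly_Mapping.keys_add[of H H'] by blast
  note lb = line_bundle_divisor_transition
  have pow: "t x q powi div_coeff (H + H') x =
      t x q powi div_coeff H x * t x q powi div_coeff H' x"
    if "x \<in> X" "y \<in> X" "x \<noteq> y" "q \<in> U x" "q \<in> U y" for x y q
  proof (cases "x \<in> D")
    case True
    then show ?thesis using parameter_nonzero[OF that True] by (simp add: lookup_add power_int_add)
  next
    case False
    then have "div_coeff H x = 0" "div_coeff H' x = 0"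
      using lookup_nonzero_imp_mem H H' by blast+
    then show ?thesis by (simp add: lookup_add)
  qed
  have "line_bundle_iso X (U, divisor_transition t (H + H'))
      (line_bundle_tensor (U, divisor_transition t H) (U, divisor_transition t H'))"
    unfolding line_bundle_tensor.simps
  proof (rule line_bundle_iso_agree[OF lb[OF HH]])
    fix x y q assume xy: "x \<in> X" "y \<in> X" "q \<in> U x" "q \<in> U y"
    show "divisor_transition t (H + H') x y q = divisor_transition t H x y q * divisor_transition t H' x y q"
      using pow[of x y q] pow[of y x q] xy by (auto simp: divisor_transition_def)
  qed simp
  then show ?thesis
    unfolding divisor_bundle_eq_transition[OF H] divisor_bundle_eq_transition[OF H']
      divisor_bundle_eq_transition[OF HH] mult_Pic[OF lb[OF H] lb[OF H']]
    by (subst line_bundle_class_eq_iff) (use lb[OF HH] line_bundle_tensor[OF lb[OF H] lb[OF H']] in auto)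
qed

end

lemma divisor_bundle_in_Pic:
  assumes "marked_curve X D" "div_supp H \<subseteq> D"
  shows "divisor_bundle X H \<in> carrier (Pic X)"
  by (rule local_parameters_exist[OF assms(1)]) (rule divisor_bundle_in_Pic_of_parameters[OF assms(1) _ assms(2)])

lemma divisor_bundle_eq_class:
  assumes "marked_curve X D" "div_supp H \<subseteq> D" "divisor_cocycle X H a"
  shows "divisor_bundle X H = line_bundle_class X a"
  by (rule local_parameters_exist[OF assms(1)]) (rule divisor_bundle_eq_class_of_parameters[OF assms(1) _ assms(2,3)])

lemma divisor_bundle_add:
  assumes "marked_curve X D" "div_supp H \<subseteq> D" "div_supp H' \<subseteq> D"
  shows "divisor_bundle X (H + H') = divisor_bundle X H \<otimes>\<^bsub>Pic X\<^esub> divisor_bundle X H'"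
  by (rule local_parameters_exist[OF assms(1)]) (rule divisor_bundle_add_of_parameters[OF assms(1) _ assms(2,3)])

lemma divisor_cocycle_exists:
  assumes "marked_curve X D" "div_supp H \<subseteq> D"
  obtains a where "divisor_cocycle X H a"
  by (rule local_parameters_exist[OF assms(1)])
    (rule that[OF divisor_cocycle_divisor_transition[OF assms(1) _ assms(2)]])

section \<open>Automorphisms and pullbacks\<close>

lemma endomorphismD:
  assumes "endomorphism X \<sigma>"
  shows "continuous_map (zariski X) (zariski X) \<sigma>"
    "\<lbrakk>openin (zariski X) V; regular_on X V f\<rbrakk> \<Longrightarrow> regular_on X {q \<in> X. \<sigma> q \<in> V} (f \<circ> \<sigma>)"
  using assms unfolding endomorphism_def by blast+

context
  fixes X :: "'n::finite point set"
  assumes X: "X \<subseteq> proj_space"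
begin

lemma endomorphism_mem: "endomorphism X \<sigma> \<Longrightarrow> x \<in> X \<Longrightarrow> \<sigma> x \<in> X"
  using continuous_map_funspace[OF endomorphismD(1), of X \<sigma>] topspace_zariski[OF X]
  by (auto simp del: topspace_subtopology)

lemma endomorphism_preimage_openin:
  "endomorphism X \<sigma> \<Longrightarrow> openin (zariski X) V \<Longrightarrow> openin (zariski X) {q \<in> X. \<sigma> q \<in> V}"
  using openin_continuous_map_preimage[OF endomorphismD(1), of X \<sigma> V] topspace_zariski[OF X]
  by (simp del: topspace_subtopology)

lemma endomorphism_cong:
  assumes \<sigma>: "endomorphism X \<sigma>" and eq: "\<And>x. x \<in> X \<Longrightarrow> \<sigma> x = \<tau> x"
  shows "endomorphism X \<tau>"
  unfolding endomorphism_def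
proof (intro conjI allI impI)
  show "continuous_map (zariski X) (zariski X) \<tau>"
    by (rule continuous_map_eq[OF endomorphismD(1)[OF \<sigma>]]) (simp add: topspace_zariski[OF X] eq)
  fix V f assume V: "openin (zariski X) V \<and> regular_on X V f"
  have "{q \<in> X. \<tau> q \<in> V} = {q \<in> X. \<sigma> q \<in> V}" using eq by auto
  moreover have "regular_on X {q \<in> X. \<sigma> q \<in> V} (f \<circ> \<tau>)"
    by (rule regular_on_cong[OF endomorphismD(2)[OF \<sigma> conjunct1[OF V] conjunct2[OF V]]])
      (use eq in auto)
  ultimately show "regular_on X {q \<in> X. \<tau> q \<in> V} (f \<circ> \<tau>)" by simp
qed

lemma endomorphism_id: "endomorphism X (\<lambda>x. x)"
  unfolding endomorphism_def
proof (intro conjI allI impI)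
  fix V f assume V: "openin (zariski X) V \<and> regular_on X V f"
  then have "{q \<in> X. q \<in> V} = V" using openin_zariski_subset by blast
  then show "regular_on X {q \<in> X. q \<in> V} (f \<circ> (\<lambda>x. x))" using V by (simp add: comp_def)
qed simp

lemma endomorphism_comp:
  assumes \<sigma>: "endomorphism X \<sigma>" and \<tau>: "endomorphism X \<tau>"
  shows "endomorphism X (\<sigma> \<circ> \<tau>)"
  unfolding endomorphism_def
proof (intro conjI allI impI)
  show "continuous_map (zariski X) (zariski X) (\<sigma> \<circ> \<tau>)"
    using endomorphismD(1)[OF \<tau>] endomorphismD(1)[OF \<sigma>] by (rule continuous_map_compose)
  fix V f assume V: "openin (zariski X) V \<and> regular_on X V f"
  let ?V = "{q \<in> X. \<sigma> q \<in> V}"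
  have "{q \<in> X. (\<sigma> \<circ> \<tau>) q \<in> V} = {q \<in> X. \<tau> q \<in> ?V}" using endomorphism_mem[OF \<tau>] by auto
  moreover have "regular_on X {q \<in> X. \<tau> q \<in> ?V} ((f \<circ> \<sigma>) \<circ> \<tau>)"
    using V by (intro endomorphismD(2)[OF \<tau>] endomorphismD(2)[OF \<sigma>]
        endomorphism_preimage_openin[OF \<sigma>]) auto
  ultimately show "regular_on X {q \<in> X. (\<sigma> \<circ> \<tau>) q \<in> V} (f \<circ> (\<sigma> \<circ> \<tau>))" by (simp add: comp_assoc)
qed

lemma unit_on_pullback:
  assumes "endomorphism X \<sigma>" "openin (zariski X) V" "unit_on X V f"
  shows "unit_on X {q \<in> X. \<sigma> q \<in> V} (\<lambda>q. f (\<sigma> q))"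
  using endomorphismD(2)[OF assms(1,2)] assms(3) unfolding unit_on_def comp_def by simp

lemma line_bundle_pullback:
  assumes \<sigma>: "endomorphism X \<sigma>" and a: "line_bundle X a"
  shows "line_bundle X (line_bundle_pullback X \<sigma> a)"
proof -
  obtain U g where Ug: "a = (U, g)" by (cases a)
  note aD = line_bundleD[OF a[unfolded Ug]] and m = endomorphism_mem[OF \<sigma>]
  show ?thesis unfolding Ug line_bundle_pullback.simps
  proof (rule line_bundleI)
    fix x y assume xy: "x \<in> X" "y \<in> X"
    have "unit_on X {q \<in> X. \<sigma> q \<in> U (\<sigma> x) \<inter> U (\<sigma> y)} (\<lambda>q. g (\<sigma> x) (\<sigma> y) (\<sigma> q))"
      by (rule unit_on_pullback[OF \<sigma> _ aD(3)]) (use aD(1) m xy in auto)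
    moreover have "{q \<in> X. \<sigma> q \<in> U (\<sigma> x) \<inter> U (\<sigma> y)} = {q \<in> X. \<sigma> q \<in> U (\<sigma> x)} \<inter> {q \<in> X. \<sigma> q \<in> U (\<sigma> y)}"
      by auto
    ultimately show "unit_on X ({q \<in> X. \<sigma> q \<in> U (\<sigma> x)} \<inter> {q \<in> X. \<sigma> q \<in> U (\<sigma> y)})
      (\<lambda>q. g (\<sigma> x) (\<sigma> y) (\<sigma> q))" by simp
  next
    fix x y z q assume "x \<in> X" "y \<in> X" "z \<in> X" "q \<in> {q \<in> X. \<sigma> q \<in> U (\<sigma> x)}"
      "q \<in> {q \<in> X. \<sigma> q \<in> U (\<sigma> y)}" "q \<in> {q \<in> X. \<sigma> q \<in> U (\<sigma> z)}"
    then show "g (\<sigma> x) (\<sigma> z) (\<sigma> q) = g (\<sigma> x) (\<sigma> y) (\<sigma> q) * g (\<sigma> y) (\<sigma> z) (\<sigma> q)"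
      using aD(4)[of "\<sigma> x" "\<sigma> y" "\<sigma> z" "\<sigma> q"] m by blast
  qed (use aD(1,2) m endomorphism_preimage_openin[OF \<sigma>] in auto)
qed

lemma line_bundle_iso_pullback:
  assumes \<sigma>: "endomorphism X \<sigma>" and ab: "line_bundle_iso X a b"
  shows "line_bundle_iso X (line_bundle_pullback X \<sigma> a) (line_bundle_pullback X \<sigma> b)"
proof -
  obtain U g V h where Ug: "a = (U, g)" "b = (V, h)" by (cases a, cases b)
  note m = endomorphism_mem[OF \<sigma>]
  from line_bundle_isoE[OF ab[unfolded Ug]] obtain W l where
    W: "\<forall>x\<in>X. openin (zariski X) (W x)" "\<forall>x\<in>X. x \<in> W x"
    "\<forall>x\<in>X. W x \<subseteq> U x" "\<forall>x\<in>X. W x \<subseteq> V x" "\<forall>x\<in>X. unit_on X (W x) (l x)"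
    "\<forall>x\<in>X. \<forall>y\<in>X. \<forall>q\<in>W x \<inter> W y. h x y q * l y q = l x q * g x y q" .
  show ?thesis unfolding Ug line_bundle_pullback.simps
  proof (rule line_bundle_isoI[where W = "\<lambda>x. {q \<in> X. \<sigma> q \<in> W (\<sigma> x)}" and l = "\<lambda>x q. l (\<sigma> x) (\<sigma> q)"])
    show "unit_on X {q \<in> X. \<sigma> q \<in> W (\<sigma> x)} (\<lambda>q. l (\<sigma> x) (\<sigma> q))" if "x \<in> X" for x
      by (rule unit_on_pullback[OF \<sigma>]) (use W m that in auto)
  qed (use W m endomorphism_preimage_openin[OF \<sigma>] in auto)
qed

lemma Pic_pullback_class:
  assumes \<sigma>: "endomorphism X \<sigma>" and a: "line_bundle X a"
  shows "Pic_pullback X \<sigma> (line_bundle_class X a) = line_bundle_class X (line_bundle_pullback X \<sigma> a)"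
  unfolding Pic_pullback_def
proof (rule line_bundle_equiv_Image[OF _ _ line_bundle_pullback[OF \<sigma> a]])
  show "line_bundle_pullback X \<sigma> ` line_bundle_class X a \<noteq> {}" using line_bundle_class_self[OF a] by blast
  fix b assume "b \<in> line_bundle_pullback X \<sigma> ` line_bundle_class X a"
  then obtain a' where a': "b = line_bundle_pullback X \<sigma> a'" "a' \<in> line_bundle_class X a" by blast
  then show "line_bundle X b \<and> line_bundle_iso X (line_bundle_pullback X \<sigma> a) b"
    using line_bundle_class_memD[OF a'(2)] line_bundle_pullback[OF \<sigma>] line_bundle_iso_pullback[OF \<sigma>]
    by blast
qed

lemma Pic_pullback_hom:
  assumes \<sigma>: "endomorphism X \<sigma>"
  shows "Pic_pullback X \<sigma> \<in> hom (Pic X) (Pic X)"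
proof (rule homI)
  fix L assume L: "L \<in> carrier (Pic X)"
  from carrier_PicE[OF L] obtain a where a: "line_bundle X a" "L = line_bundle_class X a" .
  show "Pic_pullback X \<sigma> L \<in> carrier (Pic X)"
    unfolding a(2) Pic_pullback_class[OF \<sigma> a(1)]
    by (rule line_bundle_class_in_Pic[OF line_bundle_pullback[OF \<sigma> a(1)]])
next
  fix L M assume L: "L \<in> carrier (Pic X)" and M: "M \<in> carrier (Pic X)"
  from carrier_PicE[OF L] obtain a where a: "line_bundle X a" "L = line_bundle_class X a" .
  from carrier_PicE[OF M] obtain b where b: "line_bundle X b" "M = line_bundle_class X b" .
  have "line_bundle_pullback X \<sigma> (line_bundle_tensor a b) =
      line_bundle_tensor (line_bundle_pullback X \<sigma> a) (line_bundle_pullback X \<sigma> b)"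
    by (cases a; cases b) (auto simp: fun_eq_iff)
  then show "Pic_pullback X \<sigma> (L \<otimes>\<^bsub>Pic X\<^esub> M) = Pic_pullback X \<sigma> L \<otimes>\<^bsub>Pic X\<^esub> Pic_pullback X \<sigma> M"
    unfolding a(2) b(2) by (simp only: mult_Pic line_bundle_tensor Pic_pullback_class \<sigma> a(1) b(1)
        line_bundle_pullback[OF \<sigma>])
qed

lemma Pic_pullback_agree:
  assumes \<sigma>: "endomorphism X \<sigma>" and \<tau>: "endomorphism X \<tau>" and eq: "\<And>x. x \<in> X \<Longrightarrow> \<sigma> x = \<tau> x"
    and L: "L \<in> carrier (Pic X)"
  shows "Pic_pullback X \<sigma> L = Pic_pullback X \<tau> L"
proof -
  from carrier_PicE[OF L] obtain a where a: "line_bundle X a" "L = line_bundle_class X a" .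
  obtain U g where Ug: "a = (U, g)" by (cases a)
  have "line_bundle_iso X (line_bundle_pullback X \<sigma> a) (line_bundle_pullback X \<tau> a)"
    unfolding Ug line_bundle_pullback.simps
    by (rule line_bundle_iso_agree[OF line_bundle_pullback[OF \<sigma> a(1)[unfolded Ug], unfolded line_bundle_pullback.simps]])
      (use eq in auto)
  then show ?thesis unfolding a(2) Pic_pullback_class[OF \<sigma> a(1)] Pic_pullback_class[OF \<tau> a(1)]
    by (subst line_bundle_class_eq_iff) (use line_bundle_pullback \<sigma> \<tau> a(1) in auto)
qed

lemma Pic_pullback_comp:
  assumes \<sigma>: "endomorphism X \<sigma>" and \<tau>: "endomorphism X \<tau>" and L: "L \<in> carrier (Pic X)"
  shows "Pic_pullback X (\<sigma> \<circ> \<tau>) L = Pic_pullback X \<tau> (Pic_pullback X \<sigma> L)"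
proof -
  from carrier_PicE[OF L] obtain a where a: "line_bundle X a" "L = line_bundle_class X a" .
  obtain U g where Ug: "a = (U, g)" by (cases a)
  have "line_bundle_pullback X (\<sigma> \<circ> \<tau>) a = line_bundle_pullback X \<tau> (line_bundle_pullback X \<sigma> a)"
    unfolding Ug using endomorphism_mem[OF \<tau>] by (auto simp: fun_eq_iff)
  then show ?thesis unfolding a(2) Pic_pullback_class[OF \<sigma> a(1)]
      Pic_pullback_class[OF \<tau> line_bundle_pullback[OF \<sigma> a(1)]]
      Pic_pullback_class[OF endomorphism_comp[OF \<sigma> \<tau>] a(1)] by simp
qed

lemma Pic_pullback_id:
  assumes L: "L \<in> carrier (Pic X)"
  shows "Pic_pullback X (\<lambda>x. x) L = L"
proof -
  from carrier_PicE[OF L] obtain a where a: "line_bundle X a" "L = line_bundle_class X a" .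
  obtain U g where Ug: "a = (U, g)" by (cases a)
  note aD = line_bundleD[OF a(1)[unfolded Ug]]
  have "line_bundle_iso X a (line_bundle_pullback X (\<lambda>x. x) a)"
    unfolding Ug line_bundle_pullback.simps
  proof (rule line_bundle_iso_agree[OF a(1)[unfolded Ug]])
    show "U x = {q \<in> X. q \<in> U x}" if "x \<in> X" for x using openin_zariski_subset[OF aD(1)[OF that]] by blast
  qed simp
  then show ?thesis unfolding a(2) Pic_pullback_class[OF endomorphism_id a(1)]
    by (subst eq_commute, subst line_bundle_class_eq_iff) (use line_bundle_pullback endomorphism_id a(1) in auto)
qed

end

lemma carrier_aut_group:
  "\<sigma> \<in> carrier (aut_group X D) \<longleftrightarrow>
    \<sigma> \<in> Bij X \<and> endomorphism X \<sigma> \<and> endomorphism X (inv_into X \<sigma>) \<and> \<sigma> ` D = D"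
  by (simp add: aut_group_def)

lemma autD:
  assumes "\<sigma> \<in> carrier (aut_group X D)"
  shows "\<sigma> \<in> Bij X" "endomorphism X \<sigma>" "endomorphism X (inv_into X \<sigma>)" "\<sigma> ` D = D"
    "bij_betw \<sigma> X X"
  using assms unfolding carrier_aut_group by (auto simp: Bij_def)

lemma one_aut_group: "\<one>\<^bsub>aut_group X D\<^esub> = (\<lambda>x\<in>X. x)"
  by (simp add: aut_group_def BijGroup_def)

lemma mult_aut_group:
  "\<lbrakk>\<sigma> \<in> carrier (aut_group X D); \<tau> \<in> carrier (aut_group X D)\<rbrakk> \<Longrightarrow>
    \<sigma> \<otimes>\<^bsub>aut_group X D\<^esub> \<tau> = compose X \<sigma> \<tau>"
  by (simp add: aut_group_def BijGroup_def)

lemma subgroup_aut_group: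
  assumes X: "X \<subseteq> proj_space" and D: "D \<subseteq> X"
  shows "subgroup (carrier (aut_group X D)) (BijGroup X)"
proof -
  have mult: "\<sigma> \<otimes>\<^bsub>BijGroup X\<^esub> \<tau> = compose X \<sigma> \<tau>" if "\<sigma> \<in> Bij X" "\<tau> \<in> Bij X" for \<sigma> \<tau>
    using that by (simp add: BijGroup_def)
  show ?thesis
  proof (rule group.subgroupI[OF group_BijGroup])
    show "carrier (aut_group X D) \<subseteq> carrier (BijGroup X)"
      using autD(1) by (auto simp: BijGroup_def)
    have inv_id: "inv_into X (\<lambda>x\<in>X. x) x = x" if "x \<in> X" for x
      using inv_into_f_f[of "\<lambda>x\<in>X. x" X x] that by (simp add: inj_on_def)
    have "(\<lambda>x\<in>X. x) \<in> carrier (aut_group X D)"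
      unfolding carrier_aut_group
    proof (intro conjI id_Bij)
      show "endomorphism X (\<lambda>x\<in>X. x)" by (rule endomorphism_cong[OF X endomorphism_id[OF X]]) simp
      show "endomorphism X (inv_into X (\<lambda>x\<in>X. x))"
        by (rule endomorphism_cong[OF X endomorphism_id[OF X]]) (simp add: inv_id)
      show "(\<lambda>x\<in>X. x) ` D = D" using D by (auto simp: image_iff)
    qed
    then show "carrier (aut_group X D) \<noteq> {}" by blast
  next
    fix \<sigma> assume \<sigma>: "\<sigma> \<in> carrier (aut_group X D)"
    note s = autD[OF \<sigma>]
    let ?\<rho> = "\<lambda>x\<in>X. inv_into X \<sigma> x"
    have "endomorphism X ?\<rho>" by (rule endomorphism_cong[OF X s(3)]) simp
    moreover have "inv_into X ?\<rho> x = \<sigma> x" if x: "x \<in> X" for x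
    proof -
      have "inj_on ?\<rho> X" using restrict_inv_into_Bij[OF s(1)] by (simp add: Bij_def bij_betw_def)
      moreover have "\<sigma> x \<in> X" "?\<rho> (\<sigma> x) = x"
        using s(5) x by (auto simp: bij_betw_def inv_into_f_f)
      ultimately show ?thesis by (metis inv_into_f_f)
    qed
    then have "endomorphism X (inv_into X ?\<rho>)" by (intro endomorphism_cong[OF X s(2)]) simp
    moreover have "?\<rho> ` D = D"
    proof -
      have "?\<rho> (\<sigma> x) = x" if "x \<in> D" for x
        using s(5) D that by (auto simp: bij_betw_def inv_into_f_f)
      then have "?\<rho> ` (\<sigma> ` D) = (\<lambda>x. x) ` D" unfolding image_image by (rule image_cong[OF refl])
      then have "?\<rho> ` (\<sigma> ` D) = D" by simp
      then show ?thesis using s(4) by simp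
    qed
    ultimately show "inv\<^bsub>BijGroup X\<^esub> \<sigma> \<in> carrier (aut_group X D)"
      unfolding inv_BijGroup[OF s(1)] carrier_aut_group
      by (intro conjI restrict_inv_into_Bij[OF s(1)])
  next
    fix \<sigma> \<tau> assume \<sigma>: "\<sigma> \<in> carrier (aut_group X D)" and \<tau>: "\<tau> \<in> carrier (aut_group X D)"
    note s = autD[OF \<sigma>] and t = autD[OF \<tau>]
    have "endomorphism X (compose X \<sigma> \<tau>)"
      by (rule endomorphism_cong[OF X endomorphism_comp[OF X s(2) t(2)]]) (simp add: compose_def)
    moreover have "inv_into X (compose X \<sigma> \<tau>) x = (inv_into X \<tau> \<circ> inv_into X \<sigma>) x" if x: "x \<in> X" for x
    proof -
      have "inj_on (compose X \<sigma> \<tau>) X" using compose_Bij[OF s(1) t(1)] by (simp add: Bij_def bij_betw_def)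
      moreover have y: "inv_into X \<sigma> x \<in> X" using Bij_inv_into_mem[OF s(1) x] .
      moreover have z: "inv_into X \<tau> (inv_into X \<sigma> x) \<in> X" using Bij_inv_into_mem[OF t(1) y] .
      moreover have "compose X \<sigma> \<tau> (inv_into X \<tau> (inv_into X \<sigma> x)) = x"
        using s(5) t(5) x y z by (simp add: compose_def bij_betw_def f_inv_into_f)
      ultimately show ?thesis by (metis comp_apply inv_into_f_f)
    qed
    then have "endomorphism X (inv_into X (compose X \<sigma> \<tau>))"
      by (intro endomorphism_cong[OF X endomorphism_comp[OF X t(3) s(3)]]) simp
    moreover have "compose X \<sigma> \<tau> ` D = D"
    proof -
      have "compose X \<sigma> \<tau> ` D = \<sigma> ` \<tau> ` D" unfolding image_image
        using D by (intro image_cong) (auto simp: compose_def)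
      then show ?thesis using s(4) t(4) by simp
    qed
    ultimately show "\<sigma> \<otimes>\<^bsub>BijGroup X\<^esub> \<tau> \<in> carrier (aut_group X D)"
      unfolding mult[OF s(1) t(1)] carrier_aut_group
      by (intro conjI compose_Bij[OF s(1) t(1)])
  qed
qed

lemma group_aut_group:
  assumes "X \<subseteq> proj_space" "D \<subseteq> X"
  shows "group (aut_group X D)"
  using subgroup.subgroup_is_group[OF subgroup_aut_group[OF assms] group_BijGroup]
  by (simp add: aut_group_def)

text \<open>
  To divide \<open>f\<close> by the pullback of \<open>t\<close>, move \<open>f\<close> to \<open>\<sigma> p\<close> with the inverse of \<open>\<sigma>\<close>, divide by \<open>t\<close> there, and pull
  the quotient back.
\<close>

lemma uniformizer_pullback:
  assumes X: "X \<subseteq> proj_space" and \<sigma>: "\<sigma> \<in> carrier (aut_group X D)" and p: "p \<in> X"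
    and t: "uniformizer X (\<sigma> p) U t"
  shows "uniformizer X p {q \<in> X. \<sigma> q \<in> U} (\<lambda>q. t (\<sigma> q))"
proof (rule uniformizerI)
  note s = autD[OF \<sigma>] and tD = uniformizerD[OF t]
  let ?\<rho> = "inv_into X \<sigma>"
  have inv: "?\<rho> (\<sigma> q) = q" if "q \<in> X" for q using s(5) that by (auto simp: bij_betw_def)
  have \<sigma>X: "\<sigma> q \<in> X" if "q \<in> X" for q using endomorphism_mem[OF X s(2) that] .
  show "openin (zariski X) {q \<in> X. \<sigma> q \<in> U}" by (rule endomorphism_preimage_openin[OF X s(2) tD(1)])
  show "p \<in> {q \<in> X. \<sigma> q \<in> U}" using p tD(2) by blast
  show "t (\<sigma> p) = 0" by (rule tD(4))
  show "regular_on X {q \<in> X. \<sigma> q \<in> U} (\<lambda>q. t (\<sigma> q))"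
    using endomorphismD(2)[OF s(2) tD(1,3)] by (simp add: comp_def)
  fix V f assume V: "openin (zariski X) V" "p \<in> V" "regular_on X V f" "f p = 0"
  have 1: "openin (zariski X) {q \<in> X. ?\<rho> q \<in> V}" by (rule endomorphism_preimage_openin[OF X s(3) V(1)])
  have 2: "regular_on X {q \<in> X. ?\<rho> q \<in> V} (f \<circ> ?\<rho>)" by (rule endomorphismD(2)[OF s(3) V(1,3)])
  have 3: "\<sigma> p \<in> {q \<in> X. ?\<rho> q \<in> V}" "(f \<circ> ?\<rho>) (\<sigma> p) = 0" using inv[OF p] \<sigma>X[OF p] V by auto
  from uniformizer_dividesE[OF t 1 3(1) 2 3(2)] obtain W g where
    W: "openin (zariski X) W" "\<sigma> p \<in> W" "W \<subseteq> U" "W \<subseteq> {q \<in> X. ?\<rho> q \<in> V}" "regular_on X W g"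
      "\<forall>q\<in>W. (f \<circ> ?\<rho>) q = g q * t q" .
  have "f q = (g \<circ> \<sigma>) q * t (\<sigma> q)" if "q \<in> X" "\<sigma> q \<in> W" for q
    using bspec[OF W(6) that(2)] inv[OF that(1)] by simp
  moreover have "{q \<in> X. \<sigma> q \<in> W} \<subseteq> {q \<in> X. \<sigma> q \<in> U} \<inter> V" using W(3,4) inv by fastforce
  ultimately show "\<exists>W g. openin (zariski X) W \<and> p \<in> W \<and> W \<subseteq> {q \<in> X. \<sigma> q \<in> U} \<inter> V \<and>
      regular_on X W g \<and> (\<forall>q\<in>W. f q = g q * t (\<sigma> q))"
    using endomorphism_preimage_openin[OF X s(2) W(1)] endomorphismD(2)[OF s(2) W(1,5)] p W(2)
    by (intro exI[of _ "{q \<in> X. \<sigma> q \<in> W}"] exI[of _ "g \<circ> \<sigma>"]) blast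
qed

lemma lookup_div_pullback:
  assumes \<sigma>: "\<sigma> \<in> carrier (aut_group X D)" and H: "div_supp H \<subseteq> X" and p: "p \<in> X"
  shows "div_coeff (div_pullback X \<sigma> H) p = div_coeff H (\<sigma> p)"
  using H unfolding div_pullback_def
proof (induction H rule: frag_induction)
  case (one x)
  have "inv_into X \<sigma> x = p \<longleftrightarrow> x = \<sigma> p"
    using autD(5)[OF \<sigma>] one p by (metis bij_betw_def f_inv_into_f inv_into_f_f)
  then show ?case by (auto simp: lookup_frag_of)
qed (auto simp: frag_extend_diff lookup_minus)

lemma keys_div_pullback:
  assumes \<sigma>: "\<sigma> \<in> carrier (aut_group X D)" and D: "D \<subseteq> X" and H: "div_supp H \<subseteq> D"
  shows "div_supp (div_pullback X \<sigma> H) \<subseteq> D"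
proof -
  have "inv_into X \<sigma> x \<in> D" if "x \<in> D" for x
  proof -
    obtain y where y: "y \<in> D" "x = \<sigma> y" using autD(4)[OF \<sigma>] \<open>x \<in> D\<close> by blast
    then show ?thesis using autD(5)[OF \<sigma>] D by (auto simp: bij_betw_def)
  qed
  then show ?thesis unfolding div_pullback_def using H
    by (intro order_trans[OF keys_frag_extend]) auto
qed

lemma local_equation_pullback:
  assumes X: "X \<subseteq> proj_space" and D: "D \<subseteq> X" and \<sigma>: "\<sigma> \<in> carrier (aut_group X D)"
    and H: "div_supp H \<subseteq> D" and f: "local_equation X H U f"
  shows "local_equation X (div_pullback X \<sigma> H) {q \<in> X. \<sigma> q \<in> U} (\<lambda>q. f (\<sigma> q))"
  unfolding local_equation_def
proof
  fix p assume p: "p \<in> {q \<in> X. \<sigma> q \<in> U}"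
  have HX: "div_supp H \<subseteq> X" using H D by blast
  from f p obtain W t u where W: "W \<subseteq> U" "uniformizer X (\<sigma> p) W t" "unit_on X W u"
    "\<forall>q \<in> W - div_supp H. f q = u q * t q powi div_coeff H (\<sigma> p)"
    unfolding local_equation_def by blast
  have "uniformizer X p {q \<in> X. \<sigma> q \<in> W} (\<lambda>q. t (\<sigma> q))"
    using uniformizer_pullback[OF X \<sigma> _ W(2)] p by blast
  moreover have "unit_on X {q \<in> X. \<sigma> q \<in> W} (\<lambda>q. u (\<sigma> q))"
    by (rule unit_on_pullback[OF X autD(2)[OF \<sigma>] uniformizerD(1)[OF W(2)] W(3)])
  moreover have "f (\<sigma> q) = u (\<sigma> q) * t (\<sigma> q) powi div_coeff (div_pullback X \<sigma> H) p"
    if "q \<in> {q \<in> X. \<sigma> q \<in> W} - div_supp (div_pullback X \<sigma> H)" for q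
  proof -
    have "\<sigma> q \<in> W - div_supp H"
      using that lookup_div_pullback[OF \<sigma> HX, of q] by (auto simp: in_keys_iff)
    then show ?thesis using W(4) lookup_div_pullback[OF \<sigma> HX, of p] p by simp
  qed
  ultimately show "\<exists>W t u. W \<subseteq> {q \<in> X. \<sigma> q \<in> U} \<and> uniformizer X p W t \<and> unit_on X W u \<and>
      (\<forall>q\<in>W - div_supp (div_pullback X \<sigma> H).
        f (\<sigma> q) = u q * t q powi div_coeff (div_pullback X \<sigma> H) p)"
    using W(1) by (intro exI[of _ "{q \<in> X. \<sigma> q \<in> W}"] exI[of _ "\<lambda>q. t (\<sigma> q)"]
        exI[of _ "\<lambda>q. u (\<sigma> q)"]) blast
qed

text \<open>
  The pullback of a local equation of \<open>H\<close> is a local equation of \<open>\<sigma>\<^sup>* H\<close>, because the order of vanishing at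
  \<open>p\<close> becomes that at \<open>\<sigma> p\<close>. Any cocycle computes the class of a divisor, so this gives
  \<open>\<sigma>\<^sup>* \<O>\<^sub>X(H) = \<O>\<^sub>X(\<sigma>\<^sup>* H)\<close>.
\<close>

lemma divisor_cocycle_pullback:
  assumes X: "X \<subseteq> proj_space" and D: "D \<subseteq> X" and \<sigma>: "\<sigma> \<in> carrier (aut_group X D)"
    and H: "div_supp H \<subseteq> D" and a: "divisor_cocycle X H a"
  shows "divisor_cocycle X (div_pullback X \<sigma> H) (line_bundle_pullback X \<sigma> a)"
proof -
  obtain U g where Ug: "a = (U, g)" by (cases a)
  have HX: "div_supp H \<subseteq> X" using H D by blast
  from a[unfolded Ug] obtain f where lb: "line_bundle X (U, g)"
    and f: "\<forall>x\<in>X. local_equation X H (U x) (f x)"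
    and g: "\<forall>x\<in>X. \<forall>y\<in>X. \<forall>q \<in> U x \<inter> U y - div_supp H. g x y q = f x q / f y q"
    unfolding divisor_cocycle.simps by blast
  have \<sigma>X: "\<sigma> q \<in> X" if "q \<in> X" for q using endomorphism_mem[OF X autD(2)[OF \<sigma>] that] .
  show ?thesis
    unfolding Ug line_bundle_pullback.simps divisor_cocycle.simps
  proof (intro conjI exI[of _ "\<lambda>x q. f (\<sigma> x) (\<sigma> q)"] ballI)
    show "line_bundle X (\<lambda>x. {q \<in> X. \<sigma> q \<in> U (\<sigma> x)}, \<lambda>x y q. g (\<sigma> x) (\<sigma> y) (\<sigma> q))"
      using line_bundle_pullback[OF X autD(2)[OF \<sigma>] lb] by simp
    show "local_equation X (div_pullback X \<sigma> H) {q \<in> X. \<sigma> q \<in> U (\<sigma> x)} (\<lambda>q. f (\<sigma> x) (\<sigma> q))"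
      if "x \<in> X" for x
      by (rule local_equation_pullback[OF X D \<sigma> H]) (use f \<sigma>X that in blast)
    fix x y q assume xy: "x \<in> X" "y \<in> X"
      and q: "q \<in> {q \<in> X. \<sigma> q \<in> U (\<sigma> x)} \<inter> {q \<in> X. \<sigma> q \<in> U (\<sigma> y)} - div_supp (div_pullback X \<sigma> H)"
    then have "\<sigma> q \<in> U (\<sigma> x) \<inter> U (\<sigma> y) - div_supp H"
      using lookup_div_pullback[OF \<sigma> HX, of q] by (auto simp: in_keys_iff)
    then show "g (\<sigma> x) (\<sigma> y) (\<sigma> q) = f (\<sigma> x) (\<sigma> q) / f (\<sigma> y) (\<sigma> q)" using g \<sigma>X xy by blast
  qed
qed

lemma Pic_pullback_divisor_bundle:
  assumes XD: "marked_curve X D" and \<sigma>: "\<sigma> \<in> carrier (aut_group X D)"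
    and H: "div_supp H \<subseteq> D"
  shows "Pic_pullback X \<sigma> (divisor_bundle X H) = divisor_bundle X (div_pullback X \<sigma> H)"
proof -
  have X: "X \<subseteq> proj_space" and D: "D \<subseteq> X"
    using XD curve_subset_proj_space unfolding marked_curve_def by blast+
  obtain a where a: "divisor_cocycle X H a" using divisor_cocycle_exists[OF XD H] .
  have lb: "line_bundle X a" using a by (cases a) simp
  show ?thesis
    unfolding divisor_bundle_eq_class[OF XD H a] Pic_pullback_class[OF X autD(2)[OF \<sigma>] lb]
    by (rule divisor_bundle_eq_class[OF XD keys_div_pullback[OF \<sigma> D H]
          divisor_cocycle_pullback[OF X D \<sigma> H a], symmetric])
qed

section \<open>Semidirect products\<close>

lemma semidirect_product_simps [simp]:
  "carrier (semidirect_product N Q \<phi>) = carrier N \<times> carrier Q"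
  "\<one>\<^bsub>semidirect_product N Q \<phi>\<^esub> = (\<one>\<^bsub>N\<^esub>, \<one>\<^bsub>Q\<^esub>)"
  "(n, q) \<otimes>\<^bsub>semidirect_product N Q \<phi>\<^esub> (n', q') = (n \<otimes>\<^bsub>N\<^esub> \<phi> q n', q \<otimes>\<^bsub>Q\<^esub> q')"
  by (simp_all add: semidirect_product_def)

lemma group_semidirect_product:
  assumes N: "group N" and Q: "group Q"
    and hom: "\<And>q. q \<in> carrier Q \<Longrightarrow> \<phi> q \<in> hom N N"
    and one: "\<And>n. n \<in> carrier N \<Longrightarrow> \<phi> \<one>\<^bsub>Q\<^esub> n = n"
    and mult: "\<And>q q' n. \<lbrakk>q \<in> carrier Q; q' \<in> carrier Q; n \<in> carrier N\<rbrakk> \<Longrightarrow>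
      \<phi> (q \<otimes>\<^bsub>Q\<^esub> q') n = \<phi> q (\<phi> q' n)"
  shows "group (semidirect_product N Q \<phi>)"
proof -
  interpret N: group N by (rule N)
  interpret Q: group Q by (rule Q)
  have closed [simp]: "\<phi> q n \<in> carrier N" if "q \<in> carrier Q" "n \<in> carrier N" for q n
    using hom_in_carrier[OF hom[OF that(1)] that(2)] .
  note hm = hom_mult[OF hom]
  show ?thesis
  proof (rule groupI)
    fix x assume "x \<in> carrier (semidirect_product N Q \<phi>)"
    then obtain n q where x: "x = (n, q)" "n \<in> carrier N" "q \<in> carrier Q" by auto
    let ?y = "(\<phi> (inv\<^bsub>Q\<^esub> q) (inv\<^bsub>N\<^esub> n), inv\<^bsub>Q\<^esub> q)"
    have "\<phi> (inv\<^bsub>Q\<^esub> q) (inv\<^bsub>N\<^esub> n) \<otimes>\<^bsub>N\<^esub> \<phi> (inv\<^bsub>Q\<^esub> q) n = \<phi> (inv\<^bsub>Q\<^esub> q) (inv\<^bsub>N\<^esub> n \<otimes>\<^bsub>N\<^esub> n)"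
      by (rule hm[symmetric]) (use x in auto)
    also have "\<dots> = \<one>\<^bsub>N\<^esub>" using hom_one[OF hom N N] x by simp
    finally show "\<exists>y\<in>carrier (semidirect_product N Q \<phi>). y \<otimes>\<^bsub>semidirect_product N Q \<phi>\<^esub> x =
        \<one>\<^bsub>semidirect_product N Q \<phi>\<^esub>"
      using x by (intro bexI[of _ ?y]) auto
  qed (auto simp: one mult hm N.m_assoc Q.m_assoc)
qed

text \<open>
  Homomorphisms on the two factors combine to one on the semidirect product as soon as they turn the
  action into conjugation.
\<close>

lemma semidirect_product_hom:
  assumes T: "group T" and f: "f \<in> hom N T" and k: "k \<in> hom Q T"
    and act: "\<And>q n. \<lbrakk>q \<in> carrier Q; n \<in> carrier N\<rbrakk> \<Longrightarrow> \<phi> q n \<in> carrier N"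
    and conj: "\<And>q n. \<lbrakk>q \<in> carrier Q; n \<in> carrier N\<rbrakk> \<Longrightarrow> f (\<phi> q n) \<otimes>\<^bsub>T\<^esub> k q = k q \<otimes>\<^bsub>T\<^esub> f n"
  shows "(\<lambda>(n, q). f n \<otimes>\<^bsub>T\<^esub> k q) \<in> hom (semidirect_product N Q \<phi>) T"
proof (rule homI)
  interpret T: group T by (rule T)
  note fc = hom_in_carrier[OF f] and kc = hom_in_carrier[OF k]
  fix x assume "x \<in> carrier (semidirect_product N Q \<phi>)"
  then obtain n q where x: "x = (n, q)" "n \<in> carrier N" "q \<in> carrier Q" by auto
  then show "(case x of (n, q) \<Rightarrow> f n \<otimes>\<^bsub>T\<^esub> k q) \<in> carrier T" using fc kc by simp
  fix y assume "y \<in> carrier (semidirect_product N Q \<phi>)"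
  then obtain n' q' where y: "y = (n', q')" "n' \<in> carrier N" "q' \<in> carrier Q" by auto
  have "f (n \<otimes>\<^bsub>N\<^esub> \<phi> q n') \<otimes>\<^bsub>T\<^esub> k (q \<otimes>\<^bsub>Q\<^esub> q') = f n \<otimes>\<^bsub>T\<^esub> (f (\<phi> q n') \<otimes>\<^bsub>T\<^esub> k q) \<otimes>\<^bsub>T\<^esub> k q'"
    using x y by (simp add: hom_mult[OF f] hom_mult[OF k] act fc kc T.m_assoc)
  also have "\<dots> = f n \<otimes>\<^bsub>T\<^esub> k q \<otimes>\<^bsub>T\<^esub> (f n' \<otimes>\<^bsub>T\<^esub> k q')"
    using x y by (simp add: conj fc kc T.m_assoc)
  finally show "(case x \<otimes>\<^bsub>semidirect_product N Q \<phi>\<^esub> y of (n, q) \<Rightarrow> f n \<otimes>\<^bsub>T\<^esub> k q) =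
      (case x of (n, q) \<Rightarrow> f n \<otimes>\<^bsub>T\<^esub> k q) \<otimes>\<^bsub>T\<^esub> (case y of (n, q) \<Rightarrow> f n \<otimes>\<^bsub>T\<^esub> k q)"
    by (simp add: x(1) y(1))
qed

section \<open>Transport of structure, commuting sets and free abelian groups\<close>

definition transported_group :: "'a set \<Rightarrow> ('a \<Rightarrow> 'b) \<Rightarrow> 'b monoid \<Rightarrow> 'a monoid" where
  "transported_group B \<theta> S = \<lparr>carrier = B, monoid.mult = (\<lambda>a b. inv_into B \<theta> (\<theta> a \<otimes>\<^bsub>S\<^esub> \<theta> b)),
     one = inv_into B \<theta> \<one>\<^bsub>S\<^esub>\<rparr>"

lemma transported_group:
  assumes S: "group S" and \<theta>: "bij_betw \<theta> B (carrier S)"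
  shows "group (transported_group B \<theta> S)" "\<theta> \<in> hom (transported_group B \<theta> S) S"
proof -
  interpret S: group S by (rule S)
  let ?T = "transported_group B \<theta> S"
  have c [simp]: "carrier ?T = B" by (simp add: transported_group_def)
  have inv_B: "inv_into B \<theta> s \<in> B" and \<theta>_inv: "\<theta> (inv_into B \<theta> s) = s" if "s \<in> carrier S" for s
    using \<theta> that by (auto simp: bij_betw_def f_inv_into_f inv_into_into)
  have \<theta>S [simp]: "\<theta> a \<in> carrier S" if "a \<in> B" for a using \<theta> that by (auto simp: bij_betw_def)
  have mult: "\<theta> (a \<otimes>\<^bsub>?T\<^esub> b) = \<theta> a \<otimes>\<^bsub>S\<^esub> \<theta> b" "a \<otimes>\<^bsub>?T\<^esub> b \<in> B" if "a \<in> B" "b \<in> B" for a b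
    using that by (simp_all add: transported_group_def inv_B \<theta>_inv)
  have one: "\<theta> \<one>\<^bsub>?T\<^esub> = \<one>\<^bsub>S\<^esub>" "\<one>\<^bsub>?T\<^esub> \<in> B"
    by (simp_all add: transported_group_def inv_B \<theta>_inv)
  have inj: "a = b" if "\<theta> a = \<theta> b" "a \<in> B" "b \<in> B" for a b
    using \<theta> that by (auto simp: bij_betw_def inj_on_def)
  show "group ?T"
  proof (rule groupI)
    fix x y z assume *: "x \<in> carrier ?T" "y \<in> carrier ?T" "z \<in> carrier ?T"
    then show "x \<otimes>\<^bsub>?T\<^esub> y \<otimes>\<^bsub>?T\<^esub> z = x \<otimes>\<^bsub>?T\<^esub> (y \<otimes>\<^bsub>?T\<^esub> z)"
      by (intro inj) (simp_all add: mult S.m_assoc)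
  next
    fix x assume x: "x \<in> carrier ?T"
    then show "\<one>\<^bsub>?T\<^esub> \<otimes>\<^bsub>?T\<^esub> x = x" by (intro inj) (simp_all add: mult one)
    have "inv_into B \<theta> (inv\<^bsub>S\<^esub> \<theta> x) \<otimes>\<^bsub>?T\<^esub> x = \<one>\<^bsub>?T\<^esub>"
      using x by (intro inj) (simp_all add: mult one inv_B \<theta>_inv)
    then show "\<exists>y\<in>carrier ?T. y \<otimes>\<^bsub>?T\<^esub> x = \<one>\<^bsub>?T\<^esub>" using x inv_B by auto
  qed (use mult one in auto)
  show "\<theta> \<in> hom ?T S" by (rule homI) (auto simp: mult)
qed


text \<open>
  The double centralizer of a commuting set contains it and is commutative. It provides a commutative
  target for the universal property of free abelian groups, although the ambient group need not
  be commutative.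
\<close>

lemma (in group) commuting_set_subset_comm_subgroup:
  assumes S: "S \<subseteq> carrier G" and comm: "\<And>x y. \<lbrakk>x \<in> S; y \<in> S\<rbrakk> \<Longrightarrow> x \<otimes> y = y \<otimes> x"
  obtains C where "S \<subseteq> C" "subgroup C G" "comm_group (G\<lparr>carrier := C\<rparr>)"
proof -
  define Z where "Z A = {g \<in> carrier G. \<forall>a\<in>A. g \<otimes> a = a \<otimes> g}" for A
  have sub: "subgroup (Z A) G" if A: "A \<subseteq> carrier G" for A
  proof (rule subgroupI)
    show "Z A \<subseteq> carrier G" unfolding Z_def by blast
    have "\<one> \<in> Z A" unfolding Z_def using A by auto
    then show "Z A \<noteq> {}" by blast
  next
    fix g assume g: "g \<in> Z A"
    have "inv g \<otimes> a = a \<otimes> inv g" if a: "a \<in> A" for a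
    proof -
      have c: "g \<in> carrier G" "a \<in> carrier G" "g \<otimes> a = a \<otimes> g" using g a A unfolding Z_def by blast+
      have "inv g \<otimes> a = inv g \<otimes> (a \<otimes> g) \<otimes> inv g" using c(1,2) by (simp add: m_assoc)
      also have "\<dots> = inv g \<otimes> (g \<otimes> a) \<otimes> inv g" by (simp only: c(3))
      also have "\<dots> = a \<otimes> inv g" using c(1,2) by (simp flip: m_assoc)
      finally show ?thesis .
    qed
    then show "inv g \<in> Z A" using g unfolding Z_def by blast
  next
    fix g h assume g: "g \<in> Z A" and h: "h \<in> Z A"
    have "g \<otimes> h \<otimes> a = a \<otimes> (g \<otimes> h)" if a: "a \<in> A" for a
    proof -
      have c: "g \<in> carrier G" "h \<in> carrier G" "a \<in> carrier G" "g \<otimes> a = a \<otimes> g" "h \<otimes> a = a \<otimes> h"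
        using g h a A unfolding Z_def by blast+
      have "g \<otimes> h \<otimes> a = g \<otimes> (a \<otimes> h)" using c(1-3) by (simp add: m_assoc c(5))
      also have "\<dots> = (a \<otimes> g) \<otimes> h" using c(1-3) by (simp flip: m_assoc add: c(4))
      finally show ?thesis using c(1-3) by (simp add: m_assoc)
    qed
    then show "g \<otimes> h \<in> Z A" using g h unfolding Z_def by blast
  qed
  have ZS: "S \<subseteq> Z S" using S comm unfolding Z_def by blast
  have Zc: "Z S \<subseteq> carrier G" unfolding Z_def by blast
  have SZZ: "S \<subseteq> Z (Z S)"
  proof
    fix s assume "s \<in> S"
    then show "s \<in> Z (Z S)" using S unfolding Z_def by auto
  qed
  have C: "subgroup (Z (Z S)) G" by (rule sub[OF Zc])
  have ZZ: "Z (Z S) \<subseteq> Z S" using ZS unfolding Z_def by blast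
  have "comm_group (G\<lparr>carrier := Z (Z S)\<rparr>)"
  proof (rule group.group_comm_groupI[OF subgroup_imp_group[OF C]])
    fix x y assume "x \<in> carrier (G\<lparr>carrier := Z (Z S)\<rparr>)" "y \<in> carrier (G\<lparr>carrier := Z (Z S)\<rparr>)"
    then have "x \<in> Z (Z S)" "y \<in> Z S" using ZZ by auto
    then show "x \<otimes>\<^bsub>G\<lparr>carrier := Z (Z S)\<rparr>\<^esub> y = y \<otimes>\<^bsub>G\<lparr>carrier := Z (Z S)\<rparr>\<^esub> x"
      unfolding Z_def[of "Z S"] by simp
  qed
  then show ?thesis using that[OF SZZ C] by blast
qed

lemma (in group) conjugation_hom:
  assumes "c \<in> carrier G"
  shows "(\<lambda>x. c \<otimes> x \<otimes> inv c) \<in> hom G G"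
proof (rule homI)
  fix x y assume "x \<in> carrier G" "y \<in> carrier G"
  then show "c \<otimes> (x \<otimes> y) \<otimes> inv c = c \<otimes> x \<otimes> inv c \<otimes> (c \<otimes> y \<otimes> inv c)"
    using assms inv_solve_left'[of "c \<otimes> y \<otimes> inv c" c "y \<otimes> inv c"] by (simp add: m_assoc flip: m_assoc[of "inv c" c])
qed (use assms in auto)

lemma (in group) conjugation_eq_iff:
  assumes "c \<in> carrier G" "x \<in> carrier G" "y \<in> carrier G"
  shows "c \<otimes> x \<otimes> inv c = y \<longleftrightarrow> c \<otimes> x = y \<otimes> c"
  using assms by (metis inv_solve_right m_closed)

lemma free_Abelian_group_hom_eqI:
  assumes T: "group T" and f: "f \<in> hom (free_Abelian_group D) T" and g: "g \<in> hom (free_Abelian_group D) T"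
    and eq: "\<And>x. x \<in> D \<Longrightarrow> f (frag_of x) = g (frag_of x)" and H: "div_supp H \<subseteq> D"
  shows "f H = g H"
proof -
  have "div_supp H \<subseteq> D \<and> f H = g H"
    using H
  proof (induction H rule: frag_induction)
    case zero
    show ?case using hom_one[OF f _ T] hom_one[OF g _ T] by simp
  next
    case (diff a b)
    then have ab: "div_supp a \<subseteq> D" "div_supp b \<subseteq> D" by blast+
    have sub: "h (a - b) = h a \<otimes>\<^bsub>T\<^esub> inv\<^bsub>T\<^esub> h b" if h: "h \<in> hom (free_Abelian_group D) T" for h
    proof -
      interpret group_hom "free_Abelian_group D" T h
        using h T by (simp add: group_hom_def group_hom_axioms_def)
      show ?thesis using hom_mult[of a "inv\<^bsub>free_Abelian_group D\<^esub> b"] hom_inv[of b] ab by simp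
    qed
    show ?case using sub[OF f] sub[OF g] diff keys_diff[of a b] ab by auto
  qed (use eq in auto)
  then show ?thesis ..
qed

section \<open>The action of symmetries on twists modulo relations\<close>

locale marked_curve_rank =
  fixes X D :: "'n::finite point set" and r :: nat
  assumes marked_curve: "marked_curve X D" and rank_ge_2: "r \<ge> 2"
begin

abbreviation "aut \<equiv> aut_group X D"
abbreviation "divisors \<equiv> free_Abelian_group D"
abbreviation "twists \<equiv> divisors \<times>\<times> Pic X"
abbreviation "relations \<equiv> twisting_subgroup X D r"
abbreviation "twist_quotient \<equiv> twisting_quotient X D r"
abbreviation "symmetries \<equiv> aut \<times>\<times> integer_mod_group 2"
abbreviation "action \<equiv> twisting_action X D r"
abbreviation "semidirect \<equiv> semidirect_product twist_quotient symmetries action"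
abbreviation "twist_class a \<equiv> relations #>\<^bsub>twists\<^esub> a"

definition "twist_pullback \<sigma> = (\<lambda>(H, L). (div_pullback X \<sigma> H, Pic_pullback X \<sigma> L))"

lemma X_subset: "X \<subseteq> proj_space" and D_subset: "D \<subseteq> X" and finite_D: "finite D"
  using marked_curve curve_subset_proj_space unfolding marked_curve_def by blast+

sublocale aut: group aut by (rule group_aut_group[OF X_subset D_subset])
sublocale Pic: comm_group "Pic X" by (rule comm_group_Pic[OF X_subset])
sublocale divisors: comm_group divisors by (rule abelian_free_Abelian_group)

sublocale twists: comm_group twists
  by (rule group.group_comm_groupI[OF DirProd_group[OF divisors.is_group Pic.is_group]])
    (auto simp: add.commute Pic.m_comm)

sublocale symmetries: group symmetries
  by (rule DirProd_group[OF aut.is_group group_integer_mod_group])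

lemma relations_hom: "(\<lambda>H. (frag_cmul (int r) H, divisor_bundle X H)) \<in> hom divisors twists"
proof (rule homI)
  fix H assume H: "H \<in> carrier divisors"
  then have "div_supp (frag_cmul (int r) H) \<subseteq> D"
    using keys_cmul[of "int r" H] by auto
  then show "(frag_cmul (int r) H, divisor_bundle X H) \<in> carrier twists"
    using divisor_bundle_in_Pic[OF marked_curve] H by simp
next
  fix H H' assume "H \<in> carrier divisors" "H' \<in> carrier divisors"
  then show "(frag_cmul (int r) (H \<otimes>\<^bsub>divisors\<^esub> H'), divisor_bundle X (H \<otimes>\<^bsub>divisors\<^esub> H')) =
      (frag_cmul (int r) H, divisor_bundle X H) \<otimes>\<^bsub>twists\<^esub> (frag_cmul (int r) H', divisor_bundle X H')"
    using divisor_bundle_add[OF marked_curve] by (simp add: frag_cmul_distrib2)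
qed

lemma divisor_bundle_hom: "divisor_bundle X \<in> hom divisors (Pic X)"
  using relations_hom unfolding hom_paired by simp

lemma relationI: "div_supp H \<subseteq> D \<Longrightarrow> (frag_cmul (int r) H, divisor_bundle X H) \<in> relations"
  unfolding twisting_subgroup_def by auto

lemma relationE:
  assumes "a \<in> relations"
  obtains H where "div_supp H \<subseteq> D" "a = (frag_cmul (int r) H, divisor_bundle X H)"
  using assms unfolding twisting_subgroup_def by auto

lemma subgroup_relations: "subgroup relations twists"
proof -
  have "relations = (\<lambda>H. (frag_cmul (int r) H, divisor_bundle X H)) ` carrier divisors"
    unfolding twisting_subgroup_def by blast
  then show ?thesis
    using group_hom.img_is_subgroup[of divisors twists] relations_hom
    by (simp add: group_hom_def group_hom_axioms_def divisors.is_group twists.is_group)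
qed

sublocale relations: normal relations twists
  by (rule twists.subgroup_imp_normal[OF subgroup_relations])

sublocale twist_quotient: comm_group twist_quotient
  unfolding twisting_quotient_def by (rule twists.abelian_FactGroup[OF subgroup_relations])

lemma twist_class_hom: "twist_class \<in> hom twists twist_quotient"
  unfolding twisting_quotient_def by (rule relations.r_coset_hom_Mod)

lemma carrier_twist_quotient: "carrier twist_quotient = twist_class ` carrier twists"
  unfolding twisting_quotient_def by (rule carrier_FactGroup)

lemma twist_quotientE:
  assumes "c \<in> carrier twist_quotient"
  obtains a where "a \<in> carrier twists" "c = twist_class a"
  using assms unfolding carrier_twist_quotient by blast

lemma twist_class_closed: "a \<in> carrier twists \<Longrightarrow> twist_class a \<in> carrier twist_quotient"
  unfolding carrier_twist_quotient by blast

lemma twist_class_mult: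
  "\<lbrakk>a \<in> carrier twists; b \<in> carrier twists\<rbrakk> \<Longrightarrow>
    twist_class (a \<otimes>\<^bsub>twists\<^esub> b) = twist_class a \<otimes>\<^bsub>twist_quotient\<^esub> twist_class b"
  by (rule hom_mult[OF twist_class_hom])

lemma twist_class_inv:
  "a \<in> carrier twists \<Longrightarrow> twist_class (inv\<^bsub>twists\<^esub> a) = inv\<^bsub>twist_quotient\<^esub> (twist_class a)"
  using twist_class_hom group_hom.hom_inv[of twists twist_quotient twist_class a]
  by (simp add: group_hom_def group_hom_axioms_def twists.is_group twist_quotient.is_group)

lemma twist_class_relation: "a \<in> relations \<Longrightarrow> twist_class a = \<one>\<^bsub>twist_quotient\<^esub>"
  using relations.rcos_const[OF twists.is_group] by (simp add: twisting_quotient_def)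

lemma twist_class_eqE:
  assumes "a \<in> carrier twists" "b \<in> carrier twists" "twist_class a = twist_class b"
  obtains H where "div_supp H \<subseteq> D" "a = (frag_cmul (int r) H, divisor_bundle X H) \<otimes>\<^bsub>twists\<^esub> b"
proof -
  have "a \<in> twist_class b" using twists.rcos_self[OF assms(1) subgroup_relations] assms(3) by simp
  then obtain n where "n \<in> relations" "a = n \<otimes>\<^bsub>twists\<^esub> b" unfolding r_coset_def by blast
  then show ?thesis using relationE that by metis
qed

lemma div_pullback_hom: "\<sigma> \<in> carrier aut \<Longrightarrow> div_pullback X \<sigma> \<in> hom divisors divisors"
  by (rule homI) (use keys_div_pullback[OF _ D_subset] in \<open>auto simp: div_pullback_def frag_extend_add\<close>)

lemma div_pullback_eqI:
  assumes "div_supp H \<subseteq> D" "div_supp H' \<subseteq> D"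
    and "\<And>p. p \<in> X \<Longrightarrow> div_coeff H p = div_coeff H' p"
  shows "H = H'"
proof (rule poly_mapping_eqI)
  fix p show "div_coeff H p = div_coeff H' p"
    using assms D_subset by (metis in_keys_iff subsetD)
qed

lemma div_pullback_mult:
  assumes \<sigma>: "\<sigma> \<in> carrier aut" and \<tau>: "\<tau> \<in> carrier aut" and H: "div_supp H \<subseteq> D"
  shows "div_pullback X (\<sigma> \<otimes>\<^bsub>aut\<^esub> \<tau>) H = div_pullback X \<tau> (div_pullback X \<sigma> H)"
proof (rule div_pullback_eqI)
  have HX: "div_supp H \<subseteq> X" "div_supp (div_pullback X \<sigma> H) \<subseteq> X"
    using H keys_div_pullback[OF \<sigma> D_subset H] D_subset by blast+
  show "div_supp (div_pullback X (\<sigma> \<otimes>\<^bsub>aut\<^esub> \<tau>) H) \<subseteq> D"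
    by (rule keys_div_pullback[OF aut.m_closed[OF \<sigma> \<tau>] D_subset H])
  show "div_supp (div_pullback X \<tau> (div_pullback X \<sigma> H)) \<subseteq> D"
    by (rule keys_div_pullback[OF \<tau> D_subset keys_div_pullback[OF \<sigma> D_subset H]])
  fix p assume p: "p \<in> X"
  have "\<tau> p \<in> X" using endomorphism_mem[OF X_subset autD(2)[OF \<tau>] p] .
  then show "div_coeff (div_pullback X (\<sigma> \<otimes>\<^bsub>aut\<^esub> \<tau>) H) p =
      div_coeff (div_pullback X \<tau> (div_pullback X \<sigma> H)) p"
    unfolding lookup_div_pullback[OF aut.m_closed[OF \<sigma> \<tau>] HX(1) p] lookup_div_pullback[OF \<tau> HX(2) p]
    using lookup_div_pullback[OF \<sigma> HX(1)] p by (simp add: mult_aut_group[OF \<sigma> \<tau>] compose_def)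
qed

lemma div_pullback_one:
  assumes H: "div_supp H \<subseteq> D"
  shows "div_pullback X \<one>\<^bsub>aut\<^esub> H = H"
proof (rule div_pullback_eqI)
  show "div_supp (div_pullback X \<one>\<^bsub>aut\<^esub> H) \<subseteq> D"
    by (rule keys_div_pullback[OF aut.one_closed D_subset H])
  show "div_coeff (div_pullback X \<one>\<^bsub>aut\<^esub> H) p = div_coeff H p" if "p \<in> X" for p
    using lookup_div_pullback[OF aut.one_closed _ that, of H] H D_subset that by (simp add: one_aut_group)
qed (rule H)

lemma Pic_pullback_mult:
  assumes \<sigma>: "\<sigma> \<in> carrier aut" and \<tau>: "\<tau> \<in> carrier aut" and L: "L \<in> carrier (Pic X)"
  shows "Pic_pullback X (\<sigma> \<otimes>\<^bsub>aut\<^esub> \<tau>) L = Pic_pullback X \<tau> (Pic_pullback X \<sigma> L)"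
proof -
  note s = autD(2)[OF \<sigma>] and t = autD(2)[OF \<tau>]
  have "Pic_pullback X (\<sigma> \<otimes>\<^bsub>aut\<^esub> \<tau>) L = Pic_pullback X (\<sigma> \<circ> \<tau>) L"
    by (rule Pic_pullback_agree[OF X_subset autD(2)[OF aut.m_closed[OF \<sigma> \<tau>]]
          endomorphism_comp[OF X_subset s t] _ L]) (simp add: mult_aut_group[OF \<sigma> \<tau>] compose_def)
  then show ?thesis using Pic_pullback_comp[OF X_subset s t L] by simp
qed

lemma Pic_pullback_one:
  assumes L: "L \<in> carrier (Pic X)"
  shows "Pic_pullback X \<one>\<^bsub>aut\<^esub> L = L"
proof -
  have "Pic_pullback X \<one>\<^bsub>aut\<^esub> L = Pic_pullback X (\<lambda>x. x) L"
    by (rule Pic_pullback_agree[OF X_subset autD(2)[OF aut.one_closed]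
          endomorphism_id[OF X_subset] _ L]) (simp add: one_aut_group)
  then show ?thesis using Pic_pullback_id[OF X_subset L] by simp
qed

lemma twist_pullback_hom:
  assumes "\<sigma> \<in> carrier aut"
  shows "twist_pullback \<sigma> \<in> hom twists twists"
proof (rule homI)
  note d = div_pullback_hom[OF assms] and p = Pic_pullback_hom[OF X_subset autD(2)[OF assms]]
  show "twist_pullback \<sigma> a \<in> carrier twists" if "a \<in> carrier twists" for a
    using that hom_in_carrier[OF d, of "fst a"] hom_in_carrier[OF p, of "snd a"]
    by (auto simp: twist_pullback_def)
  show "twist_pullback \<sigma> (a \<otimes>\<^bsub>twists\<^esub> b) = twist_pullback \<sigma> a \<otimes>\<^bsub>twists\<^esub> twist_pullback \<sigma> b"
    if "a \<in> carrier twists" "b \<in> carrier twists" for a b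
    using that hom_mult[OF d, of "fst a" "fst b"] hom_mult[OF p, of "snd a" "snd b"]
    by (auto simp: twist_pullback_def)
qed

lemmas twist_pullback_closed = hom_in_carrier[OF twist_pullback_hom]

lemma twist_pullback_mult:
  "\<lbrakk>\<sigma> \<in> carrier aut; \<tau> \<in> carrier aut; a \<in> carrier twists\<rbrakk> \<Longrightarrow>
    twist_pullback (\<sigma> \<otimes>\<^bsub>aut\<^esub> \<tau>) a = twist_pullback \<tau> (twist_pullback \<sigma> a)"
  by (cases a) (simp add: twist_pullback_def div_pullback_mult Pic_pullback_mult)

lemma twist_pullback_one: "a \<in> carrier twists \<Longrightarrow> twist_pullback \<one>\<^bsub>aut\<^esub> a = a"
  by (cases a) (simp add: twist_pullback_def div_pullback_one Pic_pullback_one)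

lemma twist_pullback_inv:
  assumes "\<sigma> \<in> carrier aut" "a \<in> carrier twists"
  shows "twist_pullback \<sigma> (inv\<^bsub>twists\<^esub> a) = inv\<^bsub>twists\<^esub> (twist_pullback \<sigma> a)"
  using twist_pullback_hom[OF assms(1)] group_hom.hom_inv[of twists twists "twist_pullback \<sigma>" a] assms(2)
  by (simp add: group_hom_def group_hom_axioms_def twists.is_group)

lemma twist_pullback_relation:
  assumes \<sigma>: "\<sigma> \<in> carrier aut" and a: "a \<in> relations"
  shows "twist_pullback \<sigma> a \<in> relations"
proof -
  from relationE[OF a] obtain H where H: "div_supp H \<subseteq> D"
    "a = (frag_cmul (int r) H, divisor_bundle X H)" .
  have "div_pullback X \<sigma> (frag_cmul (int r) H) = frag_cmul (int r) (div_pullback X \<sigma> H)"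
    unfolding div_pullback_def by (rule frag_extend_cmul)
  then have "twist_pullback \<sigma> a = (frag_cmul (int r) (div_pullback X \<sigma> H), divisor_bundle X (div_pullback X \<sigma> H))"
    using Pic_pullback_divisor_bundle[OF marked_curve \<sigma> H(1)] by (simp add: H(2) twist_pullback_def)
  then show ?thesis using relationI[OF keys_div_pullback[OF \<sigma> D_subset H(1)]] by simp
qed

text \<open>
  The action on cosets is defined by taking images of sets, so the image of a coset must be shown to be
  a full coset: every relation is the pullback of a relation, namely of its pullback under the inverse.
\<close>

lemma image_twist_class:
  assumes \<sigma>: "\<sigma> \<in> carrier aut" and a: "a \<in> carrier twists"
  shows "twist_pullback \<sigma> ` twist_class a = twist_class (twist_pullback \<sigma> a)"
proof (intro equalityI subsetI)
  fix b assume "b \<in> twist_pullback \<sigma> ` twist_class a"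
  then obtain n where n: "n \<in> relations" "b = twist_pullback \<sigma> (n \<otimes>\<^bsub>twists\<^esub> a)"
    unfolding r_coset_def by blast
  then have "b = twist_pullback \<sigma> n \<otimes>\<^bsub>twists\<^esub> twist_pullback \<sigma> a"
    using hom_mult[OF twist_pullback_hom[OF \<sigma>] relations.mem_carrier a] by blast
  then show "b \<in> twist_class (twist_pullback \<sigma> a)"
    using twist_pullback_relation[OF \<sigma> n(1)] unfolding r_coset_def by blast
next
  fix b assume "b \<in> twist_class (twist_pullback \<sigma> a)"
  then obtain n where n: "n \<in> relations" "b = n \<otimes>\<^bsub>twists\<^esub> twist_pullback \<sigma> a"
    unfolding r_coset_def by blast
  let ?n = "twist_pullback (inv\<^bsub>aut\<^esub> \<sigma>) n"
  have n': "?n \<in> relations" by (rule twist_pullback_relation[OF aut.inv_closed[OF \<sigma>] n(1)])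
  have "twist_pullback \<sigma> ?n = n"
    using twist_pullback_mult[OF aut.inv_closed[OF \<sigma>] \<sigma> relations.mem_carrier[OF n(1)]]
      twist_pullback_one[OF relations.mem_carrier[OF n(1)]] \<sigma> by simp
  then have "b = twist_pullback \<sigma> (?n \<otimes>\<^bsub>twists\<^esub> a)"
    using n(2) hom_mult[OF twist_pullback_hom[OF \<sigma>] relations.mem_carrier[OF n'] a] by simp
  then show "b \<in> twist_pullback \<sigma> ` twist_class a" using n' unfolding r_coset_def by blast
qed

lemma symmetriesE:
  assumes "q \<in> carrier symmetries"
  obtains \<sigma> e where "q = (\<sigma>, e)" "\<sigma> \<in> carrier aut" "e = 0 \<or> e = 1"
proof -
  obtain \<sigma> e where q: "q = (\<sigma>, e)" by (cases q)
  with assms have "\<sigma> \<in> carrier aut" "0 \<le> e" "e < 2" by (auto simp: carrier_integer_mod_group)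
  moreover from this have "e = 0 \<or> e = 1" by arith
  ultimately show ?thesis using that q by blast
qed

text \<open>
  The action of symmetries lifted from cosets to pairs of a divisor and a line bundle, where it is an
  action by homomorphisms already.
\<close>

definition "twist_symmetry = (\<lambda>(\<sigma>, e :: int) a. let b = twist_pullback (inv\<^bsub>aut\<^esub> \<sigma>) a in
  if e = 0 then b else inv\<^bsub>twists\<^esub> b)"

lemma action_twist_class:
  assumes q: "q \<in> carrier symmetries" and a: "a \<in> carrier twists"
  shows "action q (twist_class a) = twist_class (twist_symmetry q a)"
proof -
  obtain \<sigma> e where q': "q = (\<sigma>, e)" "\<sigma> \<in> carrier aut" using q by auto
  note i = aut.inv_closed[OF q'(2)]
  have "(\<lambda>(H, L). (div_pullback X (inv\<^bsub>aut\<^esub> \<sigma>) H, Pic_pullback X (inv\<^bsub>aut\<^esub> \<sigma>) L)) ` twist_class a =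
      twist_class (twist_pullback (inv\<^bsub>aut\<^esub> \<sigma>) a)"
    using image_twist_class[OF i a] unfolding twist_pullback_def .
  then show ?thesis
    unfolding twisting_action_def twist_symmetry_def q'(1)
    using twist_class_inv[OF twist_pullback_closed[OF i a]] by (simp add: Let_def)
qed

lemma twist_symmetry_hom:
  assumes "q \<in> carrier symmetries"
  shows "twist_symmetry q \<in> hom twists twists"
proof -
  obtain \<sigma> e where q: "q = (\<sigma>, e)" "\<sigma> \<in> carrier aut" using assms by auto
  note i = aut.inv_closed[OF q(2)]
  show ?thesis
    by (rule homI) (auto simp: twist_symmetry_def q(1) Let_def twist_pullback_closed[OF i]
        hom_mult[OF twist_pullback_hom[OF i]] twists.inv_mult simp del: carrier_DirProd inv_DirProd)
qed

lemmas twist_symmetry_closed = hom_in_carrier[OF twist_symmetry_hom]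

lemma twist_symmetry_one: "a \<in> carrier twists \<Longrightarrow> twist_symmetry \<one>\<^bsub>symmetries\<^esub> a = a"
  by (simp add: twist_symmetry_def twist_pullback_one del: carrier_DirProd)

lemma twist_symmetry_mult:
  assumes "q \<in> carrier symmetries" "q' \<in> carrier symmetries" and a: "a \<in> carrier twists"
  shows "twist_symmetry (q \<otimes>\<^bsub>symmetries\<^esub> q') a = twist_symmetry q (twist_symmetry q' a)"
proof -
  from symmetriesE[OF assms(1)] obtain \<sigma> e where q: "q = (\<sigma>, e)" "\<sigma> \<in> carrier aut" "e = 0 \<or> e = 1" .
  from symmetriesE[OF assms(2)] obtain \<sigma>' e' where
    q': "q' = (\<sigma>', e')" "\<sigma>' \<in> carrier aut" "e' = 0 \<or> e' = 1" .
  note i = aut.inv_closed[OF q(2)] and i' = aut.inv_closed[OF q'(2)]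
  have "twist_pullback (inv\<^bsub>aut\<^esub> (\<sigma> \<otimes>\<^bsub>aut\<^esub> \<sigma>')) a =
      twist_pullback (inv\<^bsub>aut\<^esub> \<sigma>) (twist_pullback (inv\<^bsub>aut\<^esub> \<sigma>') a)"
    unfolding aut.inv_mult_group[OF q(2) q'(2)] by (rule twist_pullback_mult[OF i' i a])
  then show ?thesis
    using q(3) q'(3) twist_pullback_inv[OF i twist_pullback_closed[OF i' a]]
      twist_pullback_closed[OF i twist_pullback_closed[OF i' a]]
    by (elim disjE) (simp_all add: twist_symmetry_def q(1) q'(1) Let_def del: carrier_DirProd inv_DirProd)
qed

lemma action_closed:
  assumes "q \<in> carrier symmetries" "c \<in> carrier twist_quotient"
  shows "action q c \<in> carrier twist_quotient"
  using assms(2) action_twist_class[OF assms(1)] twist_symmetry_closed[OF assms(1)] twist_class_closed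
  by (elim twist_quotientE) simp

lemma action_hom:
  assumes q: "q \<in> carrier symmetries"
  shows "action q \<in> hom twist_quotient twist_quotient"
proof (rule homI)
  fix c c' assume "c \<in> carrier twist_quotient" "c' \<in> carrier twist_quotient"
  then obtain a a' where a: "a \<in> carrier twists" "c = twist_class a" "a' \<in> carrier twists" "c' = twist_class a'"
    by (elim twist_quotientE)
  show "action q (c \<otimes>\<^bsub>twist_quotient\<^esub> c') = action q c \<otimes>\<^bsub>twist_quotient\<^esub> action q c'"
    unfolding a(2,4) twist_class_mult[OF a(1,3), symmetric] action_twist_class[OF q a(1)]
      action_twist_class[OF q a(3)] action_twist_class[OF q twists.m_closed[OF a(1,3)]]
      hom_mult[OF twist_symmetry_hom[OF q] a(1,3)]
    by (rule twist_class_mult[OF twist_symmetry_closed[OF q a(1)] twist_symmetry_closed[OF q a(3)]])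
qed (rule action_closed[OF q])

lemma action_one: "c \<in> carrier twist_quotient \<Longrightarrow> action \<one>\<^bsub>symmetries\<^esub> c = c"
  by (elim twist_quotientE) (simp only: action_twist_class[OF symmetries.one_closed] twist_symmetry_one)

lemma action_mult:
  assumes "q \<in> carrier symmetries" "q' \<in> carrier symmetries" "c \<in> carrier twist_quotient"
  shows "action (q \<otimes>\<^bsub>symmetries\<^esub> q') c = action q (action q' c)"
  using assms(3)
  by (elim twist_quotientE) (simp only: action_twist_class assms(1,2) symmetries.m_closed twist_symmetry_mult
      twist_symmetry_closed)

sublocale semidirect: group semidirect
  by (rule group_semidirect_product[OF twist_quotient.is_group symmetries.is_group])
    (rule action_hom action_one action_mult; assumption)+

section \<open>Tuples as normal forms in the semidirect product\<close>

lemma hecke_divisorsD: "H \<in> hecke_divisors D r \<Longrightarrow> div_supp H \<subseteq> D"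
  by (simp add: hecke_divisors_def)

text \<open>
  A relation between the two pairs changes the coefficients by multiples of \<open>r\<close>, but they all lie
  between \<open>0\<close> and \<open>r - 1\<close>. So it is the relation of the zero divisor, which is trivial on line bundles
  as well.
\<close>

lemma twist_class_hecke_inj:
  assumes H: "H \<in> hecke_divisors D r" and H': "H' \<in> hecke_divisors D r"
    and L: "L \<in> carrier (Pic X)" and L': "L' \<in> carrier (Pic X)"
    and eq: "twist_class (H, L) = twist_class (H', L')"
  shows "H = H'" "L = L'"
proof -
  have "(H, L) \<in> carrier twists" "(H', L') \<in> carrier twists"
    using hecke_divisorsD[OF H] hecke_divisorsD[OF H'] L L' by simp_all
  from twist_class_eqE[OF this eq] obtain K where K: "div_supp K \<subseteq> D"
    "(H, L) = (frag_cmul (int r) K, divisor_bundle X K) \<otimes>\<^bsub>twists\<^esub> (H', L')" .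
  have HK: "H = frag_cmul (int r) K + H'" and LK: "L = divisor_bundle X K \<otimes>\<^bsub>Pic X\<^esub> L'" using K(2) by simp_all
  have "div_coeff K x = 0" for x
  proof (cases "x \<in> D")
    case False
    then show ?thesis using K(1) by (auto simp: in_keys_iff subset_iff)
  next
    case True
    have "div_coeff H x = int r * div_coeff K x + div_coeff H' x"
      unfolding HK by (simp add: lookup_add)
    moreover have "0 \<le> div_coeff H x" "div_coeff H x < int r"
      "0 \<le> div_coeff H' x" "div_coeff H' x < int r"
      using H H' True unfolding hecke_divisors_def by fastforce+
    ultimately have "\<bar>int r * div_coeff K x\<bar> < int r * 1" by linarith
    then have "int r * \<bar>div_coeff K x\<bar> < int r * 1" by (simp add: abs_mult)
    then have "\<bar>div_coeff K x\<bar> < 1" using rank_ge_2 by (subst (asm) mult_less_cancel_left_pos) auto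
    then show ?thesis by simp
  qed
  then have "K = 0" by (intro poly_mapping_eqI) simp
  moreover have "divisor_bundle X 0 = \<one>\<^bsub>Pic X\<^esub>"
    using hom_one[OF divisor_bundle_hom divisors.is_group Pic.is_group] by simp
  ultimately show "H = H'" "L = L'" using HK LK L' by simp_all
qed


text \<open>
  Division with remainder of the coefficients by \<open>r\<close>: the quotients form a divisor \<open>J\<close> whose relation
  \<open>(r J, \<O>\<^sub>X(J))\<close> is split off.
\<close>

lemma twist_class_hecke_surj:
  assumes a: "a \<in> carrier twists"
  obtains H L where "H \<in> hecke_divisors D r" "L \<in> carrier (Pic X)" "twist_class a = twist_class (H, L)"
proof -
  obtain K M where KM: "a = (K, M)" "div_supp K \<subseteq> D" "M \<in> carrier (Pic X)" using a by auto
  define J where "J = Poly_Mapping.map (\<lambda>k. k div int r) K"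
  have J: "div_coeff J x = div_coeff K x div int r" for x
    unfolding J_def by (simp add: Poly_Mapping.map.rep_eq when_def)
  have Jk: "div_supp J \<subseteq> D" using KM(2) by (metis in_keys_iff J div_0 subset_iff)
  define H where "H = K - frag_cmul (int r) J"
  have Hx: "div_coeff H x = div_coeff K x mod int r" for x
    unfolding H_def by (simp add: lookup_minus J minus_mult_div_eq_mod)
  have "div_supp H \<subseteq> D" using KM(2) by (metis in_keys_iff Hx mod_0 subset_iff)
  then have H: "H \<in> hecke_divisors D r"
    unfolding hecke_divisors_def using rank_ge_2 by (simp add: Hx)
  define L where "L = inv\<^bsub>Pic X\<^esub> (divisor_bundle X J) \<otimes>\<^bsub>Pic X\<^esub> M"
  have JP: "divisor_bundle X J \<in> carrier (Pic X)" by (rule divisor_bundle_in_Pic[OF marked_curve Jk])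
  then have L: "L \<in> carrier (Pic X)" unfolding L_def using KM(3) by simp
  have HL: "(H, L) \<in> carrier twists" using hecke_divisorsD[OF H] L by simp
  have "a = (frag_cmul (int r) J, divisor_bundle X J) \<otimes>\<^bsub>twists\<^esub> (H, L)"
    unfolding KM(1) H_def L_def using JP KM(3) by (simp flip: Pic.m_assoc)
  then have "twist_class a = twist_class (H, L)"
    using twist_class_mult[OF relations.mem_carrier[OF relationI[OF Jk]] HL] twist_class_relation[OF relationI[OF Jk]]
      twist_class_closed[OF HL] by simp
  then show ?thesis using that[OF H L] by blast
qed

text \<open>
  Inverting \<open>\<sigma>\<close> turns the contravariant rule \<open>\<Sigma>\<^sub>\<sigma> \<Sigma>\<^sub>\<tau> = \<Sigma>\<^bsub>\<tau> \<circ> \<sigma>\<^esub>\<close> into a homomorphism.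
\<close>

definition "symmetry_of \<sigma> s = (inv\<^bsub>aut\<^esub> \<sigma>, if s = 1 then 0 else 1 :: int)"

lemma symmetry_of_closed: "\<sigma> \<in> carrier aut \<Longrightarrow> symmetry_of \<sigma> s \<in> carrier symmetries"
  by (simp add: symmetry_of_def)

text \<open>
  The element of the semidirect product which is written \<open>\<Sigma>\<^sub>\<sigma> \<T>\<^sub>L \<H>\<^sub>H\<close> or \<open>\<Sigma>\<^sub>\<sigma> \<D>\<^sup>- \<T>\<^sub>L \<H>\<^sub>H\<close>. The symmetry stands on the
  left there, and moving it to the right, where it is a component of the pair, applies its action to
  the class of \<open>(H, L)\<close>.
\<close>

definition "normal_form = (\<lambda>(\<sigma>, s :: int, L, H). (action (symmetry_of \<sigma> s) (twist_class (H, L)), symmetry_of \<sigma> s))"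

lemma action_inj:
  assumes q: "q \<in> carrier symmetries" and c: "c \<in> carrier twist_quotient" "c' \<in> carrier twist_quotient"
    and eq: "action q c = action q c'"
  shows "c = c'"
proof -
  have *: "action (inv\<^bsub>symmetries\<^esub> q) (action q c) = c" if "c \<in> carrier twist_quotient" for c
    using action_mult[OF symmetries.inv_closed[OF q] q that] action_one[OF that]
    by (simp only: symmetries.l_inv[OF q])
  show ?thesis using *[OF c(2)] unfolding eq[symmetric] *[OF c(1)] .
qed

lemma hecke_twist_closed:
  "\<lbrakk>H \<in> hecke_divisors D r; L \<in> carrier (Pic X)\<rbrakk> \<Longrightarrow> (H, L) \<in> carrier twists"
  using hecke_divisorsD by simp

lemma bij_betw_normal_form:
  "bij_betw normal_form (basic_transformations X D r) (carrier semidirect)"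
  unfolding bij_betw_def
proof (intro conjI inj_onI equalityI subsetI)
  fix x y assume x: "x \<in> basic_transformations X D r" and y: "y \<in> basic_transformations X D r"
    and eq: "normal_form x = normal_form y"
  obtain \<sigma> s L H where x': "x = (\<sigma>, s, L, H)" "\<sigma> \<in> carrier aut" "s = 1 \<or> s = -1" "L \<in> carrier (Pic X)"
    "H \<in> hecke_divisors D r" using x unfolding basic_transformations_def by auto
  obtain \<tau> u M K where y': "y = (\<tau>, u, M, K)" "\<tau> \<in> carrier aut" "u = 1 \<or> u = -1" "M \<in> carrier (Pic X)"
    "K \<in> hecke_divisors D r" using y unfolding basic_transformations_def by auto
  have q: "symmetry_of \<sigma> s = symmetry_of \<tau> u"
    using eq by (simp add: x'(1) y'(1) normal_form_def)
  have c: "action (symmetry_of \<sigma> s) (twist_class (H, L)) = action (symmetry_of \<sigma> s) (twist_class (K, M))"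
    using eq unfolding q by (simp add: x'(1) y'(1) normal_form_def q)
  have "inv\<^bsub>aut\<^esub> \<sigma> = inv\<^bsub>aut\<^esub> \<tau>" using q by (simp add: symmetry_of_def)
  then have "\<sigma> = \<tau>" using aut.inv_inv[OF x'(2)] aut.inv_inv[OF y'(2)] by metis
  moreover have "s = u" using q x'(3) y'(3) by (auto simp: symmetry_of_def)
  moreover have "H = K" "L = M"
    using twist_class_hecke_inj[OF x'(5) y'(5) x'(4) y'(4)] action_inj[OF symmetry_of_closed[OF x'(2)] _ _ c]
      twist_class_closed hecke_twist_closed x'(4,5) y'(4,5) by blast+
  ultimately show "x = y" by (simp add: x'(1) y'(1))
next
  fix z assume "z \<in> normal_form ` basic_transformations X D r"
  then obtain x where x: "z = normal_form x" "x \<in> basic_transformations X D r" by blast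
  obtain \<sigma> s L H where x': "x = (\<sigma>, s, L, H)" "\<sigma> \<in> carrier aut" "L \<in> carrier (Pic X)"
    "H \<in> hecke_divisors D r" using x(2) unfolding basic_transformations_def by auto
  have "action (symmetry_of \<sigma> s) (twist_class (H, L)) \<in> carrier twist_quotient"
    by (intro action_closed symmetry_of_closed twist_class_closed hecke_twist_closed x')
  then show "z \<in> carrier semidirect"
    using symmetry_of_closed[OF x'(2)] by (simp add: x(1) x'(1) normal_form_def del: carrier_DirProd)
next
  fix z assume "z \<in> carrier semidirect"
  then obtain c q where z: "z = (c, q)" "c \<in> carrier twist_quotient" "q \<in> carrier symmetries"
    by (auto simp del: carrier_DirProd)
  from symmetriesE[OF z(3)] obtain \<sigma> e where q: "q = (\<sigma>, e)" "\<sigma> \<in> carrier aut" "e = 0 \<or> e = 1" .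
  have "action (inv\<^bsub>symmetries\<^esub> q) c \<in> carrier twist_quotient"
    by (rule action_closed[OF symmetries.inv_closed[OF z(3)] z(2)])
  then obtain a where a: "a \<in> carrier twists" "action (inv\<^bsub>symmetries\<^esub> q) c = twist_class a" by (rule twist_quotientE)
  obtain H L where HL: "H \<in> hecke_divisors D r" "L \<in> carrier (Pic X)" "twist_class a = twist_class (H, L)"
    using twist_class_hecke_surj[OF a(1)] .
  have "action q (twist_class (H, L)) = c"
    using action_mult[OF z(3) symmetries.inv_closed[OF z(3)] z(2)] action_one[OF z(2)]
    by (simp only: symmetries.r_inv[OF z(3)] a(2) HL(3))
  moreover define s :: int where "s = (if e = 0 then 1 else -1)"
  have "symmetry_of (inv\<^bsub>aut\<^esub> \<sigma>) s = q" using q by (auto simp: symmetry_of_def s_def)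
  ultimately have "z = normal_form (inv\<^bsub>aut\<^esub> \<sigma>, s, L, H)" by (simp add: z(1) normal_form_def)
  moreover have "(inv\<^bsub>aut\<^esub> \<sigma>, s, L, H) \<in> basic_transformations X D r"
    unfolding basic_transformations_def using HL q(2) by (simp add: s_def)
  ultimately show "z \<in> normal_form ` basic_transformations X D r" by blast
qed

lemma zero_hecke: "0 \<in> hecke_divisors D r"
  using rank_ge_2 by (simp add: hecke_divisors_def)

lemma frag_of_hecke: "x \<in> D \<Longrightarrow> frag_of x \<in> hecke_divisors D r"
  using rank_ge_2 by (auto simp: hecke_divisors_def lookup_frag_of)

end

section \<open>Existence of the group of basic transformations\<close>

context marked_curve_rank
begin

lemma bt_pullback_mem: "\<sigma> \<in> carrier aut \<Longrightarrow> bt_pullback X \<sigma> \<in> basic_transformations X D r"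
  and bt_dual_mem: "bt_dual X \<in> basic_transformations X D r"
  and bt_twist_mem: "L \<in> carrier (Pic X) \<Longrightarrow> bt_twist X L \<in> basic_transformations X D r"
  and bt_hecke_mem: "H \<in> hecke_divisors D r \<Longrightarrow> bt_hecke X H \<in> basic_transformations X D r"
  using zero_hecke aut.one_closed unfolding one_aut_group
  by (simp_all add: basic_transformations_def bt_pullback_def bt_dual_def bt_twist_def bt_hecke_def)

lemma div_pullback_hecke:
  assumes \<sigma>: "\<sigma> \<in> carrier aut" and H: "H \<in> hecke_divisors D r"
  shows "div_pullback X \<sigma> H \<in> hecke_divisors D r"
proof -
  have "div_coeff (div_pullback X \<sigma> H) x = div_coeff H (\<sigma> x)" "\<sigma> x \<in> D"
    if "x \<in> D" for x
    using lookup_div_pullback[OF \<sigma>, of H x] hecke_divisorsD[OF H] D_subset that autD(4)[OF \<sigma>] by blast+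
  then show ?thesis
    using H keys_div_pullback[OF \<sigma> D_subset hecke_divisorsD[OF H]] unfolding hecke_divisors_def by simp
qed

abbreviation "of_twist a \<equiv> (twist_class a, \<one>\<^bsub>symmetries\<^esub>)"
abbreviation "of_symmetry q \<equiv> (\<one>\<^bsub>twist_quotient\<^esub>, q)"

lemma action_of_one: "q \<in> carrier symmetries \<Longrightarrow> action q \<one>\<^bsub>twist_quotient\<^esub> = \<one>\<^bsub>twist_quotient\<^esub>"
  by (rule hom_one[OF action_hom twist_quotient.is_group twist_quotient.is_group])

lemma of_twist_closed: "a \<in> carrier twists \<Longrightarrow> of_twist a \<in> carrier semidirect"
  using twist_class_closed symmetries.one_closed by (simp del: carrier_DirProd one_DirProd)

lemma of_symmetry_closed: "q \<in> carrier symmetries \<Longrightarrow> of_symmetry q \<in> carrier semidirect"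
  by (simp del: carrier_DirProd)

lemma of_twist_mult:
  assumes "a \<in> carrier twists" "b \<in> carrier twists"
  shows "of_twist a \<otimes>\<^bsub>semidirect\<^esub> of_twist b = of_twist (a \<otimes>\<^bsub>twists\<^esub> b)"
  unfolding semidirect_product_simps(3) action_one[OF twist_class_closed[OF assms(2)]]
    twist_class_mult[OF assms] symmetries.l_one[OF symmetries.one_closed] ..

lemma of_symmetry_mult:
  assumes "q \<in> carrier symmetries" "q' \<in> carrier symmetries"
  shows "of_symmetry q \<otimes>\<^bsub>semidirect\<^esub> of_symmetry q' = of_symmetry (q \<otimes>\<^bsub>symmetries\<^esub> q')"
  unfolding semidirect_product_simps(3) action_of_one[OF assms(1)]
    twist_quotient.l_one[OF twist_quotient.one_closed] ..

lemma of_symmetry_of_twist: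
  assumes "q \<in> carrier symmetries" "a \<in> carrier twists"
  shows "of_symmetry q \<otimes>\<^bsub>semidirect\<^esub> of_twist a = (action q (twist_class a), q)"
  unfolding semidirect_product_simps(3) symmetries.r_one[OF assms(1)]
    twist_quotient.l_one[OF action_closed[OF assms(1) twist_class_closed[OF assms(2)]]] ..

lemma of_symmetry_conjugates:
  assumes q: "q \<in> carrier symmetries" and a: "a \<in> carrier twists"
  shows "of_symmetry q \<otimes>\<^bsub>semidirect\<^esub> of_twist a = of_twist (twist_symmetry q a) \<otimes>\<^bsub>semidirect\<^esub> of_symmetry q"
proof -
  have "of_twist (twist_symmetry q a) \<otimes>\<^bsub>semidirect\<^esub> of_symmetry q = (twist_class (twist_symmetry q a), q)"
    unfolding semidirect_product_simps(3) action_one[OF twist_quotient.one_closed] symmetries.l_one[OF q]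
      twist_quotient.r_one[OF twist_class_closed[OF twist_symmetry_closed[OF assms]]] ..
  then show ?thesis unfolding of_symmetry_of_twist[OF assms] action_twist_class[OF assms] by (rule sym)
qed

lemma twist_class_one: "twist_class (0, \<one>\<^bsub>Pic X\<^esub>) = \<one>\<^bsub>twist_quotient\<^esub>"
  using hom_one[OF twist_class_hom twists.is_group twist_quotient.is_group] by simp

lemma pullback_symmetry_closed: "\<sigma> \<in> carrier aut \<Longrightarrow> (inv\<^bsub>aut\<^esub> \<sigma>, 0) \<in> carrier symmetries"
  and dual_symmetry_closed: "(\<one>\<^bsub>aut\<^esub>, 1) \<in> carrier symmetries"
  by simp_all

lemma normal_form_pullback:
  assumes "\<sigma> \<in> carrier aut"
  shows "normal_form (bt_pullback X \<sigma>) = of_symmetry (inv\<^bsub>aut\<^esub> \<sigma>, 0)"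
  using action_of_one[OF pullback_symmetry_closed[OF assms]] twist_class_one
  by (simp add: normal_form_def bt_pullback_def symmetry_of_def)

lemma normal_form_dual: "normal_form (bt_dual X) = of_symmetry (\<one>\<^bsub>aut\<^esub>, 1)"
  using action_of_one[OF dual_symmetry_closed] twist_class_one aut.inv_one
  by (simp add: normal_form_def bt_dual_def symmetry_of_def one_aut_group)

lemma normal_form_trivial_symmetry:
  assumes "a \<in> carrier twists"
  shows "normal_form (\<lambda>x\<in>X. x, 1, snd a, fst a) = of_twist a"
  using action_one[OF twist_class_closed[OF assms]] aut.inv_one
  by (simp add: normal_form_def symmetry_of_def one_aut_group)

lemma normal_form_twist: "L \<in> carrier (Pic X) \<Longrightarrow> normal_form (bt_twist X L) = of_twist (0, L)"
  using normal_form_trivial_symmetry[of "(0, L)"] by (simp add: bt_twist_def)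

lemma normal_form_hecke:
  "H \<in> hecke_divisors D r \<Longrightarrow> normal_form (bt_hecke X H) = of_twist (H, \<one>\<^bsub>Pic X\<^esub>)"
  using normal_form_trivial_symmetry[of "(H, \<one>\<^bsub>Pic X\<^esub>)"] hecke_divisorsD by (simp add: bt_hecke_def)

lemma of_twist_pow:
  assumes "x \<in> D"
  shows "of_twist (frag_of x, \<one>\<^bsub>Pic X\<^esub>) [^]\<^bsub>semidirect\<^esub> (k :: nat) =
    of_twist (frag_cmul (int k) (frag_of x), \<one>\<^bsub>Pic X\<^esub>)"
proof (induction k)
  case 0
  show ?case using twist_class_one by (simp del: one_DirProd)
next
  case (Suc k)
  have m: "(frag_cmul (int k) (frag_of x), \<one>\<^bsub>Pic X\<^esub>) \<in> carrier twists" "(frag_of x, \<one>\<^bsub>Pic X\<^esub>) \<in> carrier twists"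
    using assms keys_cmul[of "int k" "frag_of x"] by auto
  have "frag_cmul (int (Suc k)) (frag_of x) = frag_cmul (int k) (frag_of x) + frag_of x"
    by (simp add: frag_cmul_distrib add.commute)
  then show ?case
    unfolding nat_pow_Suc Suc.IH of_twist_mult[OF m] by simp
qed

text \<open>
  The relation \<open>(r x, \<O>\<^sub>X(x))\<close> is the rule \<open>\<H>\<^sub>x\<^sup>r = \<T>\<^bsub>\<O>(-x)\<^esub>\<close>.
\<close>

lemma twist_class_hecke_power:
  assumes x: "x \<in> D"
  shows "twist_class (frag_cmul (int r) (frag_of x), \<one>\<^bsub>Pic X\<^esub>) = twist_class (0, divisor_bundle X (- frag_of x))"
proof -
  let ?n = "(frag_cmul (int r) (frag_of x), divisor_bundle X (frag_of x))"
  let ?a = "(0, divisor_bundle X (- frag_of x))"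
  have k: "div_supp (frag_of x) \<subseteq> D" "div_supp (- frag_of x) \<subseteq> D" using x by auto
  have n: "?n \<in> relations" by (rule relationI[OF k(1)])
  have a: "?a \<in> carrier twists" using divisor_bundle_in_Pic[OF marked_curve k(2)] by simp
  have "divisor_bundle X (frag_of x) \<otimes>\<^bsub>Pic X\<^esub> divisor_bundle X (- frag_of x) = \<one>\<^bsub>Pic X\<^esub>"
    using divisor_bundle_add[OF marked_curve k] hom_one[OF divisor_bundle_hom divisors.is_group Pic.is_group]
    by simp
  then have "(frag_cmul (int r) (frag_of x), \<one>\<^bsub>Pic X\<^esub>) = ?n \<otimes>\<^bsub>twists\<^esub> ?a" by simp
  then show ?thesis
    using twist_class_mult[OF relations.mem_carrier[OF n] a] twist_class_relation[OF n]
      twist_quotient.l_one[OF twist_class_closed[OF a]] by simp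
qed

lemma twist_symmetry_pullback:
  assumes "\<sigma> \<in> carrier aut"
  shows "twist_symmetry (inv\<^bsub>aut\<^esub> \<sigma>, 0) a = twist_pullback \<sigma> a"
  using assms by (simp add: twist_symmetry_def)

lemma twist_symmetry_dual:
  "a \<in> carrier twists \<Longrightarrow> twist_symmetry (\<one>\<^bsub>aut\<^esub>, 1) a = inv\<^bsub>twists\<^esub> a"
  using twist_pullback_one by (simp add: twist_symmetry_def del: carrier_DirProd)

text \<open>
  The group structure on tuples is the one which makes \<open>normal_form\<close> an isomorphism. Injectivity of
  \<open>normal_form\<close> reduces each rule to a computation in the semidirect product.
\<close>

lemma basic_transformation_group_exists: "\<exists>T. basic_transformation_group X D r T"
proof -
  let ?B = "basic_transformations X D r"
  define T where "T = transported_group ?B normal_form semidirect"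
  have c: "carrier T = ?B" unfolding T_def transported_group_def by simp
  interpret T: group T
    unfolding T_def by (rule transported_group(1)[OF semidirect.is_group bij_betw_normal_form])
  interpret nf: group_hom T semidirect normal_form
    using transported_group(2)[OF semidirect.is_group bij_betw_normal_form] T.is_group semidirect.is_group
    by (simp add: group_hom_def group_hom_axioms_def T_def)
  have eqI: "a = b" if "normal_form a = normal_form b" "a \<in> carrier T" "b \<in> carrier T" for a b
    using bij_betw_normal_form that unfolding c bij_betw_def inj_on_def by blast
  note mem = bt_pullback_mem[folded c] bt_dual_mem[folded c] bt_twist_mem[folded c] bt_hecke_mem[folded c]
  note mult = nf.hom_mult and closed = T.m_closed
  have tw: "(0, L) \<in> carrier twists" if "L \<in> carrier (Pic X)" for L using that by simp
  have hk: "(H, \<one>\<^bsub>Pic X\<^esub>) \<in> carrier twists" if "H \<in> hecke_divisors D r" for H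
    using hecke_divisorsD[OF that] by simp
  note closedS = of_twist_closed[OF tw] of_twist_closed[OF hk] of_symmetry_closed[OF pullback_symmetry_closed]
    of_symmetry_closed[OF dual_symmetry_closed]
  have tw_hk: "of_twist (0, L) \<otimes>\<^bsub>semidirect\<^esub> of_twist (H, \<one>\<^bsub>Pic X\<^esub>) = of_twist (H, L)"
    if "L \<in> carrier (Pic X)" "H \<in> hecke_divisors D r" for L H
    unfolding of_twist_mult[OF tw[OF that(1)] hk[OF that(2)]] using that by simp
  have plus: "normal_form (bt_pullback X \<sigma> \<otimes>\<^bsub>T\<^esub> bt_twist X L \<otimes>\<^bsub>T\<^esub> bt_hecke X H) = normal_form (\<sigma>, 1, L, H)"
    and minus: "normal_form (bt_pullback X \<sigma> \<otimes>\<^bsub>T\<^esub> bt_dual X \<otimes>\<^bsub>T\<^esub> bt_twist X L \<otimes>\<^bsub>T\<^esub> bt_hecke X H) =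
        normal_form (\<sigma>, -1, L, H)"
    if *: "\<sigma> \<in> carrier aut" "L \<in> carrier (Pic X)" "H \<in> hecke_divisors D r" for \<sigma> L H
  proof -
    have q: "of_symmetry (inv\<^bsub>aut\<^esub> \<sigma>, 0) \<otimes>\<^bsub>semidirect\<^esub> of_symmetry (\<one>\<^bsub>aut\<^esub>, 1) = of_symmetry (inv\<^bsub>aut\<^esub> \<sigma>, 1)"
      unfolding of_symmetry_mult[OF pullback_symmetry_closed[OF *(1)] dual_symmetry_closed] using *(1) by simp
    have q1: "(inv\<^bsub>aut\<^esub> \<sigma>, 1) \<in> carrier symmetries" using *(1) by simp
    show "normal_form (bt_pullback X \<sigma> \<otimes>\<^bsub>T\<^esub> bt_twist X L \<otimes>\<^bsub>T\<^esub> bt_hecke X H) = normal_form (\<sigma>, 1, L, H)"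
      by (simp only: mult closed mem * normal_form_pullback normal_form_twist normal_form_hecke
          semidirect.m_assoc closedS tw_hk of_symmetry_of_twist pullback_symmetry_closed hecke_twist_closed)
        (simp add: normal_form_def symmetry_of_def)
    show "normal_form (bt_pullback X \<sigma> \<otimes>\<^bsub>T\<^esub> bt_dual X \<otimes>\<^bsub>T\<^esub> bt_twist X L \<otimes>\<^bsub>T\<^esub> bt_hecke X H) =
        normal_form (\<sigma>, -1, L, H)"
      by (simp only: mult closed mem * normal_form_pullback normal_form_dual normal_form_twist normal_form_hecke q,
          simp only: semidirect.m_assoc closedS of_symmetry_closed[OF q1] * tw_hk of_symmetry_of_twist q1 hecke_twist_closed)
        (simp add: normal_form_def symmetry_of_def)
  qed
  have "basic_transformation_group X D r T"
  proof (intro basic_transformation_group.intro basic_transformation_group_axioms.intro)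
    show "group T" by (rule T.is_group)
    show "carrier T = ?B" by (rule c)
  next
    fix \<sigma> L H assume *: "\<sigma> \<in> carrier aut" "L \<in> carrier (Pic X)" "H \<in> hecke_divisors D r"
    show "(\<sigma>, 1, L, H) = bt_pullback X \<sigma> \<otimes>\<^bsub>T\<^esub> bt_twist X L \<otimes>\<^bsub>T\<^esub> bt_hecke X H"
    proof (rule eqI[OF plus[OF *, symmetric]])
      show "(\<sigma>, 1, L, H) \<in> carrier T" using * by (simp add: c basic_transformations_def)
    qed (intro closed mem *)+
    show "(\<sigma>, -1, L, H) = bt_pullback X \<sigma> \<otimes>\<^bsub>T\<^esub> bt_dual X \<otimes>\<^bsub>T\<^esub> bt_twist X L \<otimes>\<^bsub>T\<^esub> bt_hecke X H"
    proof (rule eqI[OF minus[OF *, symmetric]])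
      show "(\<sigma>, -1, L, H) \<in> carrier T" using * by (simp add: c basic_transformations_def)
    qed (intro closed mem *)+
  next
    fix H H' assume *: "H \<in> hecke_divisors D r" "H' \<in> hecke_divisors D r" "H + H' \<in> hecke_divisors D r"
    show "bt_hecke X (H + H') = bt_hecke X H \<otimes>\<^bsub>T\<^esub> bt_hecke X H'"
    proof (rule eqI)
      show "normal_form (bt_hecke X (H + H')) = normal_form (bt_hecke X H \<otimes>\<^bsub>T\<^esub> bt_hecke X H')"
        by (simp only: mult mem normal_form_hecke * of_twist_mult hk) simp
    qed (intro closed mem *)+
  next
    fix \<sigma> \<tau> assume *: "\<sigma> \<in> carrier aut" "\<tau> \<in> carrier aut"
    have **: "\<tau> \<otimes>\<^bsub>aut\<^esub> \<sigma> \<in> carrier aut" using * by blast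
    show "bt_pullback X \<sigma> \<otimes>\<^bsub>T\<^esub> bt_pullback X \<tau> = bt_pullback X (\<tau> \<otimes>\<^bsub>aut\<^esub> \<sigma>)"
    proof (rule eqI)
      show "normal_form (bt_pullback X \<sigma> \<otimes>\<^bsub>T\<^esub> bt_pullback X \<tau>) = normal_form (bt_pullback X (\<tau> \<otimes>\<^bsub>aut\<^esub> \<sigma>))"
        by (simp only: mult mem normal_form_pullback * ** of_symmetry_mult pullback_symmetry_closed)
          (simp add: aut.inv_mult_group *)
    qed (intro closed mem * **)+
  next
    show "bt_dual X \<otimes>\<^bsub>T\<^esub> bt_dual X = \<one>\<^bsub>T\<^esub>"
    proof (rule eqI)
      show "normal_form (bt_dual X \<otimes>\<^bsub>T\<^esub> bt_dual X) = normal_form \<one>\<^bsub>T\<^esub>"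
        unfolding nf.hom_one
        by (simp only: mult mem normal_form_dual of_symmetry_mult dual_symmetry_closed) simp
    qed (intro closed mem T.one_closed)+
  next
    fix \<sigma> assume *: "\<sigma> \<in> carrier aut"
    show "bt_dual X \<otimes>\<^bsub>T\<^esub> bt_pullback X \<sigma> = bt_pullback X \<sigma> \<otimes>\<^bsub>T\<^esub> bt_dual X"
    proof (rule eqI)
      show "normal_form (bt_dual X \<otimes>\<^bsub>T\<^esub> bt_pullback X \<sigma>) = normal_form (bt_pullback X \<sigma> \<otimes>\<^bsub>T\<^esub> bt_dual X)"
        by (simp only: mult mem normal_form_dual normal_form_pullback * of_symmetry_mult
            dual_symmetry_closed pullback_symmetry_closed) (simp add: *)
    qed (intro closed mem *)+
  next
    fix L M assume *: "L \<in> carrier (Pic X)" "M \<in> carrier (Pic X)"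
    show "bt_twist X L \<otimes>\<^bsub>T\<^esub> bt_twist X M = bt_twist X (L \<otimes>\<^bsub>Pic X\<^esub> M)"
    proof (rule eqI)
      show "normal_form (bt_twist X L \<otimes>\<^bsub>T\<^esub> bt_twist X M) = normal_form (bt_twist X (L \<otimes>\<^bsub>Pic X\<^esub> M))"
        by (simp only: mult mem normal_form_twist * of_twist_mult tw Pic.m_closed) simp
    qed (intro closed mem * Pic.m_closed)+
  next
    fix x y assume *: "x \<in> D" "y \<in> D"
    note ** = frag_of_hecke[OF *(1)] frag_of_hecke[OF *(2)]
    show "bt_hecke X (frag_of x) \<otimes>\<^bsub>T\<^esub> bt_hecke X (frag_of y) = bt_hecke X (frag_of y) \<otimes>\<^bsub>T\<^esub> bt_hecke X (frag_of x)"
    proof (rule eqI)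
      show "normal_form (bt_hecke X (frag_of x) \<otimes>\<^bsub>T\<^esub> bt_hecke X (frag_of y)) =
          normal_form (bt_hecke X (frag_of y) \<otimes>\<^bsub>T\<^esub> bt_hecke X (frag_of x))"
        by (simp only: mult mem normal_form_hecke ** of_twist_mult hk) (simp add: add.commute)
    qed (intro closed mem **)+
  next
    fix x L assume *: "x \<in> D" "L \<in> carrier (Pic X)"
    note ** = frag_of_hecke[OF *(1)] *(2)
    show "bt_hecke X (frag_of x) \<otimes>\<^bsub>T\<^esub> bt_twist X L = bt_twist X L \<otimes>\<^bsub>T\<^esub> bt_hecke X (frag_of x)"
    proof (rule eqI)
      show "normal_form (bt_hecke X (frag_of x) \<otimes>\<^bsub>T\<^esub> bt_twist X L) =
          normal_form (bt_twist X L \<otimes>\<^bsub>T\<^esub> bt_hecke X (frag_of x))"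
        by (simp only: mult mem normal_form_hecke normal_form_twist ** of_twist_mult hk tw) (simp add: *)
    qed (intro closed mem **)+
  next
    fix x assume *: "x \<in> D"
    note ** = frag_of_hecke[OF *]
    have d: "divisor_bundle X (- frag_of x) \<in> carrier (Pic X)"
      by (rule divisor_bundle_in_Pic[OF marked_curve]) (use * in simp)
    show "bt_hecke X (frag_of x) [^]\<^bsub>T\<^esub> r = bt_twist X (divisor_bundle X (- frag_of x))"
    proof (rule eqI)
      show "normal_form (bt_hecke X (frag_of x) [^]\<^bsub>T\<^esub> r) = normal_form (bt_twist X (divisor_bundle X (- frag_of x)))"
        unfolding nf.hom_nat_pow[OF mem(4)[OF **]] normal_form_hecke[OF **] normal_form_twist[OF d]
          of_twist_pow[OF *] twist_class_hecke_power[OF *] ..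
    qed (intro T.nat_pow_closed mem ** d)+
  next
    fix \<sigma> L assume *: "\<sigma> \<in> carrier aut" "L \<in> carrier (Pic X)"
    have p: "Pic_pullback X \<sigma> L \<in> carrier (Pic X)"
      by (rule hom_in_carrier[OF Pic_pullback_hom[OF X_subset autD(2)[OF *(1)]] *(2)])
    have "twist_symmetry (inv\<^bsub>aut\<^esub> \<sigma>, 0) (0, L) = (0, Pic_pullback X \<sigma> L)"
      unfolding twist_symmetry_pullback[OF *(1)] by (simp add: twist_pullback_def div_pullback_def)
    then show "bt_pullback X \<sigma> \<otimes>\<^bsub>T\<^esub> bt_twist X L = bt_twist X (Pic_pullback X \<sigma> L) \<otimes>\<^bsub>T\<^esub> bt_pullback X \<sigma>"
      by (intro eqI closed mem * p)
        (simp only: mult mem normal_form_pullback normal_form_twist * p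
          of_symmetry_conjugates[OF pullback_symmetry_closed[OF *(1)] tw[OF *(2)]])
  next
    fix \<sigma> H assume *: "\<sigma> \<in> carrier aut" "H \<in> hecke_divisors D r"
    note p = div_pullback_hecke[OF *]
    have "Pic_pullback X \<sigma> \<one>\<^bsub>Pic X\<^esub> = \<one>\<^bsub>Pic X\<^esub>"
      by (rule hom_one[OF Pic_pullback_hom[OF X_subset autD(2)[OF *(1)]] Pic.is_group Pic.is_group])
    then have "twist_symmetry (inv\<^bsub>aut\<^esub> \<sigma>, 0) (H, \<one>\<^bsub>Pic X\<^esub>) = (div_pullback X \<sigma> H, \<one>\<^bsub>Pic X\<^esub>)"
      unfolding twist_symmetry_pullback[OF *(1)] by (simp add: twist_pullback_def)
    then show "bt_pullback X \<sigma> \<otimes>\<^bsub>T\<^esub> bt_hecke X H = bt_hecke X (div_pullback X \<sigma> H) \<otimes>\<^bsub>T\<^esub> bt_pullback X \<sigma>"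
      by (intro eqI closed mem * p)
        (simp only: mult mem normal_form_pullback normal_form_hecke * p
          of_symmetry_conjugates[OF pullback_symmetry_closed[OF *(1)] hk[OF *(2)]])
  next
    fix L assume *: "L \<in> carrier (Pic X)"
    have "twist_symmetry (\<one>\<^bsub>aut\<^esub>, 1) (0, L) = (0, inv\<^bsub>Pic X\<^esub> L)"
      unfolding twist_symmetry_dual[OF tw[OF *]]
      using * by (subst inv_DirProd[OF divisors.is_group Pic.is_group]) auto
    then show "bt_dual X \<otimes>\<^bsub>T\<^esub> bt_twist X L = bt_twist X (inv\<^bsub>Pic X\<^esub> L) \<otimes>\<^bsub>T\<^esub> bt_dual X"
      by (intro eqI closed mem * Pic.inv_closed)
        (simp only: mult mem normal_form_dual normal_form_twist * Pic.inv_closed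
          of_symmetry_conjugates[OF dual_symmetry_closed tw[OF *]])
  next
    fix x assume *: "x \<in> D"
    note ** = frag_of_hecke[OF *]
    let ?a = "(frag_of x, \<one>\<^bsub>Pic X\<^esub>)"
    have a: "?a \<in> carrier twists" by (rule hk[OF **])
    note ia = twists.inv_closed[OF a]
    have "of_twist (inv\<^bsub>twists\<^esub> ?a) \<otimes>\<^bsub>semidirect\<^esub> of_twist ?a = \<one>\<^bsub>semidirect\<^esub>"
      unfolding of_twist_mult[OF ia a] twists.l_inv[OF a] semidirect_product_simps(2)
        hom_one[OF twist_class_hom twists.is_group twist_quotient.is_group] ..
    then have "of_twist (inv\<^bsub>twists\<^esub> ?a) = inv\<^bsub>semidirect\<^esub> (of_twist ?a)"
      by (rule semidirect.inv_equality[symmetric]) (intro of_twist_closed a ia)+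
    then have "of_twist (twist_symmetry (\<one>\<^bsub>aut\<^esub>, 1) ?a) = normal_form (inv\<^bsub>T\<^esub> (bt_hecke X (frag_of x)))"
      unfolding nf.hom_inv[OF mem(4)[OF **]] normal_form_hecke[OF **] twist_symmetry_dual[OF a] .
    then show "bt_dual X \<otimes>\<^bsub>T\<^esub> bt_hecke X (frag_of x) = inv\<^bsub>T\<^esub> (bt_hecke X (frag_of x)) \<otimes>\<^bsub>T\<^esub> bt_dual X"
      by (intro eqI closed mem ** T.inv_closed)
        (simp only: mult mem normal_form_dual normal_form_hecke ** T.inv_closed
          of_symmetry_conjugates[OF dual_symmetry_closed a])
  qed
  then show ?thesis ..
qed

end

section \<open>Uniqueness of the group of basic transformations\<close>

locale basic_transformation_group_on_curve =
  marked_curve_rank X D r + basic_transformation_group X D r T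
  for X D :: "'n::finite point set" and r :: nat and T :: "'n basic_transformation monoid" (structure)
begin

lemmas pullback_closed = bt_pullback_mem[folded carrier_eq]
  and dual_closed = bt_dual_mem[folded carrier_eq]
  and twist_closed = bt_twist_mem[folded carrier_eq]
  and hecke_closed = bt_hecke_mem[folded carrier_eq]

lemma twist_hom: "bt_twist X \<in> hom (Pic X) T"
  by (rule homI) (simp_all add: twist_closed twist_twist)

lemma hecke_zero: "bt_hecke X 0 = \<one>"
  using hecke_add[of 0 0] zero_hecke hecke_closed[OF zero_hecke] by (simp add: r_cancel_one')

text \<open>
  The Hecke transformations at single points and the twists commute by the rules, hence generate a
  commutative subgroup, to which the free abelian group maps. This extends
  \<open>bt_hecke X\<close>, which lies in the group only on \<open>hecke_divisors\<close>, to all divisors on \<open>D\<close>.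
\<close>

lemma hecke_hom_exists:
  obtains h where "h \<in> hom divisors T" "\<And>x. x \<in> D \<Longrightarrow> h (frag_of x) = bt_hecke X (frag_of x)"
    "(\<lambda>(H, L). bt_twist X L \<otimes> h H) \<in> hom twists T"
proof -
  define S where "S = bt_twist X ` carrier (Pic X) \<union> (\<lambda>x. bt_hecke X (frag_of x)) ` D"
  have "S \<subseteq> carrier T" unfolding S_def using twist_closed hecke_closed frag_of_hecke by blast
  moreover have "a \<otimes> b = b \<otimes> a" if "a \<in> S" "b \<in> S" for a b
    using that Pic.m_comm unfolding S_def by (auto simp: twist_twist hecke_hecke hecke_twist)
  ultimately obtain C where C: "S \<subseteq> C" "subgroup C T" "comm_group (T\<lparr>carrier := C\<rparr>)"
    by (rule commuting_set_subset_comm_subgroup)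
  interpret C: comm_group "T\<lparr>carrier := C\<rparr>" by (rule C(3))
  have CT: "C \<subseteq> carrier T" by (rule subgroup.subset[OF C(2)])
  have "(\<lambda>x. bt_hecke X (frag_of x)) \<in> D \<rightarrow> carrier (T\<lparr>carrier := C\<rparr>)" using C(1) unfolding S_def by auto
  moreover have "(\<lambda>x. bt_hecke X (frag_of x)) ` D \<subseteq> carrier (T\<lparr>carrier := C\<rparr>)" using C(1) unfolding S_def by auto
  ultimately obtain h where h: "h \<in> hom divisors (T\<lparr>carrier := C\<rparr>)"
    "\<And>x. x \<in> D \<Longrightarrow> h (frag_of x) = bt_hecke X (frag_of x)"
    using C.free_Abelian_group_universal[of "\<lambda>x. bt_hecke X (frag_of x)" D] by metis
  have hC: "h H \<in> C" if "div_supp H \<subseteq> D" for H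
    using hom_in_carrier[OF h(1), of H] that by simp
  have tC: "bt_twist X L \<in> C" if "L \<in> carrier (Pic X)" for L using C(1) that unfolding S_def by blast
  have hm: "h (H + H') = h H \<otimes> h H'" if "div_supp H \<subseteq> D" "div_supp H' \<subseteq> D" for H H'
    using hom_mult[OF h(1), of H H'] that by simp
  have comm: "a \<otimes> b = b \<otimes> a" if "a \<in> C" "b \<in> C" for a b using C.m_comm[of a b] that by simp
  have "h \<in> hom divisors T"
    by (rule homI) (use hC CT hm in auto)
  moreover have "(\<lambda>(H, L). bt_twist X L \<otimes> h H) \<in> hom twists T"
  proof (rule homI)
    fix a assume "a \<in> carrier twists"
    then show "(case a of (H, L) \<Rightarrow> bt_twist X L \<otimes> h H) \<in> carrier T"
      using hC tC CT by (auto intro!: m_closed)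
  next
    fix a b assume "a \<in> carrier twists" "b \<in> carrier twists"
    then obtain H L K M where *: "a = (H, L)" "b = (K, M)" "div_supp H \<subseteq> D" "div_supp K \<subseteq> D"
      "L \<in> carrier (Pic X)" "M \<in> carrier (Pic X)" by auto
    note m = hC[OF *(3)] hC[OF *(4)] tC[OF *(5)] tC[OF *(6)]
    have mT: "h H \<in> carrier T" "h K \<in> carrier T" "bt_twist X L \<in> carrier T" "bt_twist X M \<in> carrier T"
      using m CT by blast+
    have "bt_twist X (L \<otimes>\<^bsub>Pic X\<^esub> M) \<otimes> h (H + K) = bt_twist X L \<otimes> (bt_twist X M \<otimes> h H) \<otimes> h K"
      using mT * by (simp add: hm m_assoc flip: twist_twist)
    also have "\<dots> = bt_twist X L \<otimes> h H \<otimes> (bt_twist X M \<otimes> h K)"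
      unfolding comm[OF m(4,1)] using mT by (simp add: m_assoc)
    finally show "(case a \<otimes>\<^bsub>twists\<^esub> b of (H, L) \<Rightarrow> bt_twist X L \<otimes> h H) =
        (case a of (H, L) \<Rightarrow> bt_twist X L \<otimes> h H) \<otimes> (case b of (H, L) \<Rightarrow> bt_twist X L \<otimes> h H)"
      by (simp add: *(1,2))
  qed
  ultimately show ?thesis using that h(2) by blast
qed

context
  fixes h
  assumes h_hom: "h \<in> hom divisors T"
    and h_frag_of: "\<And>x. x \<in> D \<Longrightarrow> h (frag_of x) = bt_hecke X (frag_of x)"
    and twist_h_hom: "(\<lambda>(H, L). bt_twist X L \<otimes> h H) \<in> hom twists T"
begin

interpretation h: group_hom divisors T h
  using h_hom by (simp add: group_hom_def group_hom_axioms_def divisors.is_group is_group)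

lemma h_closed: "div_supp H \<subseteq> D \<Longrightarrow> h H \<in> carrier T"
  using h.hom_closed[of H] by simp

text \<open>
  Induction on the degree of \<open>H\<close>, splitting off one point at a time by the rule \<open>hecke_add\<close>; all divisors
  that occur stay in \<open>hecke_divisors\<close>.
\<close>

lemma h_eq_hecke:
  assumes "H \<in> hecke_divisors D r"
  shows "h H = bt_hecke X H"
  using assms
proof (induction "nat (\<Sum>x\<in>D. div_coeff H x)" arbitrary: H rule: less_induct)
  case less
  have HD: "div_supp H \<subseteq> D" by (rule hecke_divisorsD[OF less.prems])
  have nonneg: "0 \<le> div_coeff H x" if "x \<in> D" for x
    using less.prems that by (simp add: hecke_divisors_def)
  show ?case
  proof (cases "H = 0")
    case True
    then show ?thesis using h.hom_one hecke_zero by simp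
  next
    case False
    then obtain x where xk: "x \<in> div_supp H" by (metis keys_eq_empty ex_in_conv)
    with HD nonneg have x: "x \<in> D" "div_coeff H x > 0" by (auto simp: in_keys_iff order_less_le)
    define K where "K = H - frag_of x"
    have K: "div_coeff K y = div_coeff H y - (if y = x then 1 else 0)" for y
      unfolding K_def by (simp add: lookup_minus lookup_frag_of)
    have "div_supp K \<subseteq> D" using keys_diff[of H "frag_of x"] HD x(1) unfolding K_def by auto
    then have Kh: "K \<in> hecke_divisors D r" using less.prems x(2) by (auto simp: hecke_divisors_def K)
    have "(\<Sum>y\<in>D. div_coeff K y) < (\<Sum>y\<in>D. div_coeff H y)"
      by (rule sum_strict_mono_ex1[OF finite_D]) (use x in \<open>auto simp: K\<close>)
    moreover have "0 \<le> (\<Sum>y\<in>D. div_coeff K y)"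
      using Kh by (intro sum_nonneg) (simp add: hecke_divisors_def)
    ultimately have IH: "h K = bt_hecke X K" by (intro less.hyps Kh) linarith
    have HK: "H = K + frag_of x" by (simp add: K_def)
    have "h H = h K \<otimes> h (frag_of x)"
      using h.hom_mult[of K "frag_of x"] hecke_divisorsD[OF Kh] x(1) by (simp add: HK)
    also have "\<dots> = bt_hecke X K \<otimes> bt_hecke X (frag_of x)" using IH h_frag_of[OF x(1)] by simp
    also have "\<dots> = bt_hecke X H"
      using hecke_add[OF Kh frag_of_hecke[OF x(1)]] less.prems by (simp add: HK)
    finally show ?thesis .
  qed
qed

abbreviation "twist_h \<equiv> (\<lambda>(H, L). bt_twist X L \<otimes> h H)"

lemmas twist_h_closed = hom_in_carrier[OF twist_h_hom]

text \<open>
  It suffices to check the relation of a single point, where it reads \<open>\<T>\<^bsub>\<O>(x)\<^esub> \<H>\<^sub>x\<^sup>r = \<T>\<^bsub>\<O>(x)\<^esub> \<T>\<^bsub>\<O>(-x)\<^esub> = 1\<close>.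
\<close>

lemma twist_h_relation:
  assumes "a \<in> relations"
  shows "twist_h a = \<one>"
proof -
  from relationE[OF assms] obtain H where H: "div_supp H \<subseteq> D"
    "a = (frag_cmul (int r) H, divisor_bundle X H)" .
  have "(twist_h \<circ> (\<lambda>H. (frag_cmul (int r) H, divisor_bundle X H))) H = (\<lambda>_. \<one>) H"
  proof (rule free_Abelian_group_hom_eqI[OF is_group _ _ _ H(1)])
    show "twist_h \<circ> (\<lambda>H. (frag_cmul (int r) H, divisor_bundle X H)) \<in> hom divisors T"
      by (rule Group.hom_compose[OF relations_hom twist_h_hom])
    show "(\<lambda>_. \<one>) \<in> hom divisors T" by (rule homI) auto
    fix x assume x: "x \<in> D"
    have k: "div_supp (frag_of x) \<subseteq> D" "div_supp (- frag_of x) \<subseteq> D" using x by auto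
    note d = divisor_bundle_in_Pic[OF marked_curve k(1)] divisor_bundle_in_Pic[OF marked_curve k(2)]
    have "h (frag_cmul (int r) (frag_of x)) = h (frag_of x) [^] r"
      using h.hom_nat_pow[of "frag_of x" r] x by simp
    also have "\<dots> = bt_twist X (divisor_bundle X (- frag_of x))"
      using h_frag_of[OF x] hecke_power[OF x] by simp
    finally have "twist_h (frag_cmul (int r) (frag_of x), divisor_bundle X (frag_of x)) =
        bt_twist X (divisor_bundle X (frag_of x + (- frag_of x)))"
      using twist_twist[OF d] divisor_bundle_add[OF marked_curve k] by simp
    also have "\<dots> = \<one>"
      using hom_one[OF divisor_bundle_hom divisors.is_group Pic.is_group]
        hom_one[OF twist_hom Pic.is_group is_group] by simp
    finally show "(twist_h \<circ> (\<lambda>H. (frag_cmul (int r) H, divisor_bundle X H))) (frag_of x) = \<one>" by simp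
  qed
  then show ?thesis by (simp add: H(2))
qed

text \<open>
  Conjugation by \<open>\<Sigma>\<^sub>\<sigma>\<close> and pullback of divisors induce homomorphisms on the free abelian group, so they
  are compared on single points.
\<close>

lemma pullback_h:
  assumes \<sigma>: "\<sigma> \<in> carrier aut" and H: "div_supp H \<subseteq> D"
  shows "bt_pullback X \<sigma> \<otimes> h H = h (div_pullback X \<sigma> H) \<otimes> bt_pullback X \<sigma>"
proof -
  note P = pullback_closed[OF \<sigma>] and k = keys_div_pullback[OF \<sigma> D_subset]
  have "((\<lambda>x. bt_pullback X \<sigma> \<otimes> x \<otimes> inv (bt_pullback X \<sigma>)) \<circ> h) H = (h \<circ> div_pullback X \<sigma>) H"
  proof (rule free_Abelian_group_hom_eqI[OF is_group _ _ _ H])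
    show "(\<lambda>x. bt_pullback X \<sigma> \<otimes> x \<otimes> inv (bt_pullback X \<sigma>)) \<circ> h \<in> hom divisors T"
      by (rule Group.hom_compose[OF h_hom conjugation_hom[OF P]])
    show "h \<circ> div_pullback X \<sigma> \<in> hom divisors T"
      by (rule Group.hom_compose[OF div_pullback_hom[OF \<sigma>] h_hom])
    fix x assume x: "x \<in> D"
    note f = frag_of_hecke[OF x]
    have "bt_pullback X \<sigma> \<otimes> bt_hecke X (frag_of x) \<otimes> inv (bt_pullback X \<sigma>) = bt_hecke X (div_pullback X \<sigma> (frag_of x))"
      using pullback_hecke[OF \<sigma> f]
        conjugation_eq_iff[OF P hecke_closed[OF f] hecke_closed[OF div_pullback_hecke[OF \<sigma> f]]] by simp
    then show "((\<lambda>x. bt_pullback X \<sigma> \<otimes> x \<otimes> inv (bt_pullback X \<sigma>)) \<circ> h) (frag_of x) = (h \<circ> div_pullback X \<sigma>) (frag_of x)"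
      using h_eq_hecke[OF f] h_eq_hecke[OF div_pullback_hecke[OF \<sigma> f]] by simp
  qed
  then show ?thesis using conjugation_eq_iff[OF P h_closed[OF H] h_closed[OF k[OF H]]] by simp
qed

lemma dual_h:
  assumes H: "div_supp H \<subseteq> D"
  shows "bt_dual X \<otimes> h H = h (- H) \<otimes> bt_dual X"
proof -
  note P = dual_closed
  have "((\<lambda>x. bt_dual X \<otimes> x \<otimes> inv (bt_dual X)) \<circ> h) H = (h \<circ> uminus) H"
  proof (rule free_Abelian_group_hom_eqI[OF is_group _ _ _ H])
    show "(\<lambda>x. bt_dual X \<otimes> x \<otimes> inv (bt_dual X)) \<circ> h \<in> hom divisors T"
      by (rule Group.hom_compose[OF h_hom conjugation_hom[OF P]])
    have "uminus \<in> hom divisors divisors" by (rule homI) auto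
    then show "h \<circ> uminus \<in> hom divisors T" by (rule Group.hom_compose[OF _ h_hom])
    fix x assume x: "x \<in> D"
    note f = hecke_closed[OF frag_of_hecke[OF x]]
    have "h (- frag_of x) = inv (bt_hecke X (frag_of x))"
      using h.hom_inv[of "frag_of x"] h_frag_of[OF x] x by simp
    then show "((\<lambda>x. bt_dual X \<otimes> x \<otimes> inv (bt_dual X)) \<circ> h) (frag_of x) = (h \<circ> uminus) (frag_of x)"
      using dual_hecke[OF x] conjugation_eq_iff[OF P f inv_closed[OF f]] h_frag_of[OF x] by simp
  qed
  then show ?thesis using conjugation_eq_iff[OF P h_closed[OF H] h_closed[of "- H"]] H by simp
qed

lemma pullback_twist_h:
  assumes \<sigma>: "\<sigma> \<in> carrier aut" and a: "a \<in> carrier twists"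
  shows "bt_pullback X \<sigma> \<otimes> twist_h a = twist_h (twist_pullback \<sigma> a) \<otimes> bt_pullback X \<sigma>"
proof -
  obtain H L where a': "a = (H, L)" "div_supp H \<subseteq> D" "L \<in> carrier (Pic X)" using a by auto
  note P = pullback_closed[OF \<sigma>]
  have p: "Pic_pullback X \<sigma> L \<in> carrier (Pic X)"
    by (rule hom_in_carrier[OF Pic_pullback_hom[OF X_subset autD(2)[OF \<sigma>]] a'(3)])
  note cl = P h_closed[OF a'(2)] h_closed[OF keys_div_pullback[OF \<sigma> D_subset a'(2)]] twist_closed[OF a'(3)]
    twist_closed[OF p]
  have "bt_pullback X \<sigma> \<otimes> (bt_twist X L \<otimes> h H) = bt_twist X (Pic_pullback X \<sigma> L) \<otimes> (bt_pullback X \<sigma> \<otimes> h H)"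
    using cl pullback_twist[OF \<sigma> a'(3)] by (simp flip: m_assoc)
  also have "\<dots> = bt_twist X (Pic_pullback X \<sigma> L) \<otimes> h (div_pullback X \<sigma> H) \<otimes> bt_pullback X \<sigma>"
    using cl pullback_h[OF \<sigma> a'(2)] by (simp add: m_assoc)
  finally show ?thesis by (simp add: a'(1) twist_pullback_def)
qed

lemma dual_twist_h:
  assumes a: "a \<in> carrier twists"
  shows "bt_dual X \<otimes> twist_h a = twist_h (inv\<^bsub>twists\<^esub> a) \<otimes> bt_dual X"
proof -
  obtain H L where a': "a = (H, L)" "div_supp H \<subseteq> D" "L \<in> carrier (Pic X)" using a by auto
  have k: "div_supp (- H) \<subseteq> D" using a'(2) by simp
  note cl = dual_closed h_closed[OF a'(2)] h_closed[OF k] twist_closed[OF a'(3)]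
    twist_closed[OF Pic.inv_closed[OF a'(3)]]
  have "bt_dual X \<otimes> (bt_twist X L \<otimes> h H) = bt_twist X (inv\<^bsub>Pic X\<^esub> L) \<otimes> (bt_dual X \<otimes> h H)"
    using cl dual_twist[OF a'(3)] by (simp flip: m_assoc)
  also have "\<dots> = bt_twist X (inv\<^bsub>Pic X\<^esub> L) \<otimes> h (- H) \<otimes> bt_dual X"
    using cl dual_h[OF a'(2)] by (simp add: m_assoc)
  finally show ?thesis
    using a' by (simp add: inv_DirProd[OF divisors.is_group Pic.is_group])
qed

definition "symmetry_transformation = (\<lambda>(\<sigma>, e :: int). bt_pullback X (inv\<^bsub>aut\<^esub> \<sigma>) \<otimes> (if e = 0 then \<one> else bt_dual X))"

lemma symmetry_transformation_hom: "symmetry_transformation \<in> hom symmetries T"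
proof (rule homI)
  fix q assume q: "q \<in> carrier symmetries"
  from symmetriesE[OF q] obtain \<sigma> e where s: "q = (\<sigma>, e)" "\<sigma> \<in> carrier aut" "e = 0 \<or> e = 1" .
  note i = aut.inv_closed[OF s(2)]
  show "symmetry_transformation q \<in> carrier T"
    using pullback_closed[OF i] dual_closed by (auto simp: symmetry_transformation_def s(1))
  fix q' assume q': "q' \<in> carrier symmetries"
  from symmetriesE[OF q'] obtain \<tau> e' where t: "q' = (\<tau>, e')" "\<tau> \<in> carrier aut" "e' = 0 \<or> e' = 1" .
  note i' = aut.inv_closed[OF t(2)]
  let ?P = "bt_pullback X (inv\<^bsub>aut\<^esub> \<sigma>)" and ?R = "bt_pullback X (inv\<^bsub>aut\<^esub> \<tau>)"
  have PR: "bt_pullback X (inv\<^bsub>aut\<^esub> (\<sigma> \<otimes>\<^bsub>aut\<^esub> \<tau>)) = ?P \<otimes> ?R"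
    unfolding aut.inv_mult_group[OF s(2) t(2)] by (rule pullback_pullback[OF i i', symmetric])
  note cl = pullback_closed[OF i] pullback_closed[OF i'] dual_closed
  have DR: "?P \<otimes> bt_dual X \<otimes> (?R \<otimes> a) = ?P \<otimes> ?R \<otimes> (bt_dual X \<otimes> a)" if a: "a \<in> carrier T" for a
  proof -
    have "?P \<otimes> bt_dual X \<otimes> (?R \<otimes> a) = ?P \<otimes> (bt_dual X \<otimes> ?R) \<otimes> a" using cl a by (simp add: m_assoc)
    also have "\<dots> = ?P \<otimes> ?R \<otimes> (bt_dual X \<otimes> a)" unfolding dual_pullback[OF i'] using cl a by (simp add: m_assoc)
    finally show ?thesis .
  qed
  show "symmetry_transformation (q \<otimes>\<^bsub>symmetries\<^esub> q') = symmetry_transformation q \<otimes> symmetry_transformation q'"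
    using s(3) t(3) DR[OF one_closed] DR[OF dual_closed] cl dual_dual
    by (elim disjE) (simp_all add: symmetry_transformation_def s(1) t(1) PR m_assoc)
qed

lemma symmetry_transformation_conjugates:
  assumes q: "q \<in> carrier symmetries" and a: "a \<in> carrier twists"
  shows "twist_h (twist_symmetry q a) \<otimes> symmetry_transformation q = symmetry_transformation q \<otimes> twist_h a"
proof -
  from symmetriesE[OF q] obtain \<sigma> e where s: "q = (\<sigma>, e)" "\<sigma> \<in> carrier aut" "e = 0 \<or> e = 1" .
  note i = aut.inv_closed[OF s(2)] and ia = twists.inv_closed[OF a]
  note cl = pullback_closed[OF i] dual_closed twist_h_closed[OF a] twist_h_closed[OF ia]
    twist_h_closed[OF twist_pullback_closed[OF i a]] twist_h_closed[OF twist_pullback_closed[OF i ia]]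
  let ?P = "bt_pullback X (inv\<^bsub>aut\<^esub> \<sigma>)"
  show ?thesis
    using s(3)
  proof
    assume "e = 0"
    then have "twist_symmetry q a = twist_pullback (inv\<^bsub>aut\<^esub> \<sigma>) a" "symmetry_transformation q = ?P"
      using cl by (simp_all add: twist_symmetry_def symmetry_transformation_def s(1))
    then show ?thesis using pullback_twist_h[OF i a] by metis
  next
    assume "e = 1"
    then have e: "twist_symmetry q a = twist_pullback (inv\<^bsub>aut\<^esub> \<sigma>) (inv\<^bsub>twists\<^esub> a)"
      "symmetry_transformation q = ?P \<otimes> bt_dual X"
      using cl twist_pullback_inv[OF i a] by (simp_all add: twist_symmetry_def symmetry_transformation_def s(1) del: inv_DirProd)
    have "?P \<otimes> bt_dual X \<otimes> twist_h a = ?P \<otimes> (bt_dual X \<otimes> twist_h a)"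
      by (rule m_assoc[OF cl(1-3)])
    also have "\<dots> = ?P \<otimes> (twist_h (inv\<^bsub>twists\<^esub> a) \<otimes> bt_dual X)" by (simp only: dual_twist_h[OF a])
    also have "\<dots> = ?P \<otimes> twist_h (inv\<^bsub>twists\<^esub> a) \<otimes> bt_dual X"
      by (rule m_assoc[OF cl(1,4,2), symmetric])
    also have "\<dots> = twist_h (twist_pullback (inv\<^bsub>aut\<^esub> \<sigma>) (inv\<^bsub>twists\<^esub> a)) \<otimes> ?P \<otimes> bt_dual X"
      by (simp only: pullback_twist_h[OF i ia])
    also have "\<dots> = twist_h (twist_pullback (inv\<^bsub>aut\<^esub> \<sigma>) (inv\<^bsub>twists\<^esub> a)) \<otimes> (?P \<otimes> bt_dual X)"
      by (rule m_assoc[OF cl(6,1,2)])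
    finally show ?thesis unfolding e by (rule sym)
  qed
qed

text \<open>
  The homomorphisms on twists and on symmetries combine to a homomorphism \<open>\<psi>\<close> from the semidirect
  product. The normal form rules of \<open>T\<close> say that \<open>\<psi>\<close> sends \<open>normal_form x\<close> to the tuple \<open>x\<close> itself, and
  \<open>normal_form\<close> is bijective, so \<open>\<psi>\<close> is its inverse.
\<close>

lemma iso_semidirect_of_hecke_hom: "T \<cong> semidirect"
proof -
  interpret t: group_hom twists T twist_h
    using twist_h_hom by (simp add: group_hom_def group_hom_axioms_def twists.is_group is_group)
  have "relations \<subseteq> kernel twists T twist_h"
    unfolding kernel_def using twist_h_relation relations.mem_carrier by blast
  from t.FactGroup_universal_kernel[OF relations.normal_axioms this]
  obtain f where f: "f \<in> hom twist_quotient T" "\<And>a. a \<in> carrier twists \<Longrightarrow> f (twist_class a) = twist_h a"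
    unfolding twisting_quotient_def by blast
  define \<psi> where "\<psi> = (\<lambda>(c, q). f c \<otimes> symmetry_transformation q)"
  have conj: "f (action q c) \<otimes> symmetry_transformation q = symmetry_transformation q \<otimes> f c"
    if q: "q \<in> carrier symmetries" and c: "c \<in> carrier twist_quotient" for q c
  proof -
    from twist_quotientE[OF c] obtain a where a: "a \<in> carrier twists" "c = twist_class a" .
    show ?thesis
      unfolding a(2) action_twist_class[OF q a(1)] f(2)[OF a(1)] f(2)[OF twist_symmetry_closed[OF q a(1)]]
      by (rule symmetry_transformation_conjugates[OF q a(1)])
  qed
  have \<psi>: "\<psi> \<in> hom semidirect T"
    unfolding \<psi>_def
    by (rule semidirect_product_hom[OF is_group f(1) symmetry_transformation_hom action_closed conj])
  have id: "\<psi> (normal_form x) = x" if x: "x \<in> basic_transformations X D r" for x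
  proof -
    obtain \<sigma> s L H where x': "x = (\<sigma>, s, L, H)" "\<sigma> \<in> carrier aut" "s = 1 \<or> s = -1" "L \<in> carrier (Pic X)"
      "H \<in> hecke_divisors D r" using x unfolding basic_transformations_def by auto
    note q = symmetry_of_closed[OF x'(2), of s] and a = hecke_twist_closed[OF x'(5,4)]
    note cl = pullback_closed[OF x'(2)] dual_closed twist_closed[OF x'(4)] hecke_closed[OF x'(5)]
    have "\<psi> (normal_form x) = f (action (symmetry_of \<sigma> s) (twist_class (H, L))) \<otimes> symmetry_transformation (symmetry_of \<sigma> s)"
      by (simp add: \<psi>_def normal_form_def x'(1))
    also have "\<dots> = symmetry_transformation (symmetry_of \<sigma> s) \<otimes> f (twist_class (H, L))"
      by (rule conj[OF q twist_class_closed[OF a]])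
    also have "f (twist_class (H, L)) = bt_twist X L \<otimes> bt_hecke X H"
      unfolding f(2)[OF a] using h_eq_hecke[OF x'(5)] by simp
    also have "symmetry_transformation (symmetry_of \<sigma> s) =
        bt_pullback X \<sigma> \<otimes> (if s = 1 then \<one> else bt_dual X)"
      using x'(2) by (simp add: symmetry_transformation_def symmetry_of_def)
    also have "\<dots> \<otimes> (bt_twist X L \<otimes> bt_hecke X H) = x"
      using x'(3) normal_form_plus[OF x'(2,4,5)] normal_form_minus[OF x'(2,4,5)] cl
      by (auto simp: x'(1) m_assoc)
    finally show ?thesis .
  qed
  have "bij_betw \<psi> (carrier semidirect) (carrier T)"
    unfolding carrier_eq
  proof (rule bij_betw_imageI)
    have img: "normal_form ` basic_transformations X D r = carrier semidirect"
      using bij_betw_normal_form by (simp add: bij_betw_def)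
    show "inj_on \<psi> (carrier semidirect)" unfolding img[symmetric] 
      by (rule inj_on_imageI, rule inj_onI) (simp add: id)
    show "\<psi> ` carrier semidirect = basic_transformations X D r"
      unfolding img[symmetric] image_image using id by simp
  qed
  with \<psi> have "\<psi> \<in> iso semidirect T" by (simp add: iso_def)
  then have "semidirect \<cong> T" unfolding is_iso_def by blast
  then show ?thesis by (rule semidirect.iso_sym)
qed

end

lemma iso_semidirect: "T \<cong> semidirect"
  by (rule hecke_hom_exists) (rule iso_semidirect_of_hecke_hom)

end

theorem proposition5p8:
  fixes X D :: "(complex ^ 'n::finite) set set" and r :: nat
  assumes "marked_curve X D" and "r \<ge> 2"
  shows "(\<exists>T. basic_transformation_group X D r T) \<and>
    (\<forall>T. basic_transformation_group X D r T \<longrightarrow>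
      T \<cong> semidirect_product
            ((free_Abelian_group D \<times>\<times> Pic X) Mod twisting_subgroup X D r)
            (aut_group X D \<times>\<times> integer_mod_group 2)
            (twisting_action X D r))"
proof (intro conjI allI impI)
  have curve: "marked_curve_rank X D r" using assms by (rule marked_curve_rank.intro)
  then show "\<exists>T. basic_transformation_group X D r T"
    by (rule marked_curve_rank.basic_transformation_group_exists)
  fix T assume "basic_transformation_group X D r T"
  with curve have "basic_transformation_group_on_curve X D r T"
    by (rule basic_transformation_group_on_curve.intro)
  from basic_transformation_group_on_curve.iso_semidirect[OF this]
  show "T \<cong> semidirect_product
            ((free_Abelian_group D \<times>\<times> Pic X) Mod twisting_subgroup X D r)
            (aut_group X D \<times>\<times> integer_mod_group 2)
            (twisting_action X D r)"
    unfolding twisting_quotient_def .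
qed

end
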